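(* Let $(H,A,C)$ be a monoidal Doi-Hopf datum with $C$ finite dimensional, and let $Q:C\otimes C\to A\otimes A$ be a twisted convolution invertible map satisfying, for all $a\in A$ and $c,d,e\in C$: (1) $Q(a_{2(1)}\cdot d,\ a_{1(1)}\cdot c)\,(\alpha_A(a_{2(0)})\otimes\alpha_A(a_{1(0)}))=\Delta(\alpha_A^2(a))\,Q(\alpha_C(d),\alpha_C(c))$; (2) $Q(d_1,c_1)\otimes\alpha_C^{-3}(c_2d_2)=Q(\alpha_C^{-1}(d_2),\alpha_C^{-1}(c_2))_{(0)}\otimes\alpha_C^{-4}\circ m_C\big(Q(\alpha_C^{-1}(d_2),\alpha_C^{-1}(c_2))_{(1)}\cdot(d_1\otimes c_1)\big)$; (3) $(\Delta\otimes\alpha_A)Q(\alpha_C^{-2}(d)\alpha_C^{-1}(e),\ \alpha_C^{-1}(c))=\alpha_A^2Q^1(\alpha_C^{-2}(d),\alpha_C^{-3}(c_2))\otimes q\big(e,\ \alpha_H^{-1}(Q^2(\alpha_C^{-2}(d),\alpha_C^{-3}(c_2))_{(1)})\cdot\alpha_C^{-3}(c_1)\big)\big(1\otimes Q^2(\alpha_C^{-2}(d),\alpha_C^{-3}(c_2))_{(0)}\big)$; (4) $(\alpha_A\otimes\Delta)Q(\alpha_C^{-1}(e),\ \alpha_C^{-1}(c)\alpha_C^{-2}(d))=q\big(\alpha_H^{-1}(Q^1(\alpha_C^{-3}(e_2),\alpha_C^{-2}(d))_{(1)})\cdot\alpha_C^{-3}(e_1),\ c\big)\big(Q^1(\alpha_C^{-3}(e_2),\alpha_C^{-2}(d))_{(0)}\otimes1\big)\otimes\alpha_A^2\big(Q^2(\alpha_C^{-3}(e_2),\alpha_C^{-2}(d))\big)$.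 Then the Hom-bialgebra $A\#C^*$ is quasitriangular.
   Context: Work over a field $k$, $\otimes=\otimes_k$. All structure maps $\alpha$ below are assumed bijective. Hom-algebra $(A,\alpha_A)$: a linear multiplication, a unit $1_A$ and a linear $\alpha_A:A\to A$ with $\alpha_A(ab)=\alpha_A(a)\alpha_A(b)$, $\alpha_A(1_A)=1_A$, $1_Aa=\alpha_A(a)=a1_A$, $\alpha_A(a)(bc)=(ab)\alpha_A(c)$. Hom-coalgebra $(C,\alpha_C)$: linear $\Delta:C\to C\otimes C$, $\Delta(c)=c_1\otimes c_2$, $\varepsilon:C\to k$ and $\alpha_C$ with $\varepsilon\circ\alpha_C=\varepsilon$, $(\alpha_C\otimes\alpha_C)\Delta=\Delta\alpha_C$, $(\varepsilon\otimes id)\Delta=\alpha_C=(id\otimes\varepsilon)\Delta$, $(\Delta\otimes\alpha_C)\Delta=(\alpha_C\otimes\Delta)\Delta$. Hom-bialgebra: a Hom-algebra and Hom-coalgebra with the same $\alpha$ such that $\Delta,\varepsilon$ are Hom-algebra morphisms. Hom-Hopf algebra: a Hom-bialgebra with a linear $S$, $S\alpha=\alpha S$, $S(h_1)h_2=h_1S(h_2)=\varepsilon(h)1$. A Hom-bialgebra $(B,\alpha_B)$ is quasitriangular if there is $R=R^1\otimes R^2\in B\otimes B$ with $\Delta^{op}(b)R=R\Delta(b)$ for all $b$, $(\Delta\otimes\alpha_B)R=R^{13}R^{23}$, $(\alpha_B\otimes\Delta)R=R^{13}R^{12}$, where $R^{12}=R^1\otimes R^2\otimes1$, $R^{13}=R^1\otimes1\otimes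 R^2$, $R^{23}=1\otimes R^1\otimes R^2$. Left $A$-module $(M,\alpha_M)$: linear $A\otimes M\to M$ with $1_A\cdot m=\alpha_M(m)$, $\alpha_M(a\cdot m)=\alpha_A(a)\cdot\alpha_M(m)$, $\alpha_A(a)\cdot(b\cdot m)=(ab)\cdot\alpha_M(m)$. Right $C$-comodule $(M,\alpha_M)$: linear $\rho:M\to M\otimes C$, $\rho(m)=m_{(0)}\otimes m_{(1)}$, with $(id\otimes\varepsilon)\rho=\alpha_M$, $(\alpha_M\otimes\alpha_C)\rho=\rho\alpha_M$, $(\rho\otimes\alpha_C)\rho=(\alpha_M\otimes\Delta)\rho$. A (Hom-type) Doi-Hopf datum $(H,A,C)$ consists of a Hom-Hopf algebra $(H,\alpha_H)$, a right $H$-comodule algebra $(A,\alpha_A)$ (a Hom-algebra and right $H$-comodule, $\rho(a)=a_{(0)}\otimes a_{(1)}$, with $\rho(ab)=\rho(a)\rho(b)$, $\rho(1_A)=1_A\otimes1_H$) and a left $H$-module coalgebra $(C,\alpha_C)$ (a Hom-coalgebra and left $H$-module with $\Delta_C(h\cdot c)=h_1\cdot c_1\otimes h_2\cdot c_2$, $\varepsilon_C(h\cdot c)=\varepsilon_H(h)\varepsilon_C(c)$). It is monoidal if $A$ and $C$ are Hom-bialgebras and $a_{(0)1}\otimes a_{(0)2}\otimes\alpha_H^2(a_{(1)})\cdot(cd)=a_{1(0)}\otimes a_{2(0)}\otimes(a_{1(1)}\cdot c)(a_{2(1)}\cdot d)$, $\varepsilon(a)1_C=\varepsilon(a_{(0)})a_{(1)}\cdot1_C$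 for all $a\in A$, $c,d\in C$. Conventions on $Q$: $Q$ is a linear map with $Q\circ\alpha_C^{\otimes2}=\alpha_A^{\otimes2}\circ Q$, written $Q(c,d)=q(c,d)=Q^1(c,d)\otimes Q^2(c,d)$ ($q$ denotes a second copy of $Q$). It is twisted convolution invertible if there is a linear $R:C\otimes C\to A\otimes A$ with $Q(c_2,d_2)R(c_1,d_1)=\varepsilon(c)\varepsilon(d)1\otimes1=R(c_2,d_2)Q(c_1,d_1)$ for all $c,d\in C$. Products in $A\otimes A$ are componentwise. For $a\otimes b\in A\otimes A$, $(a\otimes b)_{(0)}\otimes(a\otimes b)_{(1)}=a_{(0)}\otimes b_{(0)}\otimes a_{(1)}\otimes b_{(1)}\in A\otimes A\otimes H\otimes H$, $H\otimes H$ acts componentwise on $C\otimes C$, and $m_C$ is the multiplication of $C$. $C^*$ has structure map $\alpha_{C^*}=(\alpha_C^{-1})^*$, unit $\varepsilon_C$, product $\langle fg,c\rangle=\langle f,\alpha_C^{-2}(c_1)\rangle\langle g,\alpha_C^{-2}(c_2)\rangle$, coproduct $\langle f_1,c\rangle\langle f_2,d\rangle=\langle f,\alpha_C^{-2}(cd)\rangle$ and counit $f\mapsto f(1_C)$; $H$ acts on it on the right by $\langle f\leftharpoonup h,c\rangle=\langle f,h\cdot\alpha_C^{-2}(c)\rangle$. The Hom-bialgebra $(A\#C^*,\alpha_A\otimes\alpha_{C^*})$ is $A\otimes C^*$ as a space, with unit $1_A\#\varepsilon_C$, product $$(a\#f)(a'\#f')=a\,\alpha_A^{-1}(a'_{(0)})\#\big(\alpha_{C^*}^{-1}(f)\leftharpoonup\alpha_H^{-2}(a'_{(1)})\big)f',$$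 coproduct $\Delta(a\#f)=(a_1\#f_1)\otimes(a_2\#f_2)$ and counit $\varepsilon(a\#f)=\varepsilon_A(a)f(1_C)$. *)

theory Defs
  imports Complex_Main "HOL-Library.Function_Algebras"
begin

section \<open>Vector spaces and linear maps on carriers\<close>

text \<open>The ground field is a type of class \<^class>\<open>field\<close>.  A vector space is a linear subspace
  (the carrier) of a type with an abelian group structure and a scalar multiplication; carriers are
  needed because duals and tensor products are proper subspaces of function types.\<close>

record ('k, 'a) vspace =
  carrier :: "'a set"
  smul :: "'k \<Rightarrow> 'a \<Rightarrow> 'a"

locale vspace = vector_space "smul V"
  for V :: "('k::field, 'a::ab_group_add, 'z) vspace_scheme" +
  assumes carrier_subspace: "subspace (carrier V)"

definition finite_dimensional :: "('k::field, 'a::ab_group_add, 'z) vspace_scheme \<Rightarrow> bool" where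
  "finite_dimensional V \<longleftrightarrow> (\<exists>S. finite S \<and> carrier V = module.span (smul V) S)"

definition ground :: "('k::field, 'k) vspace" where
  "ground = \<lparr>carrier = UNIV, smul = (*)\<rparr>"

definition lin_on ::
  "('k::field, 'a::ab_group_add, 'z) vspace_scheme \<Rightarrow> ('k, 'b::ab_group_add, 'y) vspace_scheme
    \<Rightarrow> ('a \<Rightarrow> 'b) \<Rightarrow> bool" where
  "lin_on V W f \<longleftrightarrow>
     (\<forall>x\<in>carrier V. f x \<in> carrier W) \<and>
     (\<forall>x\<in>carrier V. \<forall>y\<in>carrier V. f (x + y) = f x + f y) \<and>
     (\<forall>r. \<forall>x\<in>carrier V. f (smul V r x) = smul W r (f x))"

definition bilin_on ::
  "('k::field, 'a::ab_group_add, 'z) vspace_scheme \<Rightarrow> ('k, 'b::ab_group_add, 'y) vspace_scheme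
    \<Rightarrow> ('k, 'c::ab_group_add, 'x) vspace_scheme \<Rightarrow> ('a \<Rightarrow> 'b \<Rightarrow> 'c) \<Rightarrow> bool" where
  "bilin_on V W U f \<longleftrightarrow>
     (\<forall>v\<in>carrier V. lin_on W U (f v)) \<and> (\<forall>w\<in>carrier W. lin_on V U (\<lambda>v. f v w))"

section \<open>Tensor products\<close>

text \<open>The pure tensor of \<open>v\<close> and \<open>w\<close> is evaluation at \<open>(v, w)\<close> on the bilinear forms, and the
  tensor product is the span of the pure tensors.  The universal property is proved below
  (\<open>sweedler_tens\<close>, \<open>sweedler_lin_on\<close>, \<open>tensor_induct\<close>).\<close>

type_synonym ('a, 'b, 'k) tensor = "('a \<Rightarrow> 'b \<Rightarrow> 'k) \<Rightarrow> 'k"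

definition tens ::
  "('k::field, 'a::ab_group_add, 'z) vspace_scheme \<Rightarrow> ('k, 'b::ab_group_add, 'y) vspace_scheme
    \<Rightarrow> 'a \<Rightarrow> 'b \<Rightarrow> ('a, 'b, 'k) tensor" where
  "tens V W v w = (\<lambda>\<beta>. if bilin_on V W ground \<beta> then \<beta> v w else 0)"

definition fun_smul :: "'k::field \<Rightarrow> ('i \<Rightarrow> 'k) \<Rightarrow> 'i \<Rightarrow> 'k" where
  "fun_smul r f = (\<lambda>i. r * f i)"

definition tensor ::
  "('k::field, 'a::ab_group_add, 'z) vspace_scheme \<Rightarrow> ('k, 'b::ab_group_add, 'y) vspace_scheme
    \<Rightarrow> ('k, ('a, 'b, 'k) tensor) vspace" where
  "tensor V W =
     \<lparr>carrier = module.span fun_smul {tens V W v w | v w. v \<in> carrier V \<and> w \<in> carrier W},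
      smul = fun_smul\<rparr>"

text \<open>\<open>sweedler V W t (\<lambda>x y. e)\<close> is the value on \<open>t\<close> of the linear map induced by the
  bilinear map \<open>\<lambda>x y. e\<close>, that is, \<open>e\<close> with \<open>t\<close> written as \<open>x \<otimes> y\<close> in Sweedler notation.
  The choice of the representing sum is immaterial by \<open>sweedler_eq\<close> below.\<close>

definition represents ::
  "('k::field, 'a::ab_group_add, 'z) vspace_scheme \<Rightarrow> ('k, 'b::ab_group_add, 'y) vspace_scheme
    \<Rightarrow> ('a \<times> 'b) list \<Rightarrow> ('a, 'b, 'k) tensor \<Rightarrow> bool" where
  "represents V W ps t \<longleftrightarrow>
     set ps \<subseteq> carrier V \<times> carrier W \<and> t = (\<Sum>(v, w)\<leftarrow>ps. tens V W v w)"

definition sweedler ::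
  "('k::field, 'a::ab_group_add, 'z) vspace_scheme \<Rightarrow> ('k, 'b::ab_group_add, 'y) vspace_scheme
    \<Rightarrow> ('a, 'b, 'k) tensor \<Rightarrow> ('a \<Rightarrow> 'b \<Rightarrow> 'c::ab_group_add) \<Rightarrow> 'c" where
  "sweedler V W t f = (\<Sum>(v, w)\<leftarrow>(SOME ps. represents V W ps t). f v w)"

definition tens3 ::
  "('k::field, 'a::ab_group_add, 'z) vspace_scheme \<Rightarrow> ('k, 'b::ab_group_add, 'y) vspace_scheme
    \<Rightarrow> ('k, 'c::ab_group_add, 'x) vspace_scheme \<Rightarrow> 'a \<Rightarrow> 'b \<Rightarrow> 'c
    \<Rightarrow> ('a, ('b, 'c, 'k) tensor, 'k) tensor" where
  "tens3 U V W u v w = tens U (tensor V W) u (tens V W v w)"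

definition tensor_map ::
  "('k::field, 'a::ab_group_add, 'z) vspace_scheme \<Rightarrow> ('k, 'b::ab_group_add, 'y) vspace_scheme
    \<Rightarrow> ('k, 'c::ab_group_add, 'x) vspace_scheme \<Rightarrow> ('k, 'd::ab_group_add, 'w) vspace_scheme
    \<Rightarrow> ('a \<Rightarrow> 'c) \<Rightarrow> ('b \<Rightarrow> 'd) \<Rightarrow> ('a, 'b, 'k) tensor \<Rightarrow> ('c, 'd, 'k) tensor" where
  "tensor_map V W V' W' f g t = sweedler V W t (\<lambda>v w. tens V' W' (f v) (g w))"

definition flip ::
  "('k::field, 'a::ab_group_add, 'z) vspace_scheme \<Rightarrow> ('k, 'b::ab_group_add, 'y) vspace_scheme
    \<Rightarrow> ('a, 'b, 'k) tensor \<Rightarrow> ('b, 'a, 'k) tensor" where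
  "flip V W t = sweedler V W t (\<lambda>v w. tens W V w v)"

lemma vspace_fun: "vector_space (fun_smul :: 'k::field \<Rightarrow> ('i \<Rightarrow> 'k) \<Rightarrow> 'i \<Rightarrow> 'k)"
  by unfold_locales (auto simp: fun_smul_def fun_eq_iff algebra_simps)

lemma vspace_ground: "vspace (ground :: ('k::field, 'k) vspace)"
proof -
  have *: "vector_space ((*) :: 'k \<Rightarrow> 'k \<Rightarrow> 'k)"
    by unfold_locales (auto simp: algebra_simps)
  show ?thesis
    unfolding vspace_def vspace_axioms_def ground_def
    using * module.subspace_UNIV[of "(*) :: 'k \<Rightarrow> 'k \<Rightarrow> 'k"]
    by (simp add: module_iff_vector_space)
qed

lemma vspace_tensor:
  fixes V :: "('k::field, 'a::ab_group_add, 'z) vspace_scheme"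
    and W :: "('k, 'b::ab_group_add, 'y) vspace_scheme"
  shows "vspace (tensor V W)"
proof -
  interpret F: vector_space "fun_smul :: 'k \<Rightarrow> (('a \<Rightarrow> 'b \<Rightarrow> 'k) \<Rightarrow> 'k) \<Rightarrow> _"
    by (rule vspace_fun)
  show ?thesis
    unfolding vspace_def vspace_axioms_def tensor_def
    by (simp add: F.subspace_span F.vector_space_axioms)
qed

lemma tens_in_tensor:
  fixes V :: "('k::field, 'a::ab_group_add, 'z) vspace_scheme"
    and W :: "('k, 'b::ab_group_add, 'y) vspace_scheme"
  assumes "v \<in> carrier V" "w \<in> carrier W"
  shows "tens V W v w \<in> carrier (tensor V W)"
proof -
  interpret F: vector_space "fun_smul :: 'k \<Rightarrow> (('a \<Rightarrow> 'b \<Rightarrow> 'k) \<Rightarrow> 'k) \<Rightarrow> _"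
    by (rule vspace_fun)
  show ?thesis
    using assms unfolding tensor_def by (auto intro!: F.span_base)
qed

lemma tens_bilin_on:
  fixes V :: "('k::field, 'a::ab_group_add, 'z) vspace_scheme"
    and W :: "('k, 'b::ab_group_add, 'y) vspace_scheme"
  shows "bilin_on V W (tensor V W) (tens V W)"
  unfolding bilin_on_def[of V W "tensor V W"] lin_on_def[of _ "tensor V W"]
  by (auto simp: tens_in_tensor)
    (auto simp: tens_def tensor_def fun_smul_def fun_eq_iff bilin_on_def lin_on_def ground_def)

lemma represents_exists:
  fixes V :: "('k::field, 'a::ab_group_add, 'z) vspace_scheme"
    and W :: "('k, 'b::ab_group_add, 'y) vspace_scheme"
  assumes "vspace V" "t \<in> carrier (tensor V W)"
  shows "\<exists>ps. represents V W ps t"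
proof -
  interpret V: vspace V by fact
  interpret F: vector_space "fun_smul :: 'k \<Rightarrow> (('a \<Rightarrow> 'b \<Rightarrow> 'k) \<Rightarrow> 'k) \<Rightarrow> _"
    by (rule vspace_fun)
  have "t \<in> F.span {tens V W v w | v w. v \<in> carrier V \<and> w \<in> carrier W}"
    using assms(2) by (simp add: tensor_def)
  then show ?thesis
  proof (induction rule: F.span_induct_alt)
    case base
    have "represents V W [] 0" by (simp add: represents_def)
    then show ?case by blast
  next
    case (step r x y)
    then obtain v w ps where vw: "v \<in> carrier V" "w \<in> carrier W" "x = tens V W v w"
      and ps: "represents V W ps y" by blast
    have "fun_smul r x = tens V W (smul V r v) w"
      using tens_bilin_on[of V W] vw by (simp add: bilin_on_def lin_on_def tensor_def)
    moreover have "smul V r v \<in> carrier V"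
      using vw V.carrier_subspace by (simp add: V.subspace_scale)
    ultimately have "represents V W ((smul V r v, w) # ps) (fun_smul r x + y)"
      using ps vw by (simp add: represents_def)
    then show ?case by blast
  qed
qed

lemma represented_sum_unique:
  fixes V :: "('k::field, 'a::ab_group_add, 'z) vspace_scheme"
    and W :: "('k, 'b::ab_group_add, 'y) vspace_scheme"
    and U :: "('k, 'u::ab_group_add, 'x) vspace_scheme"
  assumes U: "vspace U" and f: "bilin_on V W U f"
    and ps: "represents V W ps t" and qs: "represents V W qs t"
  shows "(\<Sum>(v, w)\<leftarrow>ps. f v w) = (\<Sum>(v, w)\<leftarrow>qs. f v w)"
proof (rule ccontr)
  let ?d = "(\<Sum>(v, w)\<leftarrow>ps. f v w) - (\<Sum>(v, w)\<leftarrow>qs. f v w)"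
  assume "\<not> ?thesis"
  then have d: "?d \<noteq> 0" by simp
  interpret U: vspace U by fact
  interpret K: vspace "ground :: ('k, 'k) vspace" by (rule vspace_ground)
  interpret P: vector_space_pair "smul U" "smul (ground :: ('k, 'k) vspace)" ..
  have "U.independent {?d}" using d by simp
  then obtain \<phi> where \<phi>: "Vector_Spaces.linear (smul U) (smul ground) \<phi>" "\<phi> ?d = (1 :: 'k)"
    using P.linear_independent_extend[of "{?d}" "\<lambda>_. 1"] by auto
  interpret \<phi>: Vector_Spaces.linear "smul U" "smul ground" \<phi> by (rule \<phi>(1))
  let ?\<beta> = "\<lambda>v w. \<phi> (f v w)"
  have \<beta>: "bilin_on V W ground ?\<beta>"
    using f by (auto simp: bilin_on_def lin_on_def \<phi>.add \<phi>.scale) (auto simp: ground_def)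
  have *: "\<phi> (\<Sum>(v, w)\<leftarrow>rs. f v w) = (\<Sum>(v, w)\<leftarrow>rs. tens V W v w) ?\<beta>" for rs
    by (induction rs) (auto simp: \<phi>.zero \<phi>.add tens_def \<beta>)
  have "(\<Sum>(v, w)\<leftarrow>ps. tens V W v w) = (\<Sum>(v, w)\<leftarrow>qs. tens V W v w)"
    using ps qs unfolding represents_def by metis
  then have "\<phi> (\<Sum>(v, w)\<leftarrow>ps. f v w) = \<phi> (\<Sum>(v, w)\<leftarrow>qs. f v w)"
    unfolding * by (rule arg_cong)
  then have "\<phi> ?d = 0"
    unfolding \<phi>.diff by (simp only: diff_self)
  then show False
    using \<phi>(2) by (metis zero_neq_one)
qed

lemma sweedler_eq:
  assumes "vspace U" "bilin_on V W U f" "represents V W ps t"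
  shows "sweedler V W t f = (\<Sum>(v, w)\<leftarrow>ps. f v w)"
proof -
  have "represents V W (SOME ps. represents V W ps t) t"
    using assms(3) by (rule someI)
  from represented_sum_unique[OF assms(1,2) this assms(3)] show ?thesis
    by (simp only: sweedler_def)
qed

lemma sweedler_tens:
  assumes "vspace U" "bilin_on V W U f" "v \<in> carrier V" "w \<in> carrier W"
  shows "sweedler V W (tens V W v w) f = f v w"
  using sweedler_eq[OF assms(1,2), of "[(v, w)]"] assms(3,4) by (simp add: represents_def)

lemma sweedler_lin_on:
  fixes V :: "('k::field, 'a::ab_group_add, 'z) vspace_scheme"
    and W :: "('k, 'b::ab_group_add, 'y) vspace_scheme"
    and U :: "('k, 'u::ab_group_add, 'x) vspace_scheme"
  assumes V: "vspace V" and U: "vspace U" and f: "bilin_on V W U f"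
  shows "lin_on (tensor V W) U (\<lambda>t. sweedler V W t f)"
proof -
  interpret V: vspace V by fact
  interpret U: vspace U by fact
  interpret T: vspace "tensor V W" by (rule vspace_tensor)
  have sum_in: "(\<Sum>(v, w)\<leftarrow>ps. f v w) \<in> carrier U" if "set ps \<subseteq> carrier V \<times> carrier W" for ps
    using that f
    by (induction ps)
      (auto simp: U.subspace_0[OF U.carrier_subspace] bilin_on_def lin_on_def
        intro!: U.subspace_add[OF U.carrier_subspace])
  have scale: "represents V W (map (\<lambda>(v, w). (smul V r v, w)) ps) (smul (tensor V W) r t)
      \<and> (\<Sum>(v, w)\<leftarrow>map (\<lambda>(v, w). (smul V r v, w)) ps. f v w) = smul U r (\<Sum>(v, w)\<leftarrow>ps. f v w)"
    if "represents V W ps t" for r ps t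
  proof -
    have "set ps \<subseteq> carrier V \<times> carrier W" "t = (\<Sum>(v, w)\<leftarrow>ps. tens V W v w)"
      using that by (auto simp: represents_def)
    then show ?thesis
    proof (induction ps arbitrary: t)
      case Nil
      then have "t = 0" by (simp only: list.map sum_list.Nil)
      then show ?case
        by (simp only: represents_def T.scale_zero_right U.scale_zero_right list.map sum_list.Nil)
          simp
    next
      case (Cons p ps)
      obtain v w where p: "p = (v, w)" by force
      have vw: "v \<in> carrier V" "w \<in> carrier W" using Cons.prems p by auto
      have "smul V r v \<in> carrier V"
        using vw by (simp add: V.subspace_scale[OF V.carrier_subspace])
      moreover have "tens V W (smul V r v) w = smul (tensor V W) r (tens V W v w)"
        using tens_bilin_on[of V W] vw by (simp add: bilin_on_def lin_on_def)
      moreover have "f (smul V r v) w = smul U r (f v w)"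
        using f vw by (simp add: bilin_on_def lin_on_def)
      ultimately show ?case
        using Cons.IH[OF _ refl] Cons.prems vw p
        by (simp add: represents_def T.scale_right_distrib U.scale_right_distrib
            del: plus_fun_apply zero_fun_apply)
    qed
  qed
  show ?thesis
    unfolding lin_on_def
  proof (intro conjI ballI allI)
    fix t assume "t \<in> carrier (tensor V W)"
    then obtain ps where ps: "represents V W ps t" using represents_exists[OF V] by blast
    show "sweedler V W t f \<in> carrier U"
      using sweedler_eq[OF U f ps] sum_in ps by (simp add: represents_def)
    show "sweedler V W (smul (tensor V W) r t) f = smul U r (sweedler V W t f)" for r
      using sweedler_eq[OF U f ps] sweedler_eq[OF U f conjunct1[OF scale[OF ps]]] scale[OF ps, of r]
      by simp
    fix s assume "s \<in> carrier (tensor V W)"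
    then obtain qs where qs: "represents V W qs s" using represents_exists[OF V] by blast
    have "represents V W (ps @ qs) (t + s)" using ps qs by (auto simp: represents_def)
    then show "sweedler V W (t + s) f = sweedler V W t f + sweedler V W s f"
      using sweedler_eq[OF U f] ps qs by simp
  qed
qed

lemma tensor_induct [consumes 2, case_names zero add]:
  assumes "vspace V" "t \<in> carrier (tensor V W)"
    and "P 0"
    and "\<And>v w t. \<lbrakk>v \<in> carrier V; w \<in> carrier W; t \<in> carrier (tensor V W); P t\<rbrakk>
           \<Longrightarrow> P (tens V W v w + t)"
  shows "P t"
proof -
  interpret T: vspace "tensor V W" by (rule vspace_tensor)
  obtain ps where "represents V W ps t" using represents_exists[OF assms(1,2)] by blast
  then have "set ps \<subseteq> carrier V \<times> carrier W" "t = (\<Sum>(v, w)\<leftarrow>ps. tens V W v w)"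
    by (auto simp: represents_def)
  then have "P t \<and> t \<in> carrier (tensor V W)"
  proof (induction ps arbitrary: t)
    case Nil
    then show ?case
      using assms(3)
      by (simp add: T.subspace_0[OF T.carrier_subspace] del: zero_fun_apply)
  next
    case (Cons p ps)
    then show ?case
      using assms(4)
      by (auto simp: tens_in_tensor simp del: plus_fun_apply
          intro!: T.subspace_add[OF T.carrier_subspace])
  qed
  then show ?thesis by simp
qed

section \<open>Hom-structures\<close>

record ('k, 'a) hom_space = "('k, 'a) vspace" +
  alpha :: "'a \<Rightarrow> 'a"

record ('k, 'a) hom_alg = "('k, 'a) hom_space" +
  mul :: "'a \<Rightarrow> 'a \<Rightarrow> 'a"
  one :: "'a"

record ('k, 'a) hom_bialg = "('k, 'a) hom_alg" +
  comul :: "'a \<Rightarrow> ('a, 'a, 'k) tensor"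
  counit :: "'a \<Rightarrow> 'k"

locale hom_space = vspace V
  for V :: "('k::field, 'a::ab_group_add, 'z) hom_space_scheme" +
  assumes alpha_linear: "lin_on V V (alpha V)"
    and alpha_bij: "bij_betw (alpha V) (carrier V) (carrier V)"

definition alpha_pow :: "('k, 'a, 'z) hom_space_scheme \<Rightarrow> int \<Rightarrow> 'a \<Rightarrow> 'a" where
  "alpha_pow V n =
     (if 0 \<le> n then alpha V ^^ nat n else inv_into (carrier V) (alpha V) ^^ nat (- n))"

locale hom_algebra = hom_space A
  for A :: "('k::field, 'a::ab_group_add, 'z) hom_alg_scheme" +
  assumes mul_bilinear: "bilin_on A A A (mul A)"
    and one_carrier: "one A \<in> carrier A"
    and alpha_mul: "\<lbrakk>a \<in> carrier A; b \<in> carrier A\<rbrakk>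
          \<Longrightarrow> alpha A (mul A a b) = mul A (alpha A a) (alpha A b)"
    and alpha_one: "alpha A (one A) = one A"
    and one_mul: "a \<in> carrier A \<Longrightarrow> mul A (one A) a = alpha A a"
    and mul_one: "a \<in> carrier A \<Longrightarrow> mul A a (one A) = alpha A a"
    and hom_assoc: "\<lbrakk>a \<in> carrier A; b \<in> carrier A; c \<in> carrier A\<rbrakk>
          \<Longrightarrow> mul A (alpha A a) (mul A b c) = mul A (mul A a b) (alpha A c)"

definition ground_alg :: "('k::field, 'k) hom_alg" where
  "ground_alg = \<lparr>carrier = UNIV, smul = (*), alpha = id, mul = (*), one = 1\<rparr>"

definition tensor_alg ::
  "('k::field, 'a::ab_group_add, 'z) hom_alg_scheme \<Rightarrow> ('k, 'b::ab_group_add, 'y) hom_alg_scheme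
    \<Rightarrow> ('k, ('a, 'b, 'k) tensor) hom_alg" where
  "tensor_alg A B =
     \<lparr>carrier = carrier (tensor A B), smul = smul (tensor A B),
      alpha = tensor_map A B A B (alpha A) (alpha B),
      mul = (\<lambda>s t. sweedler A B s (\<lambda>a b. sweedler A B t (\<lambda>a' b'.
               tens A B (mul A a a') (mul B b b')))),
      one = tens A B (one A) (one B)\<rparr>"

definition hom_alg_morphism ::
  "('k::field, 'a::ab_group_add, 'z) hom_alg_scheme \<Rightarrow> ('k, 'b::ab_group_add, 'y) hom_alg_scheme
    \<Rightarrow> ('a \<Rightarrow> 'b) \<Rightarrow> bool" where
  "hom_alg_morphism A B f \<longleftrightarrow>
     lin_on A B f \<and>
     (\<forall>a\<in>carrier A. f (alpha A a) = alpha B (f a)) \<and>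
     (\<forall>a\<in>carrier A. \<forall>b\<in>carrier A. f (mul A a b) = mul B (f a) (f b)) \<and>
     f (one A) = one B"

locale hom_coalgebra = hom_space C
  for C :: "('k::field, 'c::ab_group_add, 'z) hom_bialg_scheme" +
  assumes comul_linear: "lin_on C (tensor C C) (comul C)"
    and counit_linear: "lin_on C ground (counit C)"
    and counit_alpha: "c \<in> carrier C \<Longrightarrow> counit C (alpha C c) = counit C c"
    and comul_alpha: "c \<in> carrier C
          \<Longrightarrow> tensor_map C C C C (alpha C) (alpha C) (comul C c) = comul C (alpha C c)"
    and counit_left: "c \<in> carrier C
          \<Longrightarrow> sweedler C C (comul C c) (\<lambda>c1 c2. smul C (counit C c1) c2) = alpha C c"
    and counit_right: "c \<in> carrier C
          \<Longrightarrow> sweedler C C (comul C c) (\<lambda>c1 c2. smul C (counit C c2) c1) = alpha C c"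
    and hom_coassoc: "c \<in> carrier C
          \<Longrightarrow> sweedler C C (comul C c) (\<lambda>c1 c2. sweedler C C (comul C c1) (\<lambda>c11 c12.
                 tens3 C C C c11 c12 (alpha C c2)))
            = sweedler C C (comul C c) (\<lambda>c1 c2. tens C (tensor C C) (alpha C c1) (comul C c2))"

locale hom_bialgebra = hom_algebra B + hom_coalgebra B
  for B :: "('k::field, 'b::ab_group_add, 'z) hom_bialg_scheme" +
  assumes comul_morphism: "hom_alg_morphism B (tensor_alg B B) (comul B)"
    and counit_morphism: "hom_alg_morphism B ground_alg (counit B)"

locale hom_hopf_algebra = hom_bialgebra H
  for H :: "('k::field, 'h::ab_group_add, 'z) hom_bialg_scheme"
    and S :: "'h \<Rightarrow> 'h" +
  assumes antipode_linear: "lin_on H H S"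
    and antipode_alpha: "h \<in> carrier H \<Longrightarrow> S (alpha H h) = alpha H (S h)"
    and antipode_left: "h \<in> carrier H
          \<Longrightarrow> sweedler H H (comul H h) (\<lambda>h1 h2. mul H (S h1) h2) = smul H (counit H h) (one H)"
    and antipode_right: "h \<in> carrier H
          \<Longrightarrow> sweedler H H (comul H h) (\<lambda>h1 h2. mul H h1 (S h2)) = smul H (counit H h) (one H)"

locale quasitriangular_hom_bialgebra = hom_bialgebra B
  for B :: "('k::field, 'b::ab_group_add, 'z) hom_bialg_scheme" +
  assumes R_matrix: "\<exists>R \<in> carrier (tensor B B).
    (\<forall>b\<in>carrier B.
       mul (tensor_alg B B) (flip B B (comul B b)) R = mul (tensor_alg B B) R (comul B b)) \<and>
    (let R12 = sweedler B B R (\<lambda>r1 r2. tens3 B B B r1 r2 (one B));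
         R13 = sweedler B B R (\<lambda>r1 r2. tens3 B B B r1 (one B) r2);
         R23 = sweedler B B R (\<lambda>r1 r2. tens3 B B B (one B) r1 r2);
         BBB = tensor_alg B (tensor_alg B B)
     in sweedler B B R (\<lambda>r1 r2. sweedler B B (comul B r1) (\<lambda>r11 r12.
            tens3 B B B r11 r12 (alpha B r2)))
          = mul BBB R13 R23 \<and>
        sweedler B B R (\<lambda>r1 r2. tens B (tensor B B) (alpha B r1) (comul B r2))
          = mul BBB R13 R12)"

section \<open>Modules, comodules and Doi-Hopf data\<close>

locale left_hom_module = hom_algebra A + M: hom_space M
  for A :: "('k::field, 'a::ab_group_add, 'z) hom_alg_scheme"
    and M :: "('k, 'm::ab_group_add, 'y) hom_space_scheme"
    and act :: "'a \<Rightarrow> 'm \<Rightarrow> 'm" +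
  assumes act_bilinear: "bilin_on A M M act"
    and one_act: "m \<in> carrier M \<Longrightarrow> act (one A) m = alpha M m"
    and alpha_act: "\<lbrakk>a \<in> carrier A; m \<in> carrier M\<rbrakk>
          \<Longrightarrow> alpha M (act a m) = act (alpha A a) (alpha M m)"
    and act_act: "\<lbrakk>a \<in> carrier A; b \<in> carrier A; m \<in> carrier M\<rbrakk>
          \<Longrightarrow> act (alpha A a) (act b m) = act (mul A a b) (alpha M m)"

locale right_hom_comodule = hom_coalgebra C + M: hom_space M
  for C :: "('k::field, 'c::ab_group_add, 'z) hom_bialg_scheme"
    and M :: "('k, 'm::ab_group_add, 'y) hom_space_scheme"
    and \<rho> :: "'m \<Rightarrow> ('m, 'c, 'k) tensor" +
  assumes coact_linear: "lin_on M (tensor M C) \<rho>"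
    and coact_counit: "m \<in> carrier M
          \<Longrightarrow> sweedler M C (\<rho> m) (\<lambda>m0 m1. smul M (counit C m1) m0) = alpha M m"
    and coact_alpha: "m \<in> carrier M
          \<Longrightarrow> tensor_map M C M C (alpha M) (alpha C) (\<rho> m) = \<rho> (alpha M m)"
    and coact_coassoc: "m \<in> carrier M
          \<Longrightarrow> sweedler M C (\<rho> m) (\<lambda>m0 m1. sweedler M C (\<rho> m0) (\<lambda>m00 m01.
                 tens3 M C C m00 m01 (alpha C m1)))
            = sweedler M C (\<rho> m) (\<lambda>m0 m1. tens M (tensor C C) (alpha M m0) (comul C m1))"

locale right_comodule_algebra =
  H: hom_bialgebra H + A: hom_algebra A + right_hom_comodule H A \<rho>
  for H :: "('k::field, 'h::ab_group_add, 'z) hom_bialg_scheme"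
    and A :: "('k, 'a::ab_group_add, 'y) hom_alg_scheme"
    and \<rho> :: "'a \<Rightarrow> ('a, 'h, 'k) tensor" +
  assumes coact_mul: "\<lbrakk>a \<in> carrier A; b \<in> carrier A\<rbrakk>
          \<Longrightarrow> \<rho> (mul A a b) = mul (tensor_alg A H) (\<rho> a) (\<rho> b)"
    and coact_one: "\<rho> (one A) = tens A H (one A) (one H)"

locale left_module_coalgebra =
  H: hom_bialgebra H + C: hom_coalgebra C + left_hom_module H C act
  for H :: "('k::field, 'h::ab_group_add, 'z) hom_bialg_scheme"
    and C :: "('k, 'c::ab_group_add, 'y) hom_bialg_scheme"
    and act :: "'h \<Rightarrow> 'c \<Rightarrow> 'c" +
  assumes comul_act: "\<lbrakk>h \<in> carrier H; c \<in> carrier C\<rbrakk>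
          \<Longrightarrow> comul C (act h c)
            = sweedler H H (comul H h) (\<lambda>h1 h2. sweedler C C (comul C c) (\<lambda>c1 c2.
                tens C C (act h1 c1) (act h2 c2)))"
    and counit_act: "\<lbrakk>h \<in> carrier H; c \<in> carrier C\<rbrakk>
          \<Longrightarrow> counit C (act h c) = counit H h * counit C c"

locale doi_hopf_datum =
  hom_hopf_algebra H S + right_comodule_algebra H A \<rho> + left_module_coalgebra H C act
  for H :: "('k::field, 'h::ab_group_add, 'z) hom_bialg_scheme"
    and S :: "'h \<Rightarrow> 'h"
    and A :: "('k, 'a::ab_group_add, 'y) hom_alg_scheme"
    and \<rho> :: "'a \<Rightarrow> ('a, 'h, 'k) tensor"
    and C :: "('k, 'c::ab_group_add, 'x) hom_bialg_scheme"
    and act :: "'h \<Rightarrow> 'c \<Rightarrow> 'c"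

locale monoidal_doi_hopf_datum =
  doi_hopf_datum H S A \<rho> C act + A: hom_bialgebra A + C: hom_bialgebra C
  for H :: "('k::field, 'h::ab_group_add, 'z) hom_bialg_scheme"
    and S :: "'h \<Rightarrow> 'h"
    and A :: "('k, 'a::ab_group_add, 'y) hom_bialg_scheme"
    and \<rho> :: "'a \<Rightarrow> ('a, 'h, 'k) tensor"
    and C :: "('k, 'c::ab_group_add, 'x) hom_bialg_scheme"
    and act :: "'h \<Rightarrow> 'c \<Rightarrow> 'c" +
  assumes monoidal_mul: "\<lbrakk>a \<in> carrier A; c \<in> carrier C; d \<in> carrier C\<rbrakk>
          \<Longrightarrow> sweedler A H (\<rho> a) (\<lambda>a0 a1. sweedler A A (comul A a0) (\<lambda>a01 a02.
                tens3 A A C a01 a02 (act (alpha_pow H 2 a1) (mul C c d))))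
            = sweedler A A (comul A a) (\<lambda>a1 a2.
                sweedler A H (\<rho> a1) (\<lambda>a10 a11. sweedler A H (\<rho> a2) (\<lambda>a20 a21.
                  tens3 A A C a10 a20 (mul C (act a11 c) (act a21 d)))))"
    and monoidal_one: "a \<in> carrier A
          \<Longrightarrow> smul C (counit A a) (one C)
            = sweedler A H (\<rho> a) (\<lambda>a0 a1. smul C (counit A a0) (act a1 (one C)))"

section \<open>The dual of \<open>C\<close> and the smash product\<close>

text \<open>Functionals are normalised to vanish off the carrier, so that equality of functions is
  equality of functionals.\<close>

definition on_carrier :: "('k::field, 'c, 'z) vspace_scheme \<Rightarrow> ('c \<Rightarrow> 'k) \<Rightarrow> 'c \<Rightarrow> 'k" where
  "on_carrier C f = (\<lambda>c. if c \<in> carrier C then f c else 0)"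

definition dual_space ::
  "('k::field, 'c::ab_group_add, 'z) vspace_scheme \<Rightarrow> ('k, 'c \<Rightarrow> 'k) vspace" where
  "dual_space C = \<lparr>carrier = {f. lin_on C ground f \<and> on_carrier C f = f}, smul = fun_smul\<rparr>"

text \<open>For finite-dimensional \<open>C\<close> the coproduct is uniquely determined by its pairing with
  \<open>C \<otimes> C\<close>.\<close>

definition dual_bialg ::
  "('k::field, 'c::ab_group_add, 'z) hom_bialg_scheme \<Rightarrow> ('k, 'c \<Rightarrow> 'k) hom_bialg" where
  "dual_bialg C =
     \<lparr>carrier = carrier (dual_space C), smul = smul (dual_space C),
      alpha = (\<lambda>f. on_carrier C (\<lambda>c. f (alpha_pow C (-1) c))),
      mul = (\<lambda>f g. on_carrier C (\<lambda>c. sweedler C C (comul C c) (\<lambda>c1 c2.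
               f (alpha_pow C (-2) c1) * g (alpha_pow C (-2) c2)))),
      one = on_carrier C (counit C),
      comul = (\<lambda>f. THE t. t \<in> carrier (tensor (dual_space C) (dual_space C)) \<and>
                 (\<forall>c\<in>carrier C. \<forall>d\<in>carrier C.
                    sweedler (dual_space C) (dual_space C) t (\<lambda>f1 f2. f1 c * f2 d)
                      = f (alpha_pow C (-2) (mul C c d)))),
      counit = (\<lambda>f. f (one C))\<rparr>"

definition dual_act ::
  "('k::field, 'c, 'z) hom_space_scheme \<Rightarrow> ('h \<Rightarrow> 'c \<Rightarrow> 'c) \<Rightarrow> ('c \<Rightarrow> 'k) \<Rightarrow> 'h \<Rightarrow> 'c \<Rightarrow> 'k" where
  "dual_act C act f h = on_carrier C (\<lambda>c. f (act h (alpha_pow C (-2) c)))"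

definition smash ::
  "('k::field, 'h::ab_group_add, 'z) hom_bialg_scheme \<Rightarrow> ('k, 'a::ab_group_add, 'y) hom_bialg_scheme
    \<Rightarrow> ('a \<Rightarrow> ('a, 'h, 'k) tensor) \<Rightarrow> ('k, 'c::ab_group_add, 'x) hom_bialg_scheme
    \<Rightarrow> ('h \<Rightarrow> 'c \<Rightarrow> 'c) \<Rightarrow> ('k, ('a, 'c \<Rightarrow> 'k, 'k) tensor) hom_bialg" where
  "smash H A \<rho> C act =
     (let D = dual_bialg C; B = tensor A D in
     \<lparr>carrier = carrier B, smul = smul B,
      alpha = tensor_map A D A D (alpha A) (alpha D),
      mul = (\<lambda>s t. sweedler A D s (\<lambda>a f. sweedler A D t (\<lambda>a' f'.
               sweedler A H (\<rho> a') (\<lambda>a'0 a'1.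
                 tens A D (mul A a (alpha_pow A (-1) a'0))
                   (mul D (dual_act C act (alpha_pow D (-1) f) (alpha_pow H (-2) a'1)) f'))))),
      one = tens A D (one A) (one D),
      comul = (\<lambda>t. sweedler A D t (\<lambda>a f.
                 sweedler A A (comul A a) (\<lambda>a1 a2. sweedler D D (comul D f) (\<lambda>f1 f2.
                   tens B B (tens A D a1 f1) (tens A D a2 f2))))),
      counit = (\<lambda>t. sweedler A D t (\<lambda>a f. counit A a * f (one C)))\<rparr>)"

section \<open>Twisted convolution invertible maps\<close>

definition twisted_convolution_invertible ::
  "('k::field, 'a::ab_group_add, 'z) hom_alg_scheme \<Rightarrow> ('k, 'c::ab_group_add, 'y) hom_bialg_scheme
    \<Rightarrow> (('c, 'c, 'k) tensor \<Rightarrow> ('a, 'a, 'k) tensor) \<Rightarrow> bool" where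
  "twisted_convolution_invertible A C Q \<longleftrightarrow>
     (\<exists>R. lin_on (tensor C C) (tensor A A) R \<and>
        (\<forall>c\<in>carrier C. \<forall>d\<in>carrier C.
           sweedler C C (comul C c) (\<lambda>c1 c2. sweedler C C (comul C d) (\<lambda>d1 d2.
             mul (tensor_alg A A) (Q (tens C C c2 d2)) (R (tens C C c1 d1))))
             = smul (tensor A A) (counit C c * counit C d) (tens A A (one A) (one A)) \<and>
           sweedler C C (comul C c) (\<lambda>c1 c2. sweedler C C (comul C d) (\<lambda>d1 d2.
             mul (tensor_alg A A) (R (tens C C c2 d2)) (Q (tens C C c1 d1))))
             = smul (tensor A A) (counit C c * counit C d) (tens A A (one A) (one A))))"

text \<open>The map \<open>a \<otimes> b \<mapsto> (a\<^sub>(\<^sub>0\<^sub>) \<otimes> b\<^sub>(\<^sub>0\<^sub>)) \<otimes> (a\<^sub>(\<^sub>1\<^sub>) \<otimes> b\<^sub>(\<^sub>1\<^sub>))\<close> on \<open>A \<otimes> A\<close>.\<close>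

definition coact2 ::
  "('k::field, 'h::ab_group_add, 'z) vspace_scheme \<Rightarrow> ('k, 'a::ab_group_add, 'y) vspace_scheme
    \<Rightarrow> ('a \<Rightarrow> ('a, 'h, 'k) tensor)
    \<Rightarrow> ('a, 'a, 'k) tensor \<Rightarrow> (('a, 'a, 'k) tensor, ('h, 'h, 'k) tensor, 'k) tensor" where
  "coact2 H A \<rho> t = sweedler A A t (\<lambda>a b.
     sweedler A H (\<rho> a) (\<lambda>a0 a1. sweedler A H (\<rho> b) (\<lambda>b0 b1.
       tens (tensor A A) (tensor H H) (tens A A a0 b0) (tens H H a1 b1))))"

definition act2 ::
  "('k::field, 'h::ab_group_add, 'z) vspace_scheme \<Rightarrow> ('k, 'c::ab_group_add, 'y) vspace_scheme
    \<Rightarrow> ('h \<Rightarrow> 'c \<Rightarrow> 'c) \<Rightarrow> ('h, 'h, 'k) tensor \<Rightarrow> ('c, 'c, 'k) tensor \<Rightarrow> ('c, 'c, 'k) tensor" where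
  "act2 H C act s t = sweedler H H s (\<lambda>h h'. sweedler C C t (\<lambda>c c'. tens C C (act h c) (act h' c')))"

definition mul_map ::
  "('k::field, 'c::ab_group_add, 'z) hom_alg_scheme \<Rightarrow> ('c, 'c, 'k) tensor \<Rightarrow> 'c" where
  "mul_map C t = sweedler C C t (mul C)"

end

theory Submission
  imports Defs
begin

text \<open>
  Two changes of viewpoint turn the theorem into four short computations.

  A Hom-structure whose structure map \<open>\<alpha>\<close> is bijective is an ordinary structure twisted by an
  automorphism.  Put \<open>a \<circ> b = \<alpha>\<inverse>(ab)\<close>, \<open>\<Delta>'(c) = \<Delta>(\<alpha>\<inverse>(c))\<close>, \<open>\<rho>'(a) = \<rho>(\<alpha>\<inverse>(a))\<close> and
  \<open>h \<circ> c = \<alpha>\<inverse>(h \<cdot> c)\<close>.  Then the Hom-axioms become the ordinary axioms (\<open>ordinary\<close>), the structure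
  maps become automorphisms, and because \<open>Q\<close> commutes with \<open>\<alpha>\<close> every power of \<open>\<alpha>\<close> in the
  conditions on \<open>Q\<close> cancels (\<open>ordinary_braided\<close>).  With all operations untwisted they read

  \<^item> \<open>Q(a\<^sub>2\<^sub>(\<^sub>1\<^sub>) d, a\<^sub>1\<^sub>(\<^sub>1\<^sub>) c) (a\<^sub>2\<^sub>(\<^sub>0\<^sub>) \<otimes> a\<^sub>1\<^sub>(\<^sub>0\<^sub>)) = \<Delta>(a) Q(d, c)\<close>,
  \<^item> \<open>Q(d\<^sub>1, c\<^sub>1) \<otimes> c\<^sub>2 d\<^sub>2 = Q(d\<^sub>2, c\<^sub>2)\<^sub>(\<^sub>0\<^sub>) \<otimes> m(Q(d\<^sub>2, c\<^sub>2)\<^sub>(\<^sub>1\<^sub>) (d\<^sub>1 \<otimes> c\<^sub>1))\<close>,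
  \<^item> \<open>(\<Delta> \<otimes> id) Q(de, c) = Q\<^sup>1(d, c\<^sub>2) \<otimes> q(e, Q\<^sup>2(d, c\<^sub>2)\<^sub>(\<^sub>1\<^sub>) c\<^sub>1) (1 \<otimes> Q\<^sup>2(d, c\<^sub>2)\<^sub>(\<^sub>0\<^sub>))\<close>,
  \<^item> \<open>(id \<otimes> \<Delta>) Q(e, cd) = q(Q\<^sup>1(e\<^sub>2, d)\<^sub>(\<^sub>1\<^sub>) e\<^sub>1, c) (Q\<^sup>1(e\<^sub>2, d)\<^sub>(\<^sub>0\<^sub>) \<otimes> 1) \<otimes> Q\<^sup>2(e\<^sub>2, d)\<close>.

  Since \<open>C\<close> is finite dimensional, \<open>A # C\<^sup>*\<close> is the space of linear maps \<open>C \<rightarrow> A\<close>.  In this picture the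
  product is the convolution \<open>(s * t)(c) = s(t(c\<^sub>2)\<^sub>(\<^sub>1\<^sub>) c\<^sub>1) t(c\<^sub>2)\<^sub>(\<^sub>0\<^sub>)\<close> (\<open>conv\<close>), the coproduct of \<open>s\<close> is the
  map \<open>(c, d) \<mapsto> \<Delta>(s(cd))\<close>, and an element of a tensor power of \<open>A # C\<^sup>*\<close> is a multilinear map into
  a tensor power of \<open>A\<close>, determined by its values (\<open>EV2_inj\<close>, \<open>EV3_inj\<close>).  The smash product is a
  bialgebra because the first monoidality condition makes the coproduct multiplicative
  (\<open>comult_conv\<close>) and the second makes the counit multiplicative (\<open>counit_conv\<close>).

  The element \<open>R\<close> is the bilinear map \<open>R(c, d) = \<tau>(Q(d, c))\<close>, where \<open>\<tau>\<close> is the flip.  For a linear map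
  \<open>b\<close> the second condition on \<open>Q\<close> rewrites \<open>(\<Delta>\<^sup>o\<^sup>p(b) R)(c, d)\<close> and the first rewrites
  \<open>(R \<Delta>(b))(c, d)\<close>, both into \<open>\<tau>(\<Delta>(b(c\<^sub>2 d\<^sub>2)) Q(d\<^sub>1, c\<^sub>1))\<close> (\<open>Rm_natural\<close>).  The fourth and the third
  condition are the values of \<open>(\<Delta> \<otimes> id) R = R\<^sup>1\<^sup>3 R\<^sup>2\<^sup>3\<close> and \<open>(id \<otimes> \<Delta>) R = R\<^sup>1\<^sup>3 R\<^sup>1\<^sup>2\<close> with the tensor factors
  permuted (\<open>Rm_hexagon1\<close>, \<open>Rm_hexagon2\<close>).  Twisting back by the automorphism \<open>s \<mapsto> \<alpha> s \<alpha>\<inverse>\<close> gives the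
  Hom-bialgebra \<open>A # C\<^sup>*\<close> and its quasitriangular structure (\<open>quasitriangular_B\<close>).
\<close>

section \<open>Multilinear maps and the Sweedler calculus\<close>

lemma vspace_zero: "vspace V \<Longrightarrow> 0 \<in> carrier V"
  by (metis vspace.carrier_subspace vspace.axioms(1) module.subspace_0 module_iff_vector_space)

lemma vspace_add: "vspace V \<Longrightarrow> x \<in> carrier V \<Longrightarrow> y \<in> carrier V \<Longrightarrow> x + y \<in> carrier V"
  by (metis vspace.carrier_subspace vspace.axioms(1) module.subspace_add module_iff_vector_space)

lemma vspace_smul: "vspace V \<Longrightarrow> x \<in> carrier V \<Longrightarrow> smul V r x \<in> carrier V"
  by (metis vspace.carrier_subspace vspace.axioms(1) module.subspace_scale module_iff_vector_space)

lemma vspace_sum: "vspace V \<Longrightarrow> (\<And>i. i \<in> I \<Longrightarrow> f i \<in> carrier V) \<Longrightarrow> sum f I \<in> carrier V"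
  by (induction I rule: infinite_finite_induct) (auto simp: vspace_zero vspace_add)

lemma vspace_smul_simps:
  assumes "vspace V"
  shows "smul V r 0 = 0" "smul V 0 x = 0" "smul V 1 x = x"
    "smul V r (x + y) = smul V r x + smul V r y" "smul V (r + s) x = smul V r x + smul V s x"
    "smul V r (smul V s x) = smul V (r * s) x"
proof -
  interpret vspace V by fact
  show "smul V r 0 = 0" "smul V 0 x = 0" "smul V 1 x = x"
    "smul V r (x + y) = smul V r x + smul V r y" "smul V (r + s) x = smul V r x + smul V s x"
    "smul V r (smul V s x) = smul V (r * s) x"
    by (simp_all add: scale_right_distrib scale_left_distrib)
qed

lemma ground_simps [simp]: "carrier ground = UNIV" "smul ground = (*)"
  by (simp_all add: ground_def)

lemma lin_on_mem: "lin_on V W f \<Longrightarrow> x \<in> carrier V \<Longrightarrow> f x \<in> carrier W"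
  by (simp add: lin_on_def)

lemma lin_on_add: "lin_on V W f \<Longrightarrow> x \<in> carrier V \<Longrightarrow> y \<in> carrier V \<Longrightarrow> f (x + y) = f x + f y"
  by (simp add: lin_on_def)

lemma lin_on_smul: "lin_on V W f \<Longrightarrow> x \<in> carrier V \<Longrightarrow> f (smul V r x) = smul W r (f x)"
  by (simp add: lin_on_def)

lemma lin_on_zero: "vspace V \<Longrightarrow> vspace W \<Longrightarrow> lin_on V W f \<Longrightarrow> f 0 = 0"
  by (metis lin_on_smul vspace_smul_simps(2) vspace_zero)

lemma lin_on_sum:
  assumes "vspace V" "vspace W" "lin_on V W f" "\<And>i. i \<in> I \<Longrightarrow> g i \<in> carrier V"
  shows "f (sum g I) = (\<Sum>i\<in>I. f (g i))"
  using assms(4)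
  by (induction I rule: infinite_finite_induct)
    (auto simp: lin_on_zero[OF assms(1-3)] lin_on_add[OF assms(3)] vspace_sum[OF assms(1)])

lemma lin_onI:
  assumes "\<And>x. x \<in> carrier V \<Longrightarrow> f x \<in> carrier W"
    and "\<And>x y. x \<in> carrier V \<Longrightarrow> y \<in> carrier V \<Longrightarrow> f (x + y) = f x + f y"
    and "\<And>r x. x \<in> carrier V \<Longrightarrow> f (smul V r x) = smul W r (f x)"
  shows "lin_on V W f"
  using assms by (simp add: lin_on_def)

lemma lin_on_cong:
  assumes "vspace V" "\<And>x. x \<in> carrier V \<Longrightarrow> f x = g x" "lin_on V W g"
  shows "lin_on V W f"
  using assms by (simp add: lin_on_def vspace_add vspace_smul)

lemma bilin_onI:
  assumes "\<And>w. w \<in> carrier W \<Longrightarrow> lin_on V U (\<lambda>v. f v w)"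
    and "\<And>v. v \<in> carrier V \<Longrightarrow> lin_on W U (\<lambda>w. f v w)"
  shows "bilin_on V W U f"
  using assms by (simp add: bilin_on_def)

lemma bilin_on_mem: "bilin_on V W U f \<Longrightarrow> v \<in> carrier V \<Longrightarrow> w \<in> carrier W \<Longrightarrow> f v w \<in> carrier U"
  by (auto simp: bilin_on_def lin_on_def)

text \<open>Each composition rule has a rigid head once its first premise is instantiated, so that
  linearity of a nested expression follows by resolution, without search.\<close>

lemma lin_on_id: "lin_on V V (\<lambda>x. x)"
  by (simp add: lin_on_def)

lemma lin_on_comp: "lin_on V W f \<Longrightarrow> lin_on X V g \<Longrightarrow> lin_on X W (\<lambda>x. f (g x))"
  by (simp add: lin_on_def)

lemma bilin_on_lin1:
  "bilin_on V W U f \<Longrightarrow> lin_on X V g \<Longrightarrow> w \<in> carrier W \<Longrightarrow> lin_on X U (\<lambda>x. f (g x) w)"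
  by (simp add: bilin_on_def lin_on_comp[of V U "\<lambda>v. f v w" for w])

lemma bilin_on_lin2:
  "bilin_on V W U f \<Longrightarrow> lin_on X W g \<Longrightarrow> v \<in> carrier V \<Longrightarrow> lin_on X U (\<lambda>x. f v (g x))"
  by (simp add: bilin_on_def lin_on_comp[of W U "f v" for v])

lemma lin_on_lsmul: "vspace U \<Longrightarrow> lin_on X U g \<Longrightarrow> lin_on X U (\<lambda>x. smul U r (g x))"
  by (auto simp: lin_on_def vspace_smul vspace_smul_simps mult.commute)

lemma lin_on_rsmul:
  "vspace U \<Longrightarrow> lin_on X ground g \<Longrightarrow> u \<in> carrier U \<Longrightarrow> lin_on X U (\<lambda>x. smul U (g x) u)"
  by (auto simp: lin_on_def vspace_smul vspace_smul_simps)

lemma lin_on_lmult: "lin_on X ground g \<Longrightarrow> lin_on X ground (\<lambda>x. r * g x)"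
  by (auto simp: lin_on_def algebra_simps)

lemma lin_on_rmult: "lin_on X ground g \<Longrightarrow> lin_on X ground (\<lambda>x. g x * r)"
  by (auto simp: lin_on_def algebra_simps)

lemma lin_on_sumI:
  assumes "vspace U" "\<And>i. i \<in> I \<Longrightarrow> lin_on X U (\<lambda>x. g i x)"
  shows "lin_on X U (\<lambda>x. \<Sum>i\<in>I. g i x)"
proof -
  interpret U: vspace U by fact
  show ?thesis
    using assms(2) by (auto simp: lin_on_def sum.distrib U.scale_sum_right vspace_sum[OF assms(1)])
qed

subsection \<open>Sums over a representing list\<close>

text \<open>Because a Sweedler sum is a sum over one list that depends on the tensor only, sums commute,
  and linear maps pass into them, with no linearity condition on the summand.\<close>

lemma represents_some:
  assumes "vspace V" "t \<in> carrier (tensor V W)"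
  shows "set (SOME ps. represents V W ps t) \<subseteq> carrier V \<times> carrier W"
  using someI_ex[OF represents_exists[OF assms]] by (simp add: represents_def)

lemma sweedler_cong:
  assumes "vspace V" "t = t'" "t' \<in> carrier (tensor V W)"
    and "\<And>v w. v \<in> carrier V \<Longrightarrow> w \<in> carrier W \<Longrightarrow> f v w = g v w"
  shows "sweedler V W t f = sweedler V W t' g"
proof -
  show ?thesis
    using represents_some[OF assms(1,3)] unfolding sweedler_def assms(2)
    by (intro arg_cong[where f = sum_list] map_cong) (auto simp: assms(4))
qed

lemma sweedler_swap:
  "sweedler V W t (\<lambda>v w. sweedler X Y s (\<lambda>x y. f v w x y)) =
   sweedler X Y s (\<lambda>x y. sweedler V W t (\<lambda>v w. f v w x y))"
proof -
  have "(\<Sum>(v, w)\<leftarrow>ps. \<Sum>(x, y)\<leftarrow>qs. f v w x y) = (\<Sum>(x, y)\<leftarrow>qs. \<Sum>(v, w)\<leftarrow>ps. f v w x y)"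
    for ps qs
    by (induction ps) (auto simp: sum_list_addf case_prod_unfold)
  then show ?thesis by (simp add: sweedler_def)
qed

lemma sweedler_mem:
  assumes "vspace V" "vspace U" "t \<in> carrier (tensor V W)"
    and "\<And>v w. v \<in> carrier V \<Longrightarrow> w \<in> carrier W \<Longrightarrow> f v w \<in> carrier U"
  shows "sweedler V W t f \<in> carrier U"
proof -
  have "(\<Sum>(v, w)\<leftarrow>ps. f v w) \<in> carrier U" if "set ps \<subseteq> carrier V \<times> carrier W" for ps
    using that by (induction ps) (auto simp: vspace_zero vspace_add assms)
  from this[OF represents_some[OF assms(1,3)]] show ?thesis by (simp add: sweedler_def)
qed

lemma lin_on_sweedler:
  assumes "lin_on U X g" "vspace V" "vspace U" "vspace X" "t \<in> carrier (tensor V W)"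
    and "\<And>v w. v \<in> carrier V \<Longrightarrow> w \<in> carrier W \<Longrightarrow> f v w \<in> carrier U"
  shows "g (sweedler V W t f) = sweedler V W t (\<lambda>v w. g (f v w))"
proof -
  have "(\<Sum>(v, w)\<leftarrow>ps. f v w) \<in> carrier U \<and>
      g (\<Sum>(v, w)\<leftarrow>ps. f v w) = (\<Sum>(v, w)\<leftarrow>ps. g (f v w))"
    if "set ps \<subseteq> carrier V \<times> carrier W" for ps
    using that
    by (induction ps) (auto simp: vspace_zero vspace_add assms lin_on_zero[OF assms(3,4,1)]
        lin_on_add[OF assms(1)])
  from this[OF represents_some[OF assms(2,5)]] show ?thesis by (simp add: sweedler_def)
qed

lemma lin_on_sweedler2:
  assumes "lin_on U Z g" "vspace V" "vspace X" "vspace U" "vspace Z" "t \<in> carrier (tensor V W)"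
    and "\<And>v w. v \<in> carrier V \<Longrightarrow> w \<in> carrier W \<Longrightarrow> s v w \<in> carrier (tensor X Y)"
    and "\<And>v w x y. \<lbrakk>v \<in> carrier V; w \<in> carrier W; x \<in> carrier X; y \<in> carrier Y\<rbrakk> \<Longrightarrow>
      f v w x y \<in> carrier U"
  shows "g (sweedler V W t (\<lambda>v w. sweedler X Y (s v w) (f v w))) =
    sweedler V W t (\<lambda>v w. sweedler X Y (s v w) (\<lambda>x y. g (f v w x y)))"
proof -
  have "g (sweedler V W t (\<lambda>v w. sweedler X Y (s v w) (f v w))) =
    sweedler V W t (\<lambda>v w. g (sweedler X Y (s v w) (f v w)))"
    by (rule lin_on_sweedler[OF assms(1,2,4-6)]) (intro sweedler_mem assms; assumption)
  also have "\<dots> = sweedler V W t (\<lambda>v w. sweedler X Y (s v w) (\<lambda>x y. g (f v w x y)))"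
    by (intro sweedler_cong assms refl lin_on_sweedler[OF assms(1,3-5)]; assumption)
  finally show ?thesis .
qed

lemma lin_on_sweedler3:
  assumes "lin_on U Z g" "vspace V" "vspace X" "vspace X'" "vspace U" "vspace Z"
    and "t \<in> carrier (tensor V W)"
    and "\<And>v w. v \<in> carrier V \<Longrightarrow> w \<in> carrier W \<Longrightarrow> s v w \<in> carrier (tensor X Y)"
    and "\<And>v w x y. \<lbrakk>v \<in> carrier V; w \<in> carrier W; x \<in> carrier X; y \<in> carrier Y\<rbrakk> \<Longrightarrow>
      r v w x y \<in> carrier (tensor X' Y')"
    and "\<And>v w x y x' y'. \<lbrakk>v \<in> carrier V; w \<in> carrier W; x \<in> carrier X; y \<in> carrier Y;
      x' \<in> carrier X'; y' \<in> carrier Y'\<rbrakk> \<Longrightarrow> f v w x y x' y' \<in> carrier U"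
  shows "g (sweedler V W t (\<lambda>v w. sweedler X Y (s v w) (\<lambda>x y. sweedler X' Y' (r v w x y) (f v w x y)))) =
    sweedler V W t (\<lambda>v w. sweedler X Y (s v w) (\<lambda>x y. sweedler X' Y' (r v w x y)
      (\<lambda>x' y'. g (f v w x y x' y'))))"
proof -
  have "g (sweedler V W t (\<lambda>v w. sweedler X Y (s v w) (\<lambda>x y. sweedler X' Y' (r v w x y) (f v w x y)))) =
    sweedler V W t (\<lambda>v w. g (sweedler X Y (s v w) (\<lambda>x y. sweedler X' Y' (r v w x y) (f v w x y))))"
    by (rule lin_on_sweedler[OF assms(1,2,5-7)]) (intro sweedler_mem assms; assumption)
  also have "\<dots> = sweedler V W t (\<lambda>v w. sweedler X Y (s v w) (\<lambda>x y. sweedler X' Y' (r v w x y)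
      (\<lambda>x' y'. g (f v w x y x' y'))))"
    by (intro sweedler_cong assms refl lin_on_sweedler2[OF assms(1,3-6)]; assumption)
  finally show ?thesis .
qed

lemma lin_on_sweedler4:
  assumes "lin_on U Z g" "vspace V" "vspace X" "vspace X'" "vspace X''" "vspace U" "vspace Z"
    and "t \<in> carrier (tensor V W)"
    and "\<And>v w. v \<in> carrier V \<Longrightarrow> w \<in> carrier W \<Longrightarrow> s v w \<in> carrier (tensor X Y)"
    and "\<And>v w x y. \<lbrakk>v \<in> carrier V; w \<in> carrier W; x \<in> carrier X; y \<in> carrier Y\<rbrakk> \<Longrightarrow>
      r v w x y \<in> carrier (tensor X' Y')"
    and "\<And>v w x y x' y'. \<lbrakk>v \<in> carrier V; w \<in> carrier W; x \<in> carrier X; y \<in> carrier Y;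
      x' \<in> carrier X'; y' \<in> carrier Y'\<rbrakk> \<Longrightarrow> q v w x y x' y' \<in> carrier (tensor X'' Y'')"
    and "\<And>v w x y x' y' x'' y''. \<lbrakk>v \<in> carrier V; w \<in> carrier W; x \<in> carrier X; y \<in> carrier Y;
      x' \<in> carrier X'; y' \<in> carrier Y'; x'' \<in> carrier X''; y'' \<in> carrier Y''\<rbrakk> \<Longrightarrow>
      f v w x y x' y' x'' y'' \<in> carrier U"
  shows "g (sweedler V W t (\<lambda>v w. sweedler X Y (s v w) (\<lambda>x y. sweedler X' Y' (r v w x y)
      (\<lambda>x' y'. sweedler X'' Y'' (q v w x y x' y') (f v w x y x' y'))))) =
    sweedler V W t (\<lambda>v w. sweedler X Y (s v w) (\<lambda>x y. sweedler X' Y' (r v w x y)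
      (\<lambda>x' y'. sweedler X'' Y'' (q v w x y x' y') (\<lambda>x'' y''. g (f v w x y x' y' x'' y'')))))"
proof -
  have "g (sweedler V W t (\<lambda>v w. sweedler X Y (s v w) (\<lambda>x y. sweedler X' Y' (r v w x y)
      (\<lambda>x' y'. sweedler X'' Y'' (q v w x y x' y') (f v w x y x' y'))))) =
    sweedler V W t (\<lambda>v w. g (sweedler X Y (s v w) (\<lambda>x y. sweedler X' Y' (r v w x y)
      (\<lambda>x' y'. sweedler X'' Y'' (q v w x y x' y') (f v w x y x' y')))))"
    by (rule lin_on_sweedler[OF assms(1,2,6-8)]) (intro sweedler_mem assms; assumption)
  also have "\<dots> = sweedler V W t (\<lambda>v w. sweedler X Y (s v w) (\<lambda>x y. sweedler X' Y' (r v w x y)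
      (\<lambda>x' y'. sweedler X'' Y'' (q v w x y x' y') (\<lambda>x'' y''. g (f v w x y x' y' x'' y'')))))"
    by (intro sweedler_cong assms refl lin_on_sweedler3[OF assms(1,3-7)]; assumption)
  finally show ?thesis .
qed

lemma lin_on_sweedler_fun:
  assumes "vspace V" "vspace U" "t \<in> carrier (tensor V W)"
    and "\<And>v w. v \<in> carrier V \<Longrightarrow> w \<in> carrier W \<Longrightarrow> lin_on X U (\<lambda>x. f x v w)"
  shows "lin_on X U (\<lambda>x. sweedler V W t (f x))"
proof -
  interpret U: vspace U by fact
  have "lin_on X U (\<lambda>x. \<Sum>(v, w)\<leftarrow>ps. f x v w)"
    if "set ps \<subseteq> carrier V \<times> carrier W" for ps
    using that
  proof (induction ps)
    case Nil
    then show ?case by (auto simp: lin_on_def vspace_zero[OF assms(2)])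
  next
    case (Cons p ps)
    then have 1: "lin_on X U (\<lambda>x. f x (fst p) (snd p))" and
      2: "lin_on X U (\<lambda>x. \<Sum>(v, w)\<leftarrow>ps. f x v w)" using assms(4) by auto
    show ?case
      using 1 2
      by (auto simp: lin_on_def case_prod_unfold vspace_add[OF assms(2)] U.scale_right_distrib)
  qed
  from this[OF represents_some[OF assms(1,3)]] show ?thesis by (simp add: sweedler_def)
qed

lemma lin_on_sweedler_arg:
  assumes "vspace V" "vspace U" "lin_on X (tensor V W) t" "bilin_on V W U f"
  shows "lin_on X U (\<lambda>x. sweedler V W (t x) f)"
  by (rule lin_on_comp[OF sweedler_lin_on assms(3)]) (use assms in auto)

lemma sweedler_sweedler:
  assumes "vspace V" "vspace U" "bilin_on V W U f" "vspace X" "t \<in> carrier (tensor X Y)"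
    and "\<And>x y. x \<in> carrier X \<Longrightarrow> y \<in> carrier Y \<Longrightarrow> h x y \<in> carrier (tensor V W)"
  shows "sweedler V W (sweedler X Y t h) f = sweedler X Y t (\<lambda>x y. sweedler V W (h x y) f)"
  by (rule lin_on_sweedler[OF sweedler_lin_on[OF assms(1-3)]])
    (use assms vspace_tensor in auto)

text \<open>The pure tensors span, so linear maps on a tensor product are compared on them.\<close>

lemma lin_on_tensor_eqI:
  assumes "vspace V" "vspace U" "lin_on (tensor V W) U f" "lin_on (tensor V W) U g"
    and "\<And>v w. v \<in> carrier V \<Longrightarrow> w \<in> carrier W \<Longrightarrow> f (tens V W v w) = g (tens V W v w)"
    and "t \<in> carrier (tensor V W)"
  shows "f t = g t"
  using assms(1,6)
proof (induction rule: tensor_induct)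
  case zero
  show ?case using lin_on_zero[OF vspace_tensor assms(2)] assms(3,4) by metis
next
  case (add v w t)
  then show ?case
    using lin_on_add[OF assms(3) tens_in_tensor] lin_on_add[OF assms(4) tens_in_tensor] assms(5)
    by metis
qed

lemma sweedler_tens_self:
  assumes "vspace V" "t \<in> carrier (tensor V W)"
  shows "sweedler V W t (tens V W) = t"
  by (rule lin_on_tensor_eqI[OF assms(1) vspace_tensor _ lin_on_id _ assms(2)])
    (auto intro!: lin_on_sweedler_arg vspace_tensor lin_on_id tens_bilin_on
      sweedler_tens[OF vspace_tensor] assms)

lemmas tens_lin1 = bilin_on_lin1[OF tens_bilin_on]
lemmas tens_lin2 = bilin_on_lin2[OF tens_bilin_on]

named_theorems lin
lemmas [lin] = bilin_onI lin_on_id lin_on_lsmul lin_on_rsmul lin_on_lmult lin_on_rmult lin_on_sumI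
  lin_on_sweedler_arg lin_on_sweedler_fun vspace_tensor vspace_ground tens_lin1 tens_lin2
  tens_in_tensor sweedler_mem vspace_smul

subsection \<open>Maps on tensor products\<close>

lemma lin_on_tensor_map [lin]:
  assumes "vspace V" "lin_on V V' f" "lin_on W W' g" "lin_on X (tensor V W) t"
  shows "lin_on X (tensor V' W') (\<lambda>x. tensor_map V W V' W' f g (t x))"
  unfolding tensor_map_def using assms
  by (intro lin lin_on_comp[OF assms(2)] lin_on_comp[OF assms(3)]) (auto simp: lin_on_mem)

lemma tensor_map_mem:
  assumes "vspace V" "lin_on V V' f" "lin_on W W' g" "t \<in> carrier (tensor V W)"
  shows "tensor_map V W V' W' f g t \<in> carrier (tensor V' W')"
  using lin_on_mem[OF lin_on_tensor_map[OF assms(1-3) lin_on_id] assms(4)] .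

lemma sweedler_tensor_map:
  assumes "vspace V" "vspace V'" "vspace U" "lin_on V V' f" "lin_on W W' g"
    and "t \<in> carrier (tensor V W)" "bilin_on V' W' U h"
  shows "sweedler V' W' (tensor_map V W V' W' f g t) h = sweedler V W t (\<lambda>v w. h (f v) (g w))"
proof -
  have "sweedler V' W' (tensor_map V W V' W' f g t) h =
    sweedler V W t (\<lambda>v w. sweedler V' W' (tens V' W' (f v) (g w)) h)"
    unfolding tensor_map_def
    by (rule sweedler_sweedler) (use assms in \<open>auto intro!: tens_in_tensor simp: lin_on_mem\<close>)
  also have "\<dots> = sweedler V W t (\<lambda>v w. h (f v) (g w))"
    by (rule sweedler_cong)
      (use assms in \<open>auto intro!: sweedler_tens[where U = U] simp: lin_on_mem\<close>)
  finally show ?thesis .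
qed

lemma sweedler_tens2:
  assumes "vspace U" "bilin_on V W U f" "vspace V" "vspace W" "vspace X" "vspace X'"
    and "t \<in> carrier (tensor X Y)" "t' \<in> carrier (tensor X' Y')"
    and "\<And>x y x' y'. \<lbrakk>x \<in> carrier X; y \<in> carrier Y; x' \<in> carrier X'; y' \<in> carrier Y'\<rbrakk> \<Longrightarrow> p x y x' y' \<in> carrier V"
    and "\<And>x y x' y'. \<lbrakk>x \<in> carrier X; y \<in> carrier Y; x' \<in> carrier X'; y' \<in> carrier Y'\<rbrakk> \<Longrightarrow> q x y x' y' \<in> carrier W"
  shows "sweedler V W (sweedler X Y t (\<lambda>x y. sweedler X' Y' t' (\<lambda>x' y'.
      tens V W (p x y x' y') (q x y x' y')))) f =
    sweedler X Y t (\<lambda>x y. sweedler X' Y' t' (\<lambda>x' y'. f (p x y x' y') (q x y x' y')))"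
  by (subst lin_on_sweedler2[OF sweedler_lin_on[OF assms(3,1,2)]])
    (intro lin assms sweedler_cong refl sweedler_tens[OF assms(1,2)]; assumption)+

lemma lin_on_flip [lin]:
  assumes "vspace V" "vspace W" "lin_on X (tensor V W) t"
  shows "lin_on X (tensor W V) (\<lambda>x. flip V W (t x))"
  unfolding flip_def using assms by (intro lin)

lemma flip_mem [lin]:
  assumes "vspace V" "t \<in> carrier (tensor V W)"
  shows "flip V W t \<in> carrier (tensor W V)"
  unfolding flip_def using assms by (intro lin)

lemma sweedler_flip:
  assumes "vspace V" "vspace W" "vspace U" "t \<in> carrier (tensor V W)" "bilin_on W V U h"
  shows "sweedler W V (flip V W t) h = sweedler V W t (\<lambda>v w. h w v)"
proof -
  have "sweedler W V (flip V W t) h = sweedler V W t (\<lambda>v w. sweedler W V (tens W V w v) h)"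
    unfolding flip_def by (rule sweedler_sweedler) (use assms in \<open>auto intro!: tens_in_tensor\<close>)
  also have "\<dots> = sweedler V W t (\<lambda>v w. h w v)"
    by (rule sweedler_cong) (use assms in \<open>auto intro!: sweedler_tens[where U = U]\<close>)
  finally show ?thesis .
qed

definition trilin_on where
  "trilin_on U V W X f \<longleftrightarrow>
     (\<forall>u\<in>carrier U. bilin_on V W X (f u)) \<and> (\<forall>v\<in>carrier V. \<forall>w\<in>carrier W. lin_on U X (\<lambda>u. f u v w))"

lemma trilin_onI [lin]:
  assumes "\<And>v w. v \<in> carrier V \<Longrightarrow> w \<in> carrier W \<Longrightarrow> lin_on U X (\<lambda>u. f u v w)"
    and "\<And>u w. u \<in> carrier U \<Longrightarrow> w \<in> carrier W \<Longrightarrow> lin_on V X (\<lambda>v. f u v w)"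
    and "\<And>u v. u \<in> carrier U \<Longrightarrow> v \<in> carrier V \<Longrightarrow> lin_on W X (\<lambda>w. f u v w)"
  shows "trilin_on U V W X f"
  using assms by (simp add: trilin_on_def bilin_on_def)

lemma trilin_lin:
  assumes "trilin_on U V W X f"
  shows "lin_on Y U g \<Longrightarrow> v \<in> carrier V \<Longrightarrow> w \<in> carrier W \<Longrightarrow> lin_on Y X (\<lambda>x. f (g x) v w)"
    "u \<in> carrier U \<Longrightarrow> lin_on Y V h \<Longrightarrow> w \<in> carrier W \<Longrightarrow> lin_on Y X (\<lambda>x. f u (h x) w)"
    "u \<in> carrier U \<Longrightarrow> v \<in> carrier V \<Longrightarrow> lin_on Y W k \<Longrightarrow> lin_on Y X (\<lambda>x. f u v (k x))"
    "u \<in> carrier U \<Longrightarrow> v \<in> carrier V \<Longrightarrow> w \<in> carrier W \<Longrightarrow> f u v w \<in> carrier X"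
  using assms by (auto simp: trilin_on_def bilin_on_def lin_on_def)

text \<open>The linear map on \<open>U \<otimes> (V \<otimes> W)\<close> induced by a trilinear map.  Applied to both sides of an
  equation between triple tensors, such as coassociativity, it gives the same equation below an
  arbitrary trilinear map.\<close>

definition sweedler3 where
  "sweedler3 U V W t f = sweedler U (tensor V W) t (\<lambda>u s. sweedler V W s (f u))"

lemma trilin_bilin:
  assumes "vspace V" "vspace X" "trilin_on U V W X f"
  shows "bilin_on U (tensor V W) X (\<lambda>u s. sweedler V W s (f u))"
  by (intro bilin_onI lin_on_sweedler_fun[OF assms(1,2)] lin_on_sweedler_arg[OF assms(1,2)] lin_on_id)
    (use assms(3) in \<open>auto simp: trilin_on_def bilin_on_def\<close>)

lemma sweedler3_lin:
  assumes "vspace U" "vspace V" "vspace X" "trilin_on U V W X f"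
  shows "lin_on (tensor U (tensor V W)) X (\<lambda>t. sweedler3 U V W t f)"
  unfolding sweedler3_def by (intro sweedler_lin_on assms trilin_bilin)

lemma sweedler3_tens:
  assumes "vspace V" "vspace X" "trilin_on U V W X f" "u \<in> carrier U" "v \<in> carrier V" "w \<in> carrier W"
  shows "sweedler3 U V W (tens3 U V W u v w) f = f u v w"
  using assms(3,4) unfolding sweedler3_def tens3_def
  by (simp add: sweedler_tens[OF assms(2) trilin_bilin[OF assms(1-3)] assms(4)] tens_in_tensor assms
      trilin_on_def sweedler_tens[OF assms(2)])

lemma sweedler3_tens2:
  assumes "vspace V" "vspace X" "trilin_on U V W X f" "u \<in> carrier U" "s \<in> carrier (tensor V W)"
  shows "sweedler3 U V W (tens U (tensor V W) u s) f = sweedler V W s (f u)"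
  unfolding sweedler3_def
  by (simp add: sweedler_tens[OF assms(2) trilin_bilin[OF assms(1-3)] assms(4,5)])

lemma tens3_lin [lin]:
  "lin_on X U f \<Longrightarrow> v \<in> carrier V \<Longrightarrow> w \<in> carrier W \<Longrightarrow>
    lin_on X (tensor U (tensor V W)) (\<lambda>x. tens3 U V W (f x) v w)"
  "u \<in> carrier U \<Longrightarrow> lin_on X V g \<Longrightarrow> w \<in> carrier W \<Longrightarrow>
    lin_on X (tensor U (tensor V W)) (\<lambda>x. tens3 U V W u (g x) w)"
  "u \<in> carrier U \<Longrightarrow> v \<in> carrier V \<Longrightarrow> lin_on X W h \<Longrightarrow>
    lin_on X (tensor U (tensor V W)) (\<lambda>x. tens3 U V W u v (h x))"
  unfolding tens3_def by (intro lin; assumption)+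

lemma tens3_mem [lin]:
  "u \<in> carrier U \<Longrightarrow> v \<in> carrier V \<Longrightarrow> w \<in> carrier W \<Longrightarrow>
    tens3 U V W u v w \<in> carrier (tensor U (tensor V W))"
  unfolding tens3_def by (intro lin)

section \<open>Ordinary monoidal Doi-Hopf data and the smash convolution\<close>

text \<open>The case of trivial structure maps.  The operations are parameters over bare carriers, so that
  they can be instantiated by the untwisted operations of a Hom-type datum without changing the
  tensor products.\<close>

locale ordinary_datum =
  fixes A :: "('k::field, 'a::ab_group_add, 'x) vspace_scheme"
    and H :: "('k, 'h::ab_group_add, 'y) vspace_scheme"
    and C :: "('k, 'c::ab_group_add, 'z) vspace_scheme"
    and mA :: "'a \<Rightarrow> 'a \<Rightarrow> 'a" and oneA :: 'a
    and dA :: "'a \<Rightarrow> ('a, 'a, 'k) tensor" and eA :: "'a \<Rightarrow> 'k"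
    and mH :: "'h \<Rightarrow> 'h \<Rightarrow> 'h" and oneH :: 'h
    and dH :: "'h \<Rightarrow> ('h, 'h, 'k) tensor" and eH :: "'h \<Rightarrow> 'k"
    and mC :: "'c \<Rightarrow> 'c \<Rightarrow> 'c" and oneC :: 'c
    and dC :: "'c \<Rightarrow> ('c, 'c, 'k) tensor" and eC :: "'c \<Rightarrow> 'k"
    and rho :: "'a \<Rightarrow> ('a, 'h, 'k) tensor"
    and act :: "'h \<Rightarrow> 'c \<Rightarrow> 'c"
  assumes vs: "vspace A" "vspace H" "vspace C"
    and mA_bilin: "bilin_on A A A mA" and oneA_mem: "oneA \<in> carrier A"
    and mH_bilin: "bilin_on H H H mH" and oneH_mem: "oneH \<in> carrier H"
    and mC_bilin: "bilin_on C C C mC" and oneC_mem: "oneC \<in> carrier C"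
    and dA_lin: "lin_on A (tensor A A) dA" and eA_lin: "lin_on A ground eA"
    and dH_lin: "lin_on H (tensor H H) dH" and eH_lin: "lin_on H ground eH"
    and dC_lin: "lin_on C (tensor C C) dC" and eC_lin: "lin_on C ground eC"
    and rho_lin: "lin_on A (tensor A H) rho" and act_bilin: "bilin_on H C C act"
    and mA_assoc: "\<lbrakk>a \<in> carrier A; a' \<in> carrier A; a'' \<in> carrier A\<rbrakk> \<Longrightarrow>
      mA a (mA a' a'') = mA (mA a a') a''"
    and mA_one: "a \<in> carrier A \<Longrightarrow> mA oneA a = a" "a \<in> carrier A \<Longrightarrow> mA a oneA = a"
    and dA_coassoc: "a \<in> carrier A \<Longrightarrow>
      sweedler A A (dA a) (\<lambda>a1 a2. sweedler A A (dA a1) (\<lambda>x y. tens3 A A A x y a2)) =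
      sweedler A A (dA a) (\<lambda>a1 a2. tens A (tensor A A) a1 (dA a2))"
    and dA_counit: "a \<in> carrier A \<Longrightarrow> sweedler A A (dA a) (\<lambda>a1 a2. smul A (eA a1) a2) = a"
      "a \<in> carrier A \<Longrightarrow> sweedler A A (dA a) (\<lambda>a1 a2. smul A (eA a2) a1) = a"
    and dA_one: "dA oneA = tens A A oneA oneA"
    and eA_one: "eA oneA = 1"
    and mC_assoc: "\<lbrakk>c \<in> carrier C; d \<in> carrier C; e \<in> carrier C\<rbrakk> \<Longrightarrow> mC c (mC d e) = mC (mC c d) e"
    and mC_one: "c \<in> carrier C \<Longrightarrow> mC oneC c = c" "c \<in> carrier C \<Longrightarrow> mC c oneC = c"
    and eC_mult: "\<lbrakk>c \<in> carrier C; d \<in> carrier C\<rbrakk> \<Longrightarrow> eC (mC c d) = eC c * eC d"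
    and eC_one: "eC oneC = 1"
    and dA_mult: "\<lbrakk>a \<in> carrier A; b \<in> carrier A\<rbrakk> \<Longrightarrow>
      dA (mA a b) = sweedler A A (dA a) (\<lambda>a1 a2. sweedler A A (dA b) (\<lambda>b1 b2.
        tens A A (mA a1 b1) (mA a2 b2)))"
    and eA_mult: "\<lbrakk>a \<in> carrier A; b \<in> carrier A\<rbrakk> \<Longrightarrow> eA (mA a b) = eA a * eA b"
    and dC_coassoc: "c \<in> carrier C \<Longrightarrow>
      sweedler C C (dC c) (\<lambda>c1 c2. sweedler C C (dC c1) (\<lambda>x y. tens3 C C C x y c2)) =
      sweedler C C (dC c) (\<lambda>c1 c2. tens C (tensor C C) c1 (dC c2))"
    and dC_counit: "c \<in> carrier C \<Longrightarrow> sweedler C C (dC c) (\<lambda>c1 c2. smul C (eC c1) c2) = c"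
      "c \<in> carrier C \<Longrightarrow> sweedler C C (dC c) (\<lambda>c1 c2. smul C (eC c2) c1) = c"
    and dC_mult: "\<lbrakk>c \<in> carrier C; d \<in> carrier C\<rbrakk> \<Longrightarrow>
      dC (mC c d) = sweedler C C (dC c) (\<lambda>c1 c2. sweedler C C (dC d) (\<lambda>d1 d2.
        tens C C (mC c1 d1) (mC c2 d2)))"
    and dC_one: "dC oneC = tens C C oneC oneC"
    and rho_coassoc: "a \<in> carrier A \<Longrightarrow>
      sweedler A H (rho a) (\<lambda>a0 a1. sweedler A H (rho a0) (\<lambda>x y. tens3 A H H x y a1)) =
      sweedler A H (rho a) (\<lambda>a0 a1. tens A (tensor H H) a0 (dH a1))"
    and rho_counit: "a \<in> carrier A \<Longrightarrow> sweedler A H (rho a) (\<lambda>a0 a1. smul A (eH a1) a0) = a"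
    and rho_mult: "\<lbrakk>a \<in> carrier A; b \<in> carrier A\<rbrakk> \<Longrightarrow>
      rho (mA a b) = sweedler A H (rho a) (\<lambda>a0 a1. sweedler A H (rho b) (\<lambda>b0 b1.
        tens A H (mA a0 b0) (mH a1 b1)))"
    and rho_one: "rho oneA = tens A H oneA oneH"
    and act_act: "\<lbrakk>h \<in> carrier H; g \<in> carrier H; c \<in> carrier C\<rbrakk> \<Longrightarrow> act h (act g c) = act (mH h g) c"
    and act_one: "c \<in> carrier C \<Longrightarrow> act oneH c = c"
    and dC_act: "\<lbrakk>h \<in> carrier H; c \<in> carrier C\<rbrakk> \<Longrightarrow>
      dC (act h c) = sweedler H H (dH h) (\<lambda>h1 h2. sweedler C C (dC c) (\<lambda>c1 c2.
        tens C C (act h1 c1) (act h2 c2)))"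
    and eC_act: "\<lbrakk>h \<in> carrier H; c \<in> carrier C\<rbrakk> \<Longrightarrow> eC (act h c) = eH h * eC c"
    and monoidal_mul: "\<lbrakk>a \<in> carrier A; c \<in> carrier C; d \<in> carrier C\<rbrakk> \<Longrightarrow>
      sweedler A H (rho a) (\<lambda>a0 a1. sweedler A A (dA a0) (\<lambda>x y. tens3 A A C x y (act a1 (mC c d)))) =
      sweedler A A (dA a) (\<lambda>a1 a2. sweedler A H (rho a1) (\<lambda>x0 x1. sweedler A H (rho a2) (\<lambda>y0 y1.
        tens3 A A C x0 y0 (mC (act x1 c) (act y1 d)))))"
    and monoidal_one: "a \<in> carrier A \<Longrightarrow>
      sweedler A H (rho a) (\<lambda>a0 a1. smul C (eA a0) (act a1 oneC)) = smul C (eA a) oneC"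
begin

abbreviation SwA where "SwA a f \<equiv> sweedler A A (dA a) f"
abbreviation SwH where "SwH h f \<equiv> sweedler H H (dH h) f"
abbreviation SwC where "SwC c f \<equiv> sweedler C C (dC c) f"
abbreviation SwR where "SwR a f \<equiv> sweedler A H (rho a) f"

lemmas [lin] = vs oneA_mem oneH_mem oneC_mem
  bilin_on_lin1[OF mA_bilin] bilin_on_lin2[OF mA_bilin] bilin_on_mem[OF mA_bilin]
  bilin_on_lin1[OF mH_bilin] bilin_on_lin2[OF mH_bilin] bilin_on_mem[OF mH_bilin]
  bilin_on_lin1[OF mC_bilin] bilin_on_lin2[OF mC_bilin] bilin_on_mem[OF mC_bilin]
  bilin_on_lin1[OF act_bilin] bilin_on_lin2[OF act_bilin] bilin_on_mem[OF act_bilin]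
  lin_on_comp[OF dA_lin] lin_on_mem[OF dA_lin] lin_on_comp[OF eA_lin]
  lin_on_comp[OF dC_lin] lin_on_mem[OF dC_lin] lin_on_comp[OF eC_lin]
  lin_on_comp[OF dH_lin] lin_on_mem[OF dH_lin] lin_on_comp[OF eH_lin]
  lin_on_comp[OF rho_lin] lin_on_mem[OF rho_lin]

lemmas cong_A = sweedler_cong[OF vs(1) refl] and cong_C = sweedler_cong[OF vs(3) refl]

text \<open>The axioms in the form in which they are applied: as rewriting rules below an arbitrary
  multilinear map.\<close>

lemma coassoc_C:
  assumes "vspace U" "trilin_on C C C U f" "c \<in> carrier C"
  shows "SwC c (\<lambda>c1 c2. SwC c1 (\<lambda>x y. f x y c2)) =
    SwC c (\<lambda>c1 c2. SwC c2 (f c1))" (is "?l = ?r")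
proof -
  note l = sweedler3_lin[OF vs(3) vs(3) assms(1,2)]
  have "?l = sweedler3 C C C
      (SwC c (\<lambda>c1 c2. SwC c1 (\<lambda>x y. tens3 C C C x y c2))) f"
    by (subst lin_on_sweedler2[OF l])
      (intro lin assms sweedler_cong refl sweedler3_tens[OF vs(3) assms(1,2), symmetric]; assumption)+
  also have "\<dots> = ?r"
    unfolding dC_coassoc[OF assms(3)]
    by (subst lin_on_sweedler[OF l])
      (intro lin assms sweedler_cong refl sweedler3_tens2[OF vs(3) assms(1,2)]; assumption)+
  finally show ?thesis .
qed

lemma coassoc_A:
  assumes "vspace U" "trilin_on A A A U f" "a \<in> carrier A"
  shows "SwA a (\<lambda>c1 c2. SwA c1 (\<lambda>x y. f x y c2)) =
    SwA a (\<lambda>c1 c2. SwA c2 (f c1))" (is "?l = ?r")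
proof -
  note l = sweedler3_lin[OF vs(1) vs(1) assms(1,2)]
  have "?l = sweedler3 A A A
      (SwA a (\<lambda>c1 c2. SwA c1 (\<lambda>x y. tens3 A A A x y c2))) f"
    by (subst lin_on_sweedler2[OF l])
      (intro lin assms sweedler_cong refl sweedler3_tens[OF vs(1) assms(1,2), symmetric]; assumption)+
  also have "\<dots> = ?r"
    unfolding dA_coassoc[OF assms(3)]
    by (subst lin_on_sweedler[OF l])
      (intro lin assms sweedler_cong refl sweedler3_tens2[OF vs(1) assms(1,2)]; assumption)+
  finally show ?thesis .
qed

lemma coassoc_rho:
  assumes "vspace U" "trilin_on A H H U f" "a \<in> carrier A"
  shows "SwR a (\<lambda>a0 a1. SwR a0 (\<lambda>x y. f x y a1)) =
    SwR a (\<lambda>a0 a1. SwH a1 (f a0))" (is "?l = ?r")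
proof -
  note l = sweedler3_lin[OF vs(1) vs(2) assms(1,2)]
  have "?l = sweedler3 A H H
      (SwR a (\<lambda>c1 c2. SwR c1 (\<lambda>x y. tens3 A H H x y c2))) f"
    by (subst lin_on_sweedler2[OF l])
      (intro lin assms sweedler_cong refl sweedler3_tens[OF vs(2) assms(1,2), symmetric]; assumption)+
  also have "\<dots> = ?r"
    unfolding rho_coassoc[OF assms(3)]
    by (subst lin_on_sweedler[OF l])
      (intro lin assms sweedler_cong refl sweedler3_tens2[OF vs(2) assms(1,2)]; assumption)+
  finally show ?thesis .
qed

lemma monoidal:
  assumes "vspace U" "trilin_on A A C U f" "a \<in> carrier A" "c \<in> carrier C" "d \<in> carrier C"
  shows "SwR a (\<lambda>a0 a1. SwA a0 (\<lambda>x y. f x y (act a1 (mC c d)))) =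
    SwA a (\<lambda>a1 a2. SwR a1 (\<lambda>x0 x1. SwR a2 (\<lambda>y0 y1.
      f x0 y0 (mC (act x1 c) (act y1 d)))))" (is "?l = ?r")
proof -
  note l = sweedler3_lin[OF vs(1) vs(1) assms(1,2)]
  have "?l = sweedler3 A A C (SwR a (\<lambda>a0 a1. SwA a0 (\<lambda>x y.
      tens3 A A C x y (act a1 (mC c d))))) f"
    by (subst lin_on_sweedler2[OF l])
      (intro lin assms sweedler_cong refl sweedler3_tens[OF vs(1) assms(1,2), symmetric]; assumption)+
  also have "\<dots> = ?r"
    unfolding monoidal_mul[OF assms(3-5)]
    by (subst lin_on_sweedler3[OF l])
      (intro lin assms sweedler_cong refl sweedler3_tens[OF vs(1) assms(1,2)]; assumption)+
  finally show ?thesis .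
qed

lemma comult_mult_C:
  assumes "vspace U" "bilin_on C C U f" "c \<in> carrier C" "d \<in> carrier C"
  shows "SwC (mC c d) f =
    SwC c (\<lambda>c1 c2. SwC d (\<lambda>d1 d2. f (mC c1 d1) (mC c2 d2)))"
  unfolding dC_mult[OF assms(3,4)] by (rule sweedler_tens2[OF assms(1,2)]) (intro lin assms; assumption)+

lemma coact_mult:
  assumes "vspace U" "bilin_on A H U f" "a \<in> carrier A" "b \<in> carrier A"
  shows "SwR (mA a b) f =
    SwR a (\<lambda>a0 a1. SwR b (\<lambda>b0 b1. f (mA a0 b0) (mH a1 b1)))"
  unfolding rho_mult[OF assms(3,4)] by (rule sweedler_tens2[OF assms(1,2)]) (intro lin assms; assumption)+

lemma comult_act:
  assumes "vspace U" "bilin_on C C U f" "h \<in> carrier H" "c \<in> carrier C"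
  shows "SwC (act h c) f =
    SwH h (\<lambda>h1 h2. SwC c (\<lambda>c1 c2. f (act h1 c1) (act h2 c2)))"
  unfolding dC_act[OF assms(3,4)] by (rule sweedler_tens2[OF assms(1,2)]) (intro lin assms; assumption)+

subsection \<open>The convolution product on linear maps from \<open>C\<close> to \<open>A\<close>\<close>

text \<open>The product of \<open>A # C\<^sup>*\<close>, when \<open>a # f\<close> is read as the linear map \<open>c \<mapsto> f(c) a\<close>.\<close>

definition conv :: "('c \<Rightarrow> 'a) \<Rightarrow> ('c \<Rightarrow> 'a) \<Rightarrow> 'c \<Rightarrow> 'a" where
  "conv s t c = SwC c (\<lambda>c1 c2. SwR (t c2) (\<lambda>a0 a1.
     mA (s (act a1 c1)) a0))"

lemma lin_on_conv:
  assumes "lin_on C A s" "lin_on C A t" "lin_on X C g"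
  shows "lin_on X A (\<lambda>x. conv s t (g x))"
  unfolding conv_def using assms(3)
  by (intro lin lin_on_comp[OF assms(1)] lin_on_comp[OF assms(2)] lin_on_mem[OF assms(1)]
      lin_on_mem[OF assms(2)])

lemma conv_cong:
  assumes "\<And>c. c \<in> carrier C \<Longrightarrow> s c = s' c" "\<And>c. c \<in> carrier C \<Longrightarrow> t c = t' c"
    and "lin_on C A t'" "c \<in> carrier C"
  shows "conv s t c = conv s' t' c"
  unfolding conv_def
proof (rule cong_C, intro lin assms)
  fix c1 c2 assume "c1 \<in> carrier C" "c2 \<in> carrier C"
  then show "SwR (t c2) (\<lambda>a0 a1. mA (s (act a1 c1)) a0) =
    SwR (t' c2) (\<lambda>a0 a1. mA (s' (act a1 c1)) a0)"
    by (intro sweedler_cong[OF vs(1)])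
      (simp_all add: assms(1,2) bilin_on_mem[OF act_bilin] lin_on_mem[OF rho_lin] lin_on_mem[OF assms(3)])
qed

text \<open>Both sides are \<open>s(x\<^sub>1 y\<^sub>1 c\<^sub>1) (x\<^sub>0 y\<^sub>0)\<close> with \<open>y = u(c\<^sub>3)\<close> and \<open>x = t(y\<^sub>2 c\<^sub>2)\<close>, where \<open>y\<^sub>0 \<otimes> y\<^sub>1 \<otimes> y\<^sub>2\<close>
  is the twofold coaction on \<open>y\<close>.  On the left the two factors \<open>y\<^sub>1\<close> and \<open>y\<^sub>2\<close> arise from \<open>\<Delta>(h c) = h\<^sub>1 c\<^sub>1 \<otimes> h\<^sub>2 c\<^sub>2\<close>,
  on the right from the coaction on \<open>t(h c) y\<^sub>0\<close>; coassociativity identifies them.\<close>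

lemma conv_assoc:
  assumes s: "lin_on C A s" and t: "lin_on C A t" and u: "lin_on C A u" and c: "c \<in> carrier C"
  shows "conv (conv s t) u c = conv s (conv t u) c"
proof -
  note I = lin lin_on_comp[OF s] lin_on_comp[OF t] lin_on_comp[OF u]
    lin_on_mem[OF s] lin_on_mem[OF t] lin_on_mem[OF u]
  let ?K = "\<lambda>y0 h1 h2 d1 d2 x0 x1. mA (s (act (mH x1 h1) d1)) (mA x0 y0)"
  have 1: "mA (conv s t (act h c)) a = SwH h (\<lambda>h1 h2. SwC c (\<lambda>c1 c2.
      SwR (t (act h2 c2)) (\<lambda>x0 x1. mA (s (act (mH x1 h1) c1)) (mA x0 a))))"
    if "h \<in> carrier H" "c \<in> carrier C" "a \<in> carrier A" for h c a
  proof -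
    have l: "lin_on A A (\<lambda>x. mA x a)" using that by (intro I)
    have "conv s t (act h c) = SwH h (\<lambda>h1 h2. SwC c (\<lambda>c1 c2.
      SwR (t (act h2 c2)) (\<lambda>x0 x1. mA (s (act x1 (act h1 c1))) x0)))"
      unfolding conv_def using that by (intro comult_act[OF vs(1)]) (intro I; assumption)+
    also have "mA \<dots> a = SwH h (\<lambda>h1 h2. SwC c (\<lambda>c1 c2.
      SwR (t (act h2 c2)) (\<lambda>x0 x1. mA (mA (s (act x1 (act h1 c1))) x0) a)))"
      using that by (subst lin_on_sweedler3[OF l]) (intro I refl; assumption)+
    also have "\<dots> = SwH h (\<lambda>h1 h2. SwC c (\<lambda>c1 c2.
      SwR (t (act h2 c2)) (\<lambda>x0 x1. mA (s (act (mH x1 h1) c1)) (mA x0 a))))"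
      using that by (intro sweedler_cong refl) (simp_all add: act_act mA_assoc I)
    finally show ?thesis .
  qed
  let ?F = "\<lambda>d1 d2 c2. SwR (u c2) (\<lambda>a0 a1. SwR a0 (\<lambda>y0 y1.
      SwR (t (act a1 d2)) (\<lambda>x0 x1. mA (s (act (mH x1 y1) d1)) (mA x0 y0))))"
  have "conv (conv s t) u c = SwC c (\<lambda>c1 c2. SwC c1 (\<lambda>d1 d2. ?F d1 d2 c2))"
    unfolding conv_def[of "conv s t"]
  proof (intro sweedler_cong refl I c)
    fix c1 c2 assume m: "c1 \<in> carrier C" "c2 \<in> carrier C"
    let ?g = "\<lambda>y0 y1 z. SwC c1 (\<lambda>d1 d2.
      SwR (t (act z d2)) (\<lambda>x0 x1. mA (s (act (mH x1 y1) d1)) (mA x0 y0)))"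
    have "SwR (u c2) (\<lambda>a0 a1. mA (conv s t (act a1 c1)) a0) =
      SwR (u c2) (\<lambda>a0 a1. SwH a1 (?g a0))"
      using m by (intro sweedler_cong refl 1 I)
    also have "\<dots> = SwR (u c2) (\<lambda>a0 a1. SwR a0 (\<lambda>y0 y1. ?g y0 y1 a1))"
      using m by (intro coassoc_rho[OF vs(1), symmetric] I)
    also have "\<dots> = SwC c1 (\<lambda>d1 d2. ?F d1 d2 c2)"
      by (simp only: sweedler_swap[of C C "dC c1" A H])
    finally show "SwR (u c2) (\<lambda>a0 a1. mA (conv s t (act a1 c1)) a0) =
      SwC c1 (\<lambda>d1 d2. ?F d1 d2 c2)" .
  qed
  also have "\<dots> = SwC c (\<lambda>c1 c2. SwC c2 (?F c1))"
    by (intro coassoc_C[OF vs(1)] I c)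
  also have "\<dots> = conv s (conv t u) c"
    unfolding conv_def[of s]
  proof (intro sweedler_cong refl I c)
    fix c1 c2 assume m: "c1 \<in> carrier C" "c2 \<in> carrier C"
    let ?P = "\<lambda>a. SwR a (\<lambda>e0 e1. mA (s (act e1 c1)) e0)"
    have l: "lin_on A A ?P" using m by (intro I)
    have "?P (conv t u c2) = SwC c2 (\<lambda>d1 d2. SwR (u d2) (\<lambda>a0 a1.
        ?P (mA (t (act a1 d1)) a0)))"
      unfolding conv_def using m by (subst lin_on_sweedler2[OF l]) (intro I refl; assumption)+
    also have "\<dots> = SwC c2 (?F c1)"
      using m by (intro sweedler_cong refl trans[OF coact_mult[OF vs(1)] sweedler_swap] I)
    finally show "SwC c2 (?F c1) = ?P (conv t u c2)" ..
  qed
  finally show ?thesis .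
qed

text \<open>On one side \<open>\<epsilon>(h c) = \<epsilon>(h) \<epsilon>(c)\<close> makes the coaction collapse to its counit, on the other
  \<open>\<rho>(1) = 1 \<otimes> 1\<close>.\<close>

lemma conv_counit:
  assumes t: "lin_on C A t" and c: "c \<in> carrier C"
  shows "conv (\<lambda>c. smul A (eC c) oneA) t c = t c" "conv t (\<lambda>c. smul A (eC c) oneA) c = t c"
proof -
  note I = lin lin_on_comp[OF t] lin_on_mem[OF t]
  have 1: "SwR a (\<lambda>a0 a1. mA (smul A (eC (act a1 c)) oneA) a0) = smul A (eC c) a"
    if "a \<in> carrier A" "c \<in> carrier C" for a c
  proof -
    have "SwR a (\<lambda>a0 a1. mA (smul A (eC (act a1 c)) oneA) a0) =
      SwR a (\<lambda>a0 a1. smul A (eC c) (smul A (eH a1) a0))"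
    proof (intro sweedler_cong refl I that)
      fix a0 a1 assume m: "a0 \<in> carrier A" "a1 \<in> carrier H"
      have "lin_on A A (\<lambda>x. mA x a0)" using m by (intro I)
      from lin_on_smul[OF this oneA_mem] show
        "mA (smul A (eC (act a1 c)) oneA) a0 = smul A (eC c) (smul A (eH a1) a0)"
        using m that by (simp add: mA_one eC_act vspace_smul_simps[OF vs(1)] mult.commute)
    qed
    also have "\<dots> = smul A (eC c) (SwR a (\<lambda>a0 a1. smul A (eH a1) a0))"
      by (rule lin_on_sweedler[symmetric, of A A "smul A (eC c)"]) (intro I that; assumption)+
    finally show ?thesis using that by (simp add: rho_counit)
  qed
  have "conv (\<lambda>c. smul A (eC c) oneA) t c = SwC c (\<lambda>c1 c2. t (smul C (eC c1) c2))"
    unfolding conv_def using c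
    by (intro sweedler_cong refl I) (simp_all add: 1 lin_on_smul[OF t] I)
  also have "\<dots> = t (SwC c (\<lambda>c1 c2. smul C (eC c1) c2))"
    using c by (intro lin_on_sweedler[OF t, symmetric] I)
  finally show "conv (\<lambda>c. smul A (eC c) oneA) t c = t c" by (simp add: dC_counit c)
  have 2: "SwR (smul A r oneA) (\<lambda>a0 a1. mA (t (act a1 c)) a0) = smul A r (t c)"
    if "c \<in> carrier C" for c r
  proof -
    have l: "lin_on A A (\<lambda>x. SwR x (\<lambda>a0 a1. mA (t (act a1 c)) a0))"
      using that by (intro I)
    have "SwR oneA (\<lambda>a0 a1. mA (t (act a1 c)) a0) = mA (t (act oneH c)) oneA"
      unfolding rho_one using that by (intro sweedler_tens[OF vs(1)] I)
    with lin_on_smul[OF l oneA_mem] show ?thesis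
      using that by (simp add: act_one mA_one I)
  qed
  have "conv t (\<lambda>c. smul A (eC c) oneA) c = SwC c (\<lambda>c1 c2. t (smul C (eC c2) c1))"
    unfolding conv_def using c
    by (intro sweedler_cong refl I) (simp_all add: 2 lin_on_smul[OF t] I)
  also have "\<dots> = t (SwC c (\<lambda>c1 c2. smul C (eC c2) c1))"
    using c by (intro lin_on_sweedler[OF t, symmetric] I)
  finally show "conv t (\<lambda>c. smul A (eC c) oneA) c = t c" by (simp add: dC_counit c)
qed

text \<open>The second monoidality condition moves the coaction on \<open>t(1)\<close> off the argument of \<open>s\<close>.\<close>

lemma counit_conv:
  assumes s: "lin_on C A s" and t: "lin_on C A t"
  shows "eA (conv s t oneC) = eA (s oneC) * eA (t oneC)"
proof -
  note I = lin lin_on_comp[OF s] lin_on_comp[OF t] lin_on_mem[OF s] lin_on_mem[OF t]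
  have "conv s t oneC = SwR (t oneC) (\<lambda>a0 a1. mA (s (act a1 oneC)) a0)"
    unfolding conv_def dC_one by (intro sweedler_tens[OF vs(1)] I)
  also have "eA \<dots> = SwR (t oneC) (\<lambda>a0 a1. eA (mA (s (act a1 oneC)) a0))"
    by (intro lin_on_sweedler[OF eA_lin] I)
  also have "\<dots> = SwR (t oneC) (\<lambda>a0 a1. eA (s (smul C (eA a0) (act a1 oneC))))"
    by (intro sweedler_cong refl I)
      (simp_all add: eA_mult lin_on_smul[OF s] lin_on_smul[OF eA_lin] I mult.commute)
  also have "\<dots> = eA (s (SwR (t oneC) (\<lambda>a0 a1. smul C (eA a0) (act a1 oneC))))"
    by (intro lin_on_sweedler[OF lin_on_comp[OF eA_lin s], symmetric] I)
  also have "\<dots> = eA (s oneC) * eA (t oneC)"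
    by (simp add: monoidal_one I lin_on_smul[OF s] lin_on_smul[OF eA_lin] mult.commute)
  finally show ?thesis .
qed

text \<open>The same product for two arguments: the smash convolution of \<open>A \<otimes> A\<close> and \<open>C \<otimes> C\<close>.\<close>

definition conv2 ::
  "('c \<Rightarrow> 'c \<Rightarrow> ('a, 'a, 'k) tensor) \<Rightarrow> ('c \<Rightarrow> 'c \<Rightarrow> ('a, 'a, 'k) tensor) \<Rightarrow> 'c \<Rightarrow> 'c \<Rightarrow> ('a, 'a, 'k) tensor"
where
  "conv2 F G c d = SwC c (\<lambda>c1 c2. SwC d (\<lambda>d1 d2.
     sweedler A A (G c2 d2) (\<lambda>x y. SwR x (\<lambda>x0 x1. SwR y (\<lambda>y0 y1.
       sweedler A A (F (act x1 c1) (act y1 d1)) (\<lambda>p q. tens A A (mA p x0) (mA q y0)))))))"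

text \<open>After \<open>\<Delta>(cd) = \<Delta>(c) \<Delta>(d)\<close> and \<open>\<Delta>(ab) = \<Delta>(a) \<Delta>(b)\<close>, the two sides differ by the first monoidality
  condition, applied to the value of \<open>t\<close>.\<close>

lemma comult_conv:
  assumes s: "lin_on C A s" and t: "lin_on C A t" and c: "c \<in> carrier C" and d: "d \<in> carrier C"
  shows "dA (conv s t (mC c d)) = conv2 (\<lambda>c d. dA (s (mC c d))) (\<lambda>c d. dA (t (mC c d))) c d"
proof -
  note I = lin lin_on_comp[OF s] lin_on_comp[OF t] lin_on_mem[OF s] lin_on_mem[OF t]
  have "conv s t (mC c d) = SwC c (\<lambda>c1 c2. SwC d (\<lambda>d1 d2.
     SwR (t (mC c2 d2)) (\<lambda>a0 a1. mA (s (act a1 (mC c1 d1))) a0)))"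
    unfolding conv_def by (intro comult_mult_C[OF vs(1)] I c d)
  also have "dA \<dots> = SwC c (\<lambda>c1 c2. SwC d (\<lambda>d1 d2.
     SwR (t (mC c2 d2)) (\<lambda>a0 a1. dA (mA (s (act a1 (mC c1 d1))) a0))))"
    by (subst lin_on_sweedler3[OF dA_lin]) (intro I c d refl; assumption)+
  also have "\<dots> = conv2 (\<lambda>c d. dA (s (mC c d))) (\<lambda>c d. dA (t (mC c d))) c d"
    unfolding conv2_def
  proof (intro sweedler_cong refl I c d)
    fix c1 c2 d1 d2
    assume m: "c1 \<in> carrier C" "c2 \<in> carrier C" "d1 \<in> carrier C" "d2 \<in> carrier C"
    let ?f = "\<lambda>x y z. SwA (s z) (\<lambda>p q. tens A A (mA p x) (mA q y))"
    have "SwR (t (mC c2 d2)) (\<lambda>a0 a1. dA (mA (s (act a1 (mC c1 d1))) a0)) =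
      SwR (t (mC c2 d2)) (\<lambda>a0 a1. SwA a0 (\<lambda>x y. ?f x y (act a1 (mC c1 d1))))"
      using m by (intro sweedler_cong refl I trans[OF dA_mult sweedler_swap])
    also have "\<dots> = SwA (t (mC c2 d2)) (\<lambda>x y. SwR x (\<lambda>x0 x1.
        SwR y (\<lambda>y0 y1. ?f x0 y0 (mC (act x1 c1) (act y1 d1)))))"
      using m by (intro monoidal[OF vspace_tensor[of A A]] I)
    finally show "SwR (t (mC c2 d2)) (\<lambda>a0 a1. dA (mA (s (act a1 (mC c1 d1))) a0)) = \<dots>" .
  qed
  finally show ?thesis .
qed

text \<open>An automorphism \<open>(f, h, \<gamma>)\<close> of the datum acts on linear maps by \<open>s \<mapsto> f s \<gamma>\<inverse>\<close>.  Here \<open>g\<close> is the inverse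
  of \<open>\<gamma>\<close>, which explains the form of the compatibility with the action.\<close>

lemma conv_equivariant:
  assumes s: "lin_on C A s" and t: "lin_on C A t" and c: "c \<in> carrier C"
    and f: "lin_on A A f" and g: "lin_on C C g" and h: "lin_on H H h"
    and f_mult: "\<And>a b. a \<in> carrier A \<Longrightarrow> b \<in> carrier A \<Longrightarrow> f (mA a b) = mA (f a) (f b)"
    and f_rho: "\<And>a. a \<in> carrier A \<Longrightarrow> rho (f a) = tensor_map A H A H f h (rho a)"
    and g_dC: "\<And>c. c \<in> carrier C \<Longrightarrow> dC (g c) = tensor_map C C C C g g (dC c)"
    and g_act: "\<And>x c. x \<in> carrier H \<Longrightarrow> c \<in> carrier C \<Longrightarrow> g (act (h x) c) = act x (g c)"
  shows "conv (\<lambda>c. f (s (g c))) (\<lambda>c. f (t (g c))) c = f (conv s t (g c))"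
proof -
  note I = lin lin_on_comp[OF s] lin_on_comp[OF t] lin_on_mem[OF s] lin_on_mem[OF t]
    lin_on_comp[OF f] lin_on_comp[OF g] lin_on_comp[OF h]
    lin_on_mem[OF f] lin_on_mem[OF g] lin_on_mem[OF h]
  have "conv (\<lambda>c. f (s (g c))) (\<lambda>c. f (t (g c))) c =
    SwC c (\<lambda>c1 c2. SwR (t (g c2)) (\<lambda>a0 a1.
      f (mA (s (act a1 (g c1))) a0)))"
    unfolding conv_def
  proof (rule cong_C, intro I c)
    fix c1 c2 assume m: "c1 \<in> carrier C" "c2 \<in> carrier C"
    have "SwR (f (t (g c2))) (\<lambda>a0 a1. mA (f (s (g (act a1 c1)))) a0) =
      SwR (t (g c2)) (\<lambda>a0 a1. mA (f (s (g (act (h a1) c1)))) (f a0))"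
      using m by (simp only: f_rho I) (intro sweedler_tensor_map[OF vs(1) vs(1) vs(1) f h] I)
    also have "\<dots> = SwR (t (g c2)) (\<lambda>a0 a1. f (mA (s (act a1 (g c1))) a0))"
      using m by (intro sweedler_cong refl I) (simp_all add: g_act f_mult I)
    finally show "SwR (f (t (g c2))) (\<lambda>a0 a1. mA (f (s (g (act a1 c1)))) a0) = \<dots>" .
  qed
  also have "\<dots> = f (SwC c (\<lambda>c1 c2. SwR (t (g c2)) (\<lambda>a0 a1.
      mA (s (act a1 (g c1))) a0)))"
    by (rule lin_on_sweedler2[OF f, symmetric]) (intro I c; assumption)+
  also have "\<dots> = f (conv s t (g c))"
    unfolding conv_def g_dC[OF c]
    by (subst sweedler_tensor_map[OF vs(3) vs(3) vs(1) g g]) (intro I c refl; assumption)+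
  finally show ?thesis .
qed

end

subsection \<open>The braiding\<close>

text \<open>The four conditions on \<open>Q\<close> for trivial structure maps.\<close>

locale ordinary_braided_datum =
  ordinary_datum A H C mA oneA dA eA mH oneH dH eH mC oneC dC eC rho act
  for A :: "('k::field, 'a::ab_group_add, 'x) vspace_scheme"
    and H :: "('k, 'h::ab_group_add, 'y) vspace_scheme"
    and C :: "('k, 'c::ab_group_add, 'z) vspace_scheme"
    and mA oneA dA eA mH oneH dH eH mC oneC dC eC rho act +
  fixes Q :: "('c, 'c, 'k) tensor \<Rightarrow> ('a, 'a, 'k) tensor"
  assumes Q_lin: "lin_on (tensor C C) (tensor A A) Q"
    and Q_natural_A: "\<lbrakk>a \<in> carrier A; c \<in> carrier C; d \<in> carrier C\<rbrakk> \<Longrightarrow>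
      sweedler A A (dA a) (\<lambda>a1 a2. sweedler A H (rho a1) (\<lambda>x0 x1. sweedler A H (rho a2) (\<lambda>y0 y1.
        sweedler A A (Q (tens C C (act y1 d) (act x1 c))) (\<lambda>p q. tens A A (mA p y0) (mA q x0))))) =
      sweedler A A (dA a) (\<lambda>a1 a2. sweedler A A (Q (tens C C d c)) (\<lambda>p q. tens A A (mA a1 p) (mA a2 q)))"
    and Q_natural_C: "\<lbrakk>c \<in> carrier C; d \<in> carrier C\<rbrakk> \<Longrightarrow>
      sweedler C C (dC c) (\<lambda>c1 c2. sweedler C C (dC d) (\<lambda>d1 d2.
        tens (tensor A A) C (Q (tens C C d1 c1)) (mC c2 d2))) =
      sweedler C C (dC c) (\<lambda>c1 c2. sweedler C C (dC d) (\<lambda>d1 d2.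
        sweedler A A (Q (tens C C d2 c2)) (\<lambda>p q. sweedler A H (rho p) (\<lambda>p0 p1. sweedler A H (rho q) (\<lambda>q0 q1.
          tens (tensor A A) C (tens A A p0 q0) (mC (act p1 d1) (act q1 c1)))))))"
    and Q_hexagon1: "\<lbrakk>c \<in> carrier C; d \<in> carrier C; e \<in> carrier C\<rbrakk> \<Longrightarrow>
      sweedler A A (Q (tens C C (mC d e) c)) (\<lambda>x y. sweedler A A (dA x) (\<lambda>x1 x2. tens3 A A A x1 x2 y)) =
      sweedler C C (dC c) (\<lambda>c1 c2. sweedler A A (Q (tens C C d c2)) (\<lambda>p q. sweedler A H (rho q) (\<lambda>q0 q1.
        sweedler A A (Q (tens C C e (act q1 c1))) (\<lambda>x y. tens3 A A A p x (mA y q0)))))"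
    and Q_hexagon2: "\<lbrakk>c \<in> carrier C; d \<in> carrier C; e \<in> carrier C\<rbrakk> \<Longrightarrow>
      sweedler A A (Q (tens C C e (mC c d))) (\<lambda>x y. tens A (tensor A A) x (dA y)) =
      sweedler C C (dC e) (\<lambda>e1 e2. sweedler A A (Q (tens C C e2 d)) (\<lambda>p q. sweedler A H (rho p) (\<lambda>p0 p1.
        sweedler A A (Q (tens C C (act p1 e1) c)) (\<lambda>x y. tens3 A A A (mA x p0) y q))))"
begin

abbreviation SwQ where "SwQ c d f \<equiv> sweedler A A (Q (tens C C c d)) f"

lemmas [lin] = lin_on_comp[OF Q_lin] lin_on_mem[OF Q_lin]

text \<open>The braiding of Doi-Hopf modules is \<open>m \<otimes> n \<mapsto> Q(n\<^sub>1, m\<^sub>1) (n\<^sub>0 \<otimes> m\<^sub>0)\<close>, while a quasitriangular structure gives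
  \<open>m \<otimes> n \<mapsto> R\<^sup>2 n \<otimes> R\<^sup>1 m\<close>.  Comparing the two gives the exchange of arguments and of tensor factors.\<close>

definition Rm :: "'c \<Rightarrow> 'c \<Rightarrow> ('a, 'a, 'k) tensor" where
  "Rm c d = flip A A (Q (tens C C d c))"

lemma Rm_lin [lin]:
  "lin_on X C f \<Longrightarrow> d \<in> carrier C \<Longrightarrow> lin_on X (tensor A A) (\<lambda>x. Rm (f x) d)"
  "c \<in> carrier C \<Longrightarrow> lin_on X C f \<Longrightarrow> lin_on X (tensor A A) (\<lambda>x. Rm c (f x))"
  "c \<in> carrier C \<Longrightarrow> d \<in> carrier C \<Longrightarrow> Rm c d \<in> carrier (tensor A A)"
  unfolding Rm_def by (intro lin; assumption)+

lemma sweedler_Rm: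
  assumes "vspace U" "bilin_on A A U f" "c \<in> carrier C" "d \<in> carrier C"
  shows "sweedler A A (Rm c d) f = SwQ d c (\<lambda>x y. f y x)"
  unfolding Rm_def by (intro sweedler_flip[OF _ _ assms(1) _ assms(2)] lin assms)

text \<open>The two sides are \<open>\<Delta>\<^sup>o\<^sup>p(b) R\<close> and \<open>R \<Delta>(b)\<close>.  The condition in \<open>C\<close> turns the first, the condition in \<open>A\<close> at
  \<open>a = b(c\<^sub>2 d\<^sub>2)\<close> the second, into the flip of \<open>\<Delta>(b(c\<^sub>2 d\<^sub>2)) Q(d\<^sub>1, c\<^sub>1)\<close>.\<close>

lemma Rm_natural:
  assumes b: "lin_on C A b" and c: "c \<in> carrier C" and d: "d \<in> carrier C"
  shows "conv2 (\<lambda>c d. flip A A (dA (b (mC d c)))) Rm c d = conv2 Rm (\<lambda>c d. dA (b (mC c d))) c d"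
proof -
  note I = lin lin_on_comp[OF b] lin_on_mem[OF b]
  note V = vspace_tensor[of A A]
  \<comment> \<open>Right multiplication of the flip of \<open>\<Delta>(b(z))\<close> by the flip of \<open>T\<close>: the linear map under which
    the condition in \<open>C\<close> is applied.\<close>
  let ?f = "\<lambda>T z. sweedler A A T (\<lambda>y0 x0. SwA (b z) (\<lambda>q p.
    tens A A (mA p x0) (mA q y0)))"
  have f: "bilin_on (tensor A A) C (tensor A A) ?f" by (intro I)
  note l = sweedler_lin_on[OF V V f]
  have "conv2 (\<lambda>c d. flip A A (dA (b (mC d c)))) Rm c d =
    SwC c (\<lambda>c1 c2. SwC d (\<lambda>d1 d2.
        SwQ d2 c2 (\<lambda>y x. SwR y (\<lambda>y0 y1. SwR x (\<lambda>x0 x1.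
          sweedler (tensor A A) C (tens (tensor A A) C (tens A A y0 x0) (mC (act y1 d1) (act x1 c1))) ?f)))))"
    unfolding conv2_def
  proof (intro cong_C I c d)
    fix c1 c2 d1 d2
    assume m: "c1 \<in> carrier C" "c2 \<in> carrier C" "d1 \<in> carrier C" "d2 \<in> carrier C"
    have 1: "sweedler A A (flip A A (dA (b z))) (\<lambda>p q. tens A A (mA p x0) (mA q y0)) =
        sweedler (tensor A A) C (tens (tensor A A) C (tens A A y0 x0) z) ?f"
      if "z \<in> carrier C" "x0 \<in> carrier A" "y0 \<in> carrier A" for z x0 y0
    proof -
      have "sweedler (tensor A A) C (tens (tensor A A) C (tens A A y0 x0) z) ?f = ?f (tens A A y0 x0) z"
        using that by (intro sweedler_tens[OF V f] I)
      also have "\<dots> = SwA (b z) (\<lambda>q p. tens A A (mA p x0) (mA q y0))"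
        using that by (intro sweedler_tens[OF V] I)
      also have "\<dots> = sweedler A A (flip A A (dA (b z))) (\<lambda>p q. tens A A (mA p x0) (mA q y0))"
        using that by (intro sweedler_flip[OF _ _ V, symmetric] I)
      finally show ?thesis ..
    qed
    show "sweedler A A (Rm c2 d2) (\<lambda>x y. SwR x (\<lambda>x0 x1. SwR y (\<lambda>y0 y1.
        sweedler A A (flip A A (dA (b (mC (act y1 d1) (act x1 c1))))) (\<lambda>p q.
          tens A A (mA p x0) (mA q y0))))) =
      SwQ d2 c2 (\<lambda>y x. SwR y (\<lambda>y0 y1. SwR x (\<lambda>x0 x1.
          sweedler (tensor A A) C (tens (tensor A A) C (tens A A y0 x0) (mC (act y1 d1) (act x1 c1))) ?f)))"
      (is "sweedler A A _ ?g = _")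
    proof -
      have "sweedler A A (Rm c2 d2) ?g = SwQ d2 c2 (\<lambda>y x. ?g x y)"
        using m by (intro sweedler_Rm[OF V] I)
      also have "\<dots> = SwQ d2 c2 (\<lambda>y x.
          SwR x (\<lambda>x0 x1. SwR y (\<lambda>y0 y1.
          sweedler (tensor A A) C (tens (tensor A A) C (tens A A y0 x0) (mC (act y1 d1) (act x1 c1))) ?f)))"
        using m by (intro cong_A 1 I)
      also have "\<dots> = SwQ d2 c2 (\<lambda>y x.
          SwR y (\<lambda>y0 y1. SwR x (\<lambda>x0 x1.
          sweedler (tensor A A) C (tens (tensor A A) C (tens A A y0 x0) (mC (act y1 d1) (act x1 c1))) ?f)))"
        by (intro arg_cong[where f = "SwQ d2 c2"] ext sweedler_swap)
      finally show ?thesis .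
    qed
  qed
  also have "\<dots> = sweedler (tensor A A) C (SwC c (\<lambda>c1 c2. SwC d (\<lambda>d1 d2.
        SwQ d2 c2 (\<lambda>p q. SwR p (\<lambda>p0 p1. SwR q (\<lambda>q0 q1.
          tens (tensor A A) C (tens A A p0 q0) (mC (act p1 d1) (act q1 c1)))))))) ?f"
    apply (subst lin_on_sweedler2[OF l])
            apply (intro I c d; assumption)+
    apply (intro cong_C I c d)
    apply (rule lin_on_sweedler3[OF l, symmetric])
    apply (intro I c d; assumption)+
    done
  also have "\<dots> = sweedler (tensor A A) C (SwC c (\<lambda>c1 c2. SwC d (\<lambda>d1 d2.
        tens (tensor A A) C (Q (tens C C d1 c1)) (mC c2 d2)))) ?f"
    by (simp only: Q_natural_C[OF c d])
  also have "\<dots> = SwC c (\<lambda>c1 c2. SwC d (\<lambda>d1 d2. ?f (Q (tens C C d1 c1)) (mC c2 d2)))"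
    by (subst lin_on_sweedler2[OF l])
      (intro I c d cong_C sweedler_tens[OF V f]; assumption)+
  also have "\<dots> = conv2 Rm (\<lambda>c d. dA (b (mC c d))) c d"
    unfolding conv2_def
  proof (intro cong_C I c d)
    fix c1 c2 d1 d2
    assume m: "c1 \<in> carrier C" "c2 \<in> carrier C" "d1 \<in> carrier C" "d2 \<in> carrier C"
    define a where "a = b (mC c2 d2)"
    have a: "a \<in> carrier A" unfolding a_def using m by (intro I)
    have fl: "lin_on (tensor A A) (tensor A A) (flip A A)" by (intro I)
    have ft: "flip A A (tens A A x y) = tens A A y x" if "x \<in> carrier A" "y \<in> carrier A" for x y
      unfolding flip_def using that by (intro sweedler_tens[OF V] I)
    have "?f (Q (tens C C d1 c1)) (mC c2 d2) =
      SwA a (\<lambda>a1 a2. SwQ d1 c1 (\<lambda>p q.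
        flip A A (tens A A (mA a1 p) (mA a2 q))))"
      unfolding a_def[symmetric] using m a
      by (subst sweedler_swap) (intro cong_A I ft[symmetric])
    also have "\<dots> = flip A A (SwA a (\<lambda>a1 a2. SwQ d1 c1 (\<lambda>p q.
        tens A A (mA a1 p) (mA a2 q))))"
      using m a by (intro lin_on_sweedler2[OF fl, symmetric] I)
    also have "\<dots> = flip A A (SwA a (\<lambda>a1 a2. SwR a1 (\<lambda>x0 x1.
        SwR a2 (\<lambda>y0 y1. SwQ (act y1 d1) (act x1 c1) (\<lambda>p q.
          tens A A (mA p y0) (mA q x0))))))"
      using m a by (simp only: Q_natural_A)
    also have "\<dots> = SwA a (\<lambda>a1 a2. SwR a1 (\<lambda>x0 x1.
        SwR a2 (\<lambda>y0 y1. SwQ (act y1 d1) (act x1 c1) (\<lambda>p q.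
          flip A A (tens A A (mA p y0) (mA q x0))))))"
      using m a by (intro lin_on_sweedler4[OF fl] I)
    also have "\<dots> = SwA a (\<lambda>x y. SwR x (\<lambda>x0 x1.
        SwR y (\<lambda>y0 y1. sweedler A A (Rm (act x1 c1) (act y1 d1)) (\<lambda>p q.
          tens A A (mA p x0) (mA q y0)))))"
    proof (intro cong_A I a)
      fix x y x0 x1 y0 y1 assume m': "x \<in> carrier A" "y \<in> carrier A" "x0 \<in> carrier A" "x1 \<in> carrier H"
        "y0 \<in> carrier A" "y1 \<in> carrier H"
      have "sweedler A A (Rm (act x1 c1) (act y1 d1)) (\<lambda>p q. tens A A (mA p x0) (mA q y0)) =
        SwQ (act y1 d1) (act x1 c1) (\<lambda>p q. tens A A (mA q x0) (mA p y0))"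
        using m m' by (intro sweedler_Rm[OF V] I)
      also have "\<dots> = SwQ (act y1 d1) (act x1 c1) (\<lambda>p q.
          flip A A (tens A A (mA p y0) (mA q x0)))"
        using m m' by (intro cong_A I ft[symmetric])
      finally show "SwQ (act y1 d1) (act x1 c1) (\<lambda>p q.
          flip A A (tens A A (mA p y0) (mA q x0))) =
        sweedler A A (Rm (act x1 c1) (act y1 d1)) (\<lambda>p q. tens A A (mA p x0) (mA q y0))" ..
    qed
    finally show "?f (Q (tens C C d1 c1)) (mC c2 d2) = SwA (b (mC c2 d2)) (\<lambda>x y.
        SwR x (\<lambda>x0 x1. SwR y (\<lambda>y0 y1.
          sweedler A A (Rm (act x1 c1) (act y1 d1)) (\<lambda>p q. tens A A (mA p x0) (mA q y0)))))"
      unfolding a_def .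
  qed
  finally show ?thesis .
qed

text \<open>The values of \<open>(\<Delta> \<otimes> id) R = R\<^sup>1\<^sup>3 R\<^sup>2\<^sup>3\<close> at \<open>(c, d, e)\<close>.  \<open>Q\<close> carries the argument \<open>e\<close> in its first tensor factor
  and \<open>R\<close> in its last, so the test map cyclically permutes the factors of the condition.\<close>

lemma Rm_hexagon1:
  assumes U: "vspace U" and F: "trilin_on A A A U f"
    and c: "c \<in> carrier C" and d: "d \<in> carrier C" and e: "e \<in> carrier C"
  shows "sweedler A A (Rm (mC c d) e) (\<lambda>u v. SwA u (\<lambda>x y. f x y v)) =
    SwC e (\<lambda>e1 e2. sweedler A A (Rm d e2) (\<lambda>s1 s2. SwR s2 (\<lambda>a0 a1.
      sweedler A A (Rm c (act a1 e1)) (\<lambda>r1 r2. f r1 s1 (mA r2 a0)))))"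
proof -
  note V = U
  note I = lin U trilin_lin[OF F]
  let ?f = "\<lambda>x y z. f y z x"
  have f: "trilin_on A A A U ?f" by (intro I)
  note l = sweedler3_lin[OF vs(1) vs(1) V f]
  have "sweedler A A (Rm (mC c d) e) (\<lambda>u v. SwA u (\<lambda>x y. f x y v)) =
    SwQ e (mC c d) (\<lambda>x y. SwA y (?f x))"
    by (intro sweedler_Rm[OF V] I c d e)
  also have "\<dots> = sweedler3 A A A (SwQ e (mC c d) (\<lambda>x y. tens A (tensor A A) x (dA y))) ?f"
    by (subst lin_on_sweedler[OF l])
      (intro I c d e cong_A sweedler3_tens2[OF vs(1) V f, symmetric]; assumption)+
  also have "\<dots> = SwC e (\<lambda>e1 e2. SwQ e2 d (\<lambda>p q.
      SwR p (\<lambda>p0 p1. SwQ (act p1 e1) c (\<lambda>x y. ?f (mA x p0) y q))))"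
    unfolding Q_hexagon2[OF c d e]
    by (subst lin_on_sweedler4[OF l])
      (intro I c d e cong_A cong_C sweedler3_tens[OF vs(1) V f]; assumption)+
  also have "\<dots> = SwC e (\<lambda>e1 e2. sweedler A A (Rm d e2) (\<lambda>s1 s2. SwR s2 (\<lambda>a0 a1.
      sweedler A A (Rm c (act a1 e1)) (\<lambda>r1 r2. f r1 s1 (mA r2 a0)))))"
  proof (intro cong_C I e)
    fix e1 e2 assume m: "e1 \<in> carrier C" "e2 \<in> carrier C"
    have "sweedler A A (Rm d e2) (\<lambda>s1 s2. SwR s2 (\<lambda>a0 a1.
        sweedler A A (Rm c (act a1 e1)) (\<lambda>r1 r2. f r1 s1 (mA r2 a0)))) =
      SwQ e2 d (\<lambda>s2 s1. SwR s2 (\<lambda>a0 a1.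
        sweedler A A (Rm c (act a1 e1)) (\<lambda>r1 r2. f r1 s1 (mA r2 a0))))"
      using m by (intro sweedler_Rm[OF V] I c d)
    also have "\<dots> = SwQ e2 d (\<lambda>s2 s1. SwR s2 (\<lambda>a0 a1.
        SwQ (act a1 e1) c (\<lambda>r2 r1. f r1 s1 (mA r2 a0))))"
      using m by (intro cong_A sweedler_Rm[OF V] I c d)
    finally show "SwQ e2 d (\<lambda>p q. SwR p (\<lambda>p0 p1.
        SwQ (act p1 e1) c (\<lambda>x y. ?f (mA x p0) y q))) =
      sweedler A A (Rm d e2) (\<lambda>s1 s2. SwR s2 (\<lambda>a0 a1.
        sweedler A A (Rm c (act a1 e1)) (\<lambda>r1 r2. f r1 s1 (mA r2 a0))))" ..
  qed
  finally show ?thesis .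
qed

text \<open>The values of \<open>(id \<otimes> \<Delta>) R = R\<^sup>1\<^sup>3 R\<^sup>1\<^sup>2\<close> at \<open>(c, d, e)\<close>.\<close>

lemma Rm_hexagon2:
  assumes U: "vspace U" and F: "trilin_on A A A U f"
    and c: "c \<in> carrier C" and d: "d \<in> carrier C" and e: "e \<in> carrier C"
  shows "sweedler A A (Rm c (mC d e)) (\<lambda>u v. SwA v (\<lambda>x y. f u x y)) =
    SwC c (\<lambda>c1 c2. sweedler A A (Rm c2 d) (\<lambda>s1 s2. SwR s1 (\<lambda>a0 a1.
      sweedler A A (Rm (act a1 c1) e) (\<lambda>r1 r2. f (mA r1 a0) s2 r2))))"
proof -
  note V = U
  note I = lin U trilin_lin[OF F]
  let ?f = "\<lambda>x y z. f z x y"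
  have f: "trilin_on A A A U ?f" by (intro I)
  note l = sweedler3_lin[OF vs(1) vs(1) V f]
  have "sweedler A A (Rm c (mC d e)) (\<lambda>u v. SwA v (\<lambda>x y. f u x y)) =
    SwQ (mC d e) c (\<lambda>x y. SwA x (\<lambda>x1 x2. ?f x1 x2 y))"
    by (intro sweedler_Rm[OF V] I c d e)
  also have "\<dots> = sweedler3 A A A (SwQ (mC d e) c (\<lambda>x y.
      SwA x (\<lambda>x1 x2. tens3 A A A x1 x2 y))) ?f"
    by (subst lin_on_sweedler2[OF l])
      (intro I c d e cong_A sweedler3_tens[OF vs(1) V f, symmetric]; assumption)+
  also have "\<dots> = SwC c (\<lambda>c1 c2. SwQ d c2 (\<lambda>p q.
      SwR q (\<lambda>q0 q1. SwQ e (act q1 c1) (\<lambda>x y. ?f p x (mA y q0)))))"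
    unfolding Q_hexagon1[OF c d e]
    by (subst lin_on_sweedler4[OF l])
      (intro I c d e cong_A cong_C sweedler3_tens[OF vs(1) V f]; assumption)+
  also have "\<dots> = SwC c (\<lambda>c1 c2. sweedler A A (Rm c2 d) (\<lambda>s1 s2. SwR s1 (\<lambda>a0 a1.
      sweedler A A (Rm (act a1 c1) e) (\<lambda>r1 r2. f (mA r1 a0) s2 r2))))"
  proof (intro cong_C I c)
    fix c1 c2 assume m: "c1 \<in> carrier C" "c2 \<in> carrier C"
    have "sweedler A A (Rm c2 d) (\<lambda>s1 s2. SwR s1 (\<lambda>a0 a1.
        sweedler A A (Rm (act a1 c1) e) (\<lambda>r1 r2. f (mA r1 a0) s2 r2))) =
      SwQ d c2 (\<lambda>s2 s1. SwR s1 (\<lambda>a0 a1.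
        sweedler A A (Rm (act a1 c1) e) (\<lambda>r1 r2. f (mA r1 a0) s2 r2)))"
      using m by (intro sweedler_Rm[OF V] I d e)
    also have "\<dots> = SwQ d c2 (\<lambda>s2 s1. SwR s1 (\<lambda>a0 a1.
        SwQ e (act a1 c1) (\<lambda>r2 r1. f (mA r1 a0) s2 r2)))"
      using m by (intro cong_A sweedler_Rm[OF V] I d e)
    finally show "SwQ d c2 (\<lambda>p q. SwR q (\<lambda>q0 q1.
        SwQ e (act q1 c1) (\<lambda>x y. ?f p x (mA y q0)))) =
      sweedler A A (Rm c2 d) (\<lambda>s1 s2. SwR s1 (\<lambda>a0 a1.
        sweedler A A (Rm (act a1 c1) e) (\<lambda>r1 r2. f (mA r1 a0) s2 r2)))" ..
  qed
  finally show ?thesis .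
qed

end

section \<open>Reconstruction from finitely many linear maps\<close>

lemma tensor_map_tens:
  assumes "lin_on V V' f" "lin_on W W' g" "v \<in> carrier V" "w \<in> carrier W"
  shows "tensor_map V W V' W' f g (tens V W v w) = tens V' W' (f v) (g w)"
  unfolding tensor_map_def
  by (intro sweedler_tens[OF vspace_tensor[of V' W']] bilin_onI tens_lin1 tens_lin2 lin_on_comp[OF assms(1)]
      lin_on_comp[OF assms(2)] lin_on_id lin_on_mem[OF assms(1)] lin_on_mem[OF assms(2)] assms)

text \<open>A finite family of linear maps \<open>p i\<close> from which every element is linearly recovered.  Unlike joint
  injectivity, this property passes to tensor products at once; it is the way in which finite
  dimensionality enters.\<close>

definition reconstruction where
  "reconstruction V W I p l \<longleftrightarrow> finite I \<and> (\<forall>i\<in>I. lin_on V W (p i) \<and> lin_on W V (l i)) \<and>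
     (\<forall>v\<in>carrier V. (\<Sum>i\<in>I. l i (p i v)) = v)"

lemma reconstruction_inj:
  assumes "reconstruction V W I p l" "v \<in> carrier V" "v' \<in> carrier V"
    and "\<And>i. i \<in> I \<Longrightarrow> p i v = p i v'"
  shows "v = v'"
proof -
  have "v = (\<Sum>i\<in>I. l i (p i v))" using assms(1,2) by (simp add: reconstruction_def)
  also have "\<dots> = (\<Sum>i\<in>I. l i (p i v'))" using assms(4) by simp
  also have "\<dots> = v'" using assms(1,3) by (simp add: reconstruction_def)
  finally show ?thesis .
qed

lemma reconstruction_tensor:
  assumes V: "vspace V" "vspace V'" and W: "vspace W" "vspace W'"
    and p: "reconstruction V W I p l" and q: "reconstruction V' W' J q m"
  shows "reconstruction (tensor V V') (tensor W W') (I \<times> J)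
    (\<lambda>(i, j). tensor_map V V' W W' (p i) (q j)) (\<lambda>(i, j). tensor_map W W' V V' (l i) (m j))"
proof -
  have pl: "lin_on V W (p i)" "lin_on W V (l i)" if "i \<in> I" for i
    using p that by (auto simp: reconstruction_def)
  have qm: "lin_on V' W' (q j)" "lin_on W' V' (m j)" if "j \<in> J" for j
    using q that by (auto simp: reconstruction_def)
  have r: "(\<Sum>i\<in>I. l i (p i v)) = v" if "v \<in> carrier V" for v
    using p that by (simp add: reconstruction_def)
  have r': "(\<Sum>j\<in>J. m j (q j v)) = v" if "v \<in> carrier V'" for v
    using q that by (simp add: reconstruction_def)
  have mem: "l i (p i v) \<in> carrier V" if "i \<in> I" "v \<in> carrier V" for i v
    using pl[OF that(1)] that(2) by (auto simp: lin_on_def)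
  have mem': "m j (q j v) \<in> carrier V'" if "j \<in> J" "v \<in> carrier V'" for j v
    using qm[OF that(1)] that(2) by (auto simp: lin_on_def)
  let ?G = "\<lambda>t. \<Sum>i\<in>I. \<Sum>j\<in>J. tensor_map W W' V V' (l i) (m j) (tensor_map V V' W W' (p i) (q j) t)"
  have "?G t = t" if t: "t \<in> carrier (tensor V V')" for t
  proof (rule lin_on_tensor_eqI[OF V(1) vspace_tensor _ lin_on_id _ t])
    show "lin_on (tensor V V') (tensor V V') ?G"
      by (intro lin_on_sumI lin_on_tensor_map lin_on_id vspace_tensor V W pl qm)
    fix v w assume v: "v \<in> carrier V" and w: "w \<in> carrier V'"
    have "?G (tens V V' v w) = (\<Sum>i\<in>I. \<Sum>j\<in>J. tens V V' (l i (p i v)) (m j (q j w)))"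
      using v w by (intro sum.cong refl)
        (simp add: tensor_map_tens[OF pl(1) qm(1)] tensor_map_tens[OF pl(2) qm(2)]
          lin_on_mem[OF pl(1)] lin_on_mem[OF qm(1)])
    also have "\<dots> = (\<Sum>i\<in>I. tens V V' (l i (p i v)) w)"
    proof (intro sum.cong refl)
      fix i assume i: "i \<in> I"
      have "lin_on V' (tensor V V') (tens V V' (l i (p i v)))"
        by (intro tens_lin2 lin_on_id mem i v)
      from lin_on_sum[OF V(2) vspace_tensor this, of J "\<lambda>j. m j (q j w)"]
      show "(\<Sum>j\<in>J. tens V V' (l i (p i v)) (m j (q j w))) = tens V V' (l i (p i v)) w"
        by (simp add: mem' w r')
    qed
    also have "\<dots> = tens V V' v w"
    proof -
      have "lin_on V (tensor V V') (\<lambda>x. tens V V' x w)" by (intro tens_lin1 lin_on_id w)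
      from lin_on_sum[OF V(1) vspace_tensor this, of I "\<lambda>i. l i (p i v)"]
      show ?thesis by (simp add: mem v r)
    qed
    finally show "?G (tens V V' v w) = tens V V' v w" .
  qed
  moreover have "(\<Sum>x\<in>I \<times> J. (case x of (i, j) \<Rightarrow> tensor_map W W' V V' (l i) (m j))
      ((case x of (i, j) \<Rightarrow> tensor_map V V' W W' (p i) (q j)) t)) = ?G t" for t
    by (simp add: sum.cartesian_product case_prod_unfold)
  ultimately show ?thesis
    using p q V W pl qm unfolding reconstruction_def
    by (auto intro!: lin_on_tensor_map lin_on_id)
qed

section \<open>Hom-bialgebras of linear maps\<close>

text \<open>A Hom-bialgebra structure on a copy \<open>B\<close> of the space of linear maps \<open>C \<rightarrow> A\<close>: \<open>ev c b\<close> is the value of \<open>b\<close>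
  at \<open>c\<close>, and each operation is the ordinary one followed by the twist \<open>s \<mapsto> fA s iC\<close>.  The maps \<open>iA\<close>
  and \<open>iC\<close> are the inverses of the automorphisms \<open>fA\<close> and \<open>fC\<close>.  The coordinates \<open>crd i\<close> belong to the
  finite spanning family \<open>bas i\<close>, and \<open>lft i a\<close> is the map \<open>c \<mapsto> crd i c a\<close>.\<close>

locale smash_evaluation =
  ordinary_datum A H C mA oneA dA eA mH oneH dH eH mC oneC dC eC rho act
  for A :: "('k::field, 'a::ab_group_add, 'x) vspace_scheme"
    and H :: "('k, 'h::ab_group_add, 'y) vspace_scheme"
    and C :: "('k, 'c::ab_group_add, 'z) vspace_scheme"
    and mA oneA dA eA mH oneH dH eH mC oneC dC eC rho act +
  fixes fA iA :: "'a \<Rightarrow> 'a" and fH :: "'h \<Rightarrow> 'h" and fC iC :: "'c \<Rightarrow> 'c"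
    and B :: "('k, 'b::ab_group_add) hom_bialg" and ev :: "'c \<Rightarrow> 'b \<Rightarrow> 'a"
    and I :: "'i set" and bas :: "'i \<Rightarrow> 'c" and crd :: "'i \<Rightarrow> 'c \<Rightarrow> 'k" and lft :: "'i \<Rightarrow> 'a \<Rightarrow> 'b"
  assumes fA_lin: "lin_on A A fA" and iA_lin: "lin_on A A iA" and fH_lin: "lin_on H H fH"
    and fC_lin: "lin_on C C fC" and iC_lin: "lin_on C C iC"
    and fA_iA: "a \<in> carrier A \<Longrightarrow> fA (iA a) = a" and iA_fA: "a \<in> carrier A \<Longrightarrow> iA (fA a) = a"
    and fC_iC: "c \<in> carrier C \<Longrightarrow> fC (iC c) = c" and iC_fC: "c \<in> carrier C \<Longrightarrow> iC (fC c) = c"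
    and fA_mult: "\<lbrakk>a \<in> carrier A; a' \<in> carrier A\<rbrakk> \<Longrightarrow> fA (mA a a') = mA (fA a) (fA a')"
    and fA_one: "fA oneA = oneA"
    and fA_dA: "a \<in> carrier A \<Longrightarrow> dA (fA a) = tensor_map A A A A fA fA (dA a)"
    and fA_eA: "a \<in> carrier A \<Longrightarrow> eA (fA a) = eA a"
    and fA_rho: "a \<in> carrier A \<Longrightarrow> rho (fA a) = tensor_map A H A H fA fH (rho a)"
    and iC_mult: "\<lbrakk>c \<in> carrier C; d \<in> carrier C\<rbrakk> \<Longrightarrow> iC (mC c d) = mC (iC c) (iC d)"
    and iC_one: "iC oneC = oneC"
    and iC_dC: "c \<in> carrier C \<Longrightarrow> dC (iC c) = tensor_map C C C C iC iC (dC c)"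
    and iC_eC: "c \<in> carrier C \<Longrightarrow> eC (iC c) = eC c"
    and iC_act: "\<lbrakk>h \<in> carrier H; c \<in> carrier C\<rbrakk> \<Longrightarrow> iC (act (fH h) c) = act h (iC c)"
    and vs_B: "vspace B" and alpha_B_lin: "lin_on B B (alpha B)" and mul_B_bilin: "bilin_on B B B (mul B)"
    and one_B_mem: "one B \<in> carrier B" and comul_B_lin: "lin_on B (tensor B B) (comul B)"
    and ev_lin_C: "b \<in> carrier B \<Longrightarrow> lin_on C A (\<lambda>c. ev c b)"
    and ev_lin_B: "c \<in> carrier C \<Longrightarrow> lin_on B A (ev c)"
    and ev_alpha: "\<lbrakk>c \<in> carrier C; b \<in> carrier B\<rbrakk> \<Longrightarrow> ev c (alpha B b) = fA (ev (iC c) b)"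
    and ev_mul: "\<lbrakk>c \<in> carrier C; b \<in> carrier B; b' \<in> carrier B\<rbrakk> \<Longrightarrow>
      ev c (mul B b b') = fA (conv (\<lambda>x. ev x b) (\<lambda>x. ev x b') (iC c))"
    and ev_one: "c \<in> carrier C \<Longrightarrow> ev c (one B) = smul A (eC c) oneA"
    and ev_comul: "\<lbrakk>c \<in> carrier C; d \<in> carrier C; b \<in> carrier B\<rbrakk> \<Longrightarrow>
      tensor_map B B A A (ev c) (ev d) (comul B b) = dA (fA (ev (iC (mC c d)) b))"
    and counit_ev: "b \<in> carrier B \<Longrightarrow> counit B b = eA (ev oneC b)"
    and fin_I: "finite I" and bas_mem: "i \<in> I \<Longrightarrow> bas i \<in> carrier C"
    and lft_lin: "i \<in> I \<Longrightarrow> lin_on A B (lft i)"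
    and ev_lft: "\<lbrakk>i \<in> I; c \<in> carrier C; a \<in> carrier A\<rbrakk> \<Longrightarrow> ev c (lft i a) = smul A (crd i c) a"
    and lft_ev: "b \<in> carrier B \<Longrightarrow> (\<Sum>i\<in>I. lft i (ev (bas i) b)) = b"
    and crd_bas: "c \<in> carrier C \<Longrightarrow> (\<Sum>i\<in>I. smul C (crd i c) (bas i)) = c"
begin

abbreviation SwB where "SwB b f \<equiv> sweedler B B (comul B b) f"

lemma ev_lin1: "b \<in> carrier B \<Longrightarrow> lin_on X C g \<Longrightarrow> lin_on X A (\<lambda>x. ev (g x) b)"
  using lin_on_comp[OF ev_lin_C] .

lemma ev_lin2: "c \<in> carrier C \<Longrightarrow> lin_on X B g \<Longrightarrow> lin_on X A (\<lambda>x. ev c (g x))"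
  using lin_on_comp[OF ev_lin_B] .

lemma ev_mem: "c \<in> carrier C \<Longrightarrow> b \<in> carrier B \<Longrightarrow> ev c b \<in> carrier A"
  using lin_on_mem[OF ev_lin_B] .

lemmas [lin] = lin_on_comp[OF fA_lin] lin_on_comp[OF iA_lin] lin_on_comp[OF fH_lin]
  lin_on_comp[OF fC_lin] lin_on_comp[OF iC_lin] lin_on_mem[OF fA_lin] lin_on_mem[OF iA_lin]
  lin_on_mem[OF fH_lin] lin_on_mem[OF fC_lin] lin_on_mem[OF iC_lin]
  vs_B lin_on_comp[OF alpha_B_lin] lin_on_mem[OF alpha_B_lin]
  bilin_on_lin1[OF mul_B_bilin] bilin_on_lin2[OF mul_B_bilin] bilin_on_mem[OF mul_B_bilin]
  one_B_mem lin_on_comp[OF comul_B_lin] lin_on_mem[OF comul_B_lin] ev_lin1 ev_lin2 ev_mem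

lemmas cong_B = sweedler_cong[OF vs_B refl]

lemmas mems = ev_mem lin_on_mem[OF fA_lin] lin_on_mem[OF iC_lin] lin_on_mem[OF alpha_B_lin]
  bilin_on_mem[OF mul_B_bilin] one_B_mem lin_on_mem[OF comul_B_lin]

lemma reconstruction_B: "reconstruction B A I (\<lambda>i. ev (bas i)) lft"
  unfolding reconstruction_def using fin_I ev_lin_B bas_mem lft_lin lft_ev by blast

definition EV2 where "EV2 c d = tensor_map B B A A (ev c) (ev d)"

definition EV3 where
  "EV3 c d e = tensor_map B (tensor B B) A (tensor A A) (ev c) (EV2 d e)"

lemma EV2_lin [lin]: "c \<in> carrier C \<Longrightarrow> d \<in> carrier C \<Longrightarrow> lin_on X (tensor B B) g \<Longrightarrow>
    lin_on X (tensor A A) (\<lambda>x. EV2 c d (g x))"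
  unfolding EV2_def by (intro lin ev_lin_B)

lemma EV2_lin' [lin]:
  "t \<in> carrier (tensor B B) \<Longrightarrow> d \<in> carrier C \<Longrightarrow> lin_on X C g \<Longrightarrow>
    lin_on X (tensor A A) (\<lambda>x. EV2 (g x) d t)"
  "t \<in> carrier (tensor B B) \<Longrightarrow> c \<in> carrier C \<Longrightarrow> lin_on X C g \<Longrightarrow>
    lin_on X (tensor A A) (\<lambda>x. EV2 c (g x) t)"
  unfolding EV2_def tensor_map_def by (intro lin; assumption)+

lemma EV2_mem [lin]:
  assumes "c \<in> carrier C" "d \<in> carrier C" "t \<in> carrier (tensor B B)"
  shows "EV2 c d t \<in> carrier (tensor A A)"
  unfolding EV2_def using assms by (intro tensor_map_mem ev_lin_B vs_B)

lemma EV3_lin: "c \<in> carrier C \<Longrightarrow> d \<in> carrier C \<Longrightarrow> e \<in> carrier C \<Longrightarrow>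
    lin_on (tensor B (tensor B B)) (tensor A (tensor A A)) (EV3 c d e)"
  unfolding EV3_def by (intro lin ev_lin_B)

lemma ev_inj:
  assumes "b \<in> carrier B" "b' \<in> carrier B" "\<And>c. c \<in> carrier C \<Longrightarrow> ev c b = ev c b'"
  shows "b = b'"
  by (rule reconstruction_inj[OF reconstruction_B assms(1,2)]) (simp add: assms(3) bas_mem)

lemma EV2_inj:
  assumes "b \<in> carrier (tensor B B)" "b' \<in> carrier (tensor B B)"
    and "\<And>c d. c \<in> carrier C \<Longrightarrow> d \<in> carrier C \<Longrightarrow> EV2 c d b = EV2 c d b'"
  shows "b = b'"
  by (rule reconstruction_inj[OF reconstruction_tensor[OF vs_B vs_B vs(1) vs(1) reconstruction_B
        reconstruction_B] assms(1,2)]) (use assms(3) bas_mem in \<open>auto simp: EV2_def\<close>)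

lemma EV3_inj:
  assumes "b \<in> carrier (tensor B (tensor B B))" "b' \<in> carrier (tensor B (tensor B B))"
    and "\<And>c d e. c \<in> carrier C \<Longrightarrow> d \<in> carrier C \<Longrightarrow> e \<in> carrier C \<Longrightarrow> EV3 c d e b = EV3 c d e b'"
  shows "b = b'"
  by (rule reconstruction_inj[OF reconstruction_tensor[OF vs_B vspace_tensor vs(1) vspace_tensor
        reconstruction_B reconstruction_tensor[OF vs_B vs_B vs(1) vs(1) reconstruction_B
        reconstruction_B]] assms(1,2)])
    (use assms(3) bas_mem in \<open>auto simp: EV2_def EV3_def\<close>)

lemma EV2_tens:
  "\<lbrakk>c \<in> carrier C; d \<in> carrier C; x \<in> carrier B; y \<in> carrier B\<rbrakk> \<Longrightarrow>
    EV2 c d (tens B B x y) = tens A A (ev c x) (ev d y)"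
  unfolding EV2_def by (intro tensor_map_tens ev_lin_B)

lemma EV3_tens2:
  "\<lbrakk>c \<in> carrier C; d \<in> carrier C; e \<in> carrier C; x \<in> carrier B; t \<in> carrier (tensor B B)\<rbrakk> \<Longrightarrow>
    EV3 c d e (tens B (tensor B B) x t) = tens A (tensor A A) (ev c x) (EV2 d e t)"
  unfolding EV3_def by (intro tensor_map_tens ev_lin_B lin)

lemma EV3_tens3:
  "\<lbrakk>c \<in> carrier C; d \<in> carrier C; e \<in> carrier C; x \<in> carrier B; y \<in> carrier B; z \<in> carrier B\<rbrakk> \<Longrightarrow>
    EV3 c d e (tens3 B B B x y z) = tens3 A A A (ev c x) (ev d y) (ev e z)"
  unfolding tens3_def by (simp add: EV3_tens2 EV2_tens tens_in_tensor)

lemma sweedler_EV2: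
  assumes "vspace U" "bilin_on A A U f" "c \<in> carrier C" "d \<in> carrier C" "t \<in> carrier (tensor B B)"
  shows "sweedler B B t (\<lambda>x y. f (ev c x) (ev d y)) = sweedler A A (EV2 c d t) f"
  unfolding EV2_def
  by (rule sweedler_tensor_map[symmetric, OF vs_B vs(1) assms(1) ev_lin_B ev_lin_B assms(5,2)])
    (rule assms)+

lemma sweedler_comul:
  assumes "vspace U" "bilin_on A A U f" "c \<in> carrier C" "d \<in> carrier C" "b \<in> carrier B"
  shows "SwB b (\<lambda>x y. f (ev c x) (ev d y)) =
    SwA (fA (ev (iC (mC c d)) b)) f"
  using sweedler_EV2[OF assms(1-4) lin_on_mem[OF comul_B_lin assms(5)]]
  by (simp add: EV2_def ev_comul assms)

lemma conv_twist:
  assumes "lin_on C A s" "lin_on C A t" "c \<in> carrier C"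
  shows "conv (\<lambda>c. fA (s (iC c))) (\<lambda>c. fA (t (iC c))) c = fA (conv s t (iC c))"
  by (rule conv_equivariant[OF assms fA_lin iC_lin fH_lin fA_mult fA_rho iC_dC iC_act])

lemma lin_on_conv_ev [lin]:
  "\<lbrakk>b \<in> carrier B; b' \<in> carrier B; lin_on X C g\<rbrakk> \<Longrightarrow>
    lin_on X A (\<lambda>x. conv (\<lambda>x. ev x b) (\<lambda>x. ev x b') (g x))"
  by (intro lin_on_conv ev_lin_C)

lemma conv_ev_mem [lin]:
  "\<lbrakk>b \<in> carrier B; b' \<in> carrier B; c \<in> carrier C\<rbrakk> \<Longrightarrow> conv (\<lambda>x. ev x b) (\<lambda>x. ev x b') c \<in> carrier A"
  using lin_on_mem[OF lin_on_conv_ev[OF _ _ lin_on_id]] .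

text \<open>Bijectivity of the twist: a preimage of \<open>b\<close> is assembled from the values of \<open>c \<mapsto> iA(b(fC(c)))\<close>.\<close>

lemma hom_space_B: "hom_space B"
proof (intro hom_space.intro hom_space_axioms.intro vs_B)
  show "lin_on B B (alpha B)" by (rule alpha_B_lin)
  show "bij_betw (alpha B) (carrier B) (carrier B)"
  proof (intro bij_betw_imageI inj_onI equalityI subsetI)
    fix b b' assume b: "b \<in> carrier B" "b' \<in> carrier B" and eq: "alpha B b = alpha B b'"
    show "b = b'"
    proof (rule ev_inj[OF b])
      fix c assume c: "c \<in> carrier C"
      then have "iA (ev (fC c) (alpha B b)) = iA (ev (fC c) (alpha B b'))" using eq by simp
      then show "ev c b = ev c b'"
        using b c by (simp add: ev_alpha lin_on_mem[OF fC_lin] iC_fC iA_fA ev_mem)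
    qed
  next
    fix b assume "b \<in> alpha B ` carrier B"
    then show "b \<in> carrier B" using lin_on_mem[OF alpha_B_lin] by auto
  next
    fix b assume b: "b \<in> carrier B"
    define b' where "b' = (\<Sum>i\<in>I. lft i (iA (ev (fC (bas i)) b)))"
    have m: "iA (ev (fC c) b) \<in> carrier A" if "c \<in> carrier C" for c using b that by (intro lin)
    have b': "b' \<in> carrier B"
      unfolding b'_def using b by (intro vspace_sum vs_B lin_on_mem[OF lft_lin] m bas_mem)
    have "alpha B b' = b"
    proof (rule ev_inj[OF _ b])
      show "alpha B b' \<in> carrier B" using b' by (intro lin)
      fix c assume c: "c \<in> carrier C"
      let ?k = "\<lambda>x. iA (ev (fC x) b)"
      have k: "lin_on C A ?k" using b by (intro lin)
      have ic: "iC c \<in> carrier C" using c by (intro lin)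
      have "ev (iC c) b' = (\<Sum>i\<in>I. ev (iC c) (lft i (?k (bas i))))"
        unfolding b'_def
        by (intro lin_on_sum[OF vs_B vs(1) ev_lin_B] ic lin_on_mem[OF lft_lin] m bas_mem)
      also have "\<dots> = (\<Sum>i\<in>I. ?k (smul C (crd i (iC c)) (bas i)))"
        by (intro sum.cong refl) (simp add: ev_lft ic m bas_mem lin_on_smul[OF k])
      also have "\<dots> = ?k (\<Sum>i\<in>I. smul C (crd i (iC c)) (bas i))"
        by (intro lin_on_sum[OF vs(3) vs(1) k, symmetric] vspace_smul vs bas_mem)
      also have "\<dots> = ?k (iC c)" by (simp only: crd_bas[OF ic])
      finally have "ev (iC c) b' = ?k (iC c)" .
      then show "ev c (alpha B b') = ev c b"
        using b b' c by (simp add: ev_alpha fC_iC fA_iA ev_mem)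
    qed
    then show "b \<in> alpha B ` carrier B" using b' by auto
  qed
qed


text \<open>Each Hom-axiom is an identity for \<open>conv\<close> composed with powers of the twist, by equivariance.\<close>

lemma hom_algebra_B: "hom_algebra B"
proof (intro hom_algebra.intro hom_algebra_axioms.intro hom_space_B)
  show "bilin_on B B B (mul B)" by (rule mul_B_bilin)
  show "one B \<in> carrier B" by (rule one_B_mem)
  have conv_alpha: "conv (\<lambda>x. ev x (alpha B a)) (\<lambda>x. ev x (alpha B b)) c =
      fA (conv (\<lambda>x. ev x a) (\<lambda>x. ev x b) (iC c))"
    if "a \<in> carrier B" "b \<in> carrier B" "c \<in> carrier C" for a b c
  proof -
    have "conv (\<lambda>x. ev x (alpha B a)) (\<lambda>x. ev x (alpha B b)) c =
      conv (\<lambda>x. fA (ev (iC x) a)) (\<lambda>x. fA (ev (iC x) b)) c"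
      using that by (intro conv_cong) (simp_all add: ev_alpha | intro lin)+
    then show ?thesis using conv_twist[OF ev_lin_C ev_lin_C] that by simp
  qed
  show "alpha B (mul B a b) = mul B (alpha B a) (alpha B b)"
    if ab: "a \<in> carrier B" "b \<in> carrier B" for a b
    by (rule ev_inj) (simp_all add: ab mems ev_alpha ev_mul conv_alpha)
  show "alpha B (one B) = one B"
    by (rule ev_inj)
      (simp_all add: mems ev_alpha ev_one iC_eC lin_on_smul[OF fA_lin] oneA_mem fA_one)
  fix a assume a: "a \<in> carrier B"
  have o: "lin_on C A (\<lambda>x. smul A (eC x) oneA)" by (intro lin)
  show "mul B (one B) a = alpha B a"
  proof (rule ev_inj)
    fix c assume c: "c \<in> carrier C"
    have "conv (\<lambda>x. ev x (one B)) (\<lambda>x. ev x a) (iC c) = conv (\<lambda>x. smul A (eC x) oneA) (\<lambda>x. ev x a) (iC c)"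
      using a c by (intro conv_cong) (simp_all add: ev_one | intro lin)+
    then show "ev c (mul B (one B) a) = ev c (alpha B a)"
      using a c by (simp add: ev_mul ev_alpha mems conv_counit ev_lin_C)
  qed (use a in \<open>simp_all add: mems\<close>)
  show "mul B a (one B) = alpha B a"
  proof (rule ev_inj)
    fix c assume c: "c \<in> carrier C"
    have "conv (\<lambda>x. ev x a) (\<lambda>x. ev x (one B)) (iC c) = conv (\<lambda>x. ev x a) (\<lambda>x. smul A (eC x) oneA) (iC c)"
      using a c o by (intro conv_cong) (simp_all add: ev_one mems)
    then show "ev c (mul B a (one B)) = ev c (alpha B a)"
      using a c by (simp add: ev_mul ev_alpha mems conv_counit ev_lin_C)
  qed (use a in \<open>simp_all add: mems\<close>)
  fix b d assume b: "b \<in> carrier B" and d: "d \<in> carrier B"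
  show "mul B (alpha B a) (mul B b d) = mul B (mul B a b) (alpha B d)"
  proof (rule ev_inj)
    fix c assume "c \<in> carrier C"
    then have c: "iC c \<in> carrier C" by (intro lin)
    have "conv (\<lambda>x. ev x (alpha B a)) (\<lambda>x. ev x (mul B b d)) (iC c) =
        conv (\<lambda>x. fA (ev (iC x) a)) (\<lambda>x. fA (conv (\<lambda>x. ev x b) (\<lambda>x. ev x d) (iC x))) (iC c)"
      using a b d c \<open>c \<in> carrier C\<close> by (intro conv_cong) (simp_all add: ev_alpha ev_mul | intro lin)+
    also have "\<dots> = fA (conv (\<lambda>x. ev x a) (conv (\<lambda>x. ev x b) (\<lambda>x. ev x d)) (iC (iC c)))"
      using a b d \<open>c \<in> carrier C\<close> by (intro conv_twist lin)
    also have "\<dots> = fA (conv (conv (\<lambda>x. ev x a) (\<lambda>x. ev x b)) (\<lambda>x. ev x d) (iC (iC c)))"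
      using a b d \<open>c \<in> carrier C\<close> by (subst conv_assoc) (intro lin refl; assumption)+
    also have "\<dots> = conv (\<lambda>x. fA (conv (\<lambda>x. ev x a) (\<lambda>x. ev x b) (iC x))) (\<lambda>x. fA (ev (iC x) d)) (iC c)"
      using a b d \<open>c \<in> carrier C\<close> by (intro conv_twist[symmetric] lin)
    also have "\<dots> = conv (\<lambda>x. ev x (mul B a b)) (\<lambda>x. ev x (alpha B d)) (iC c)"
      using a b d c \<open>c \<in> carrier C\<close> by (intro conv_cong) (simp_all add: ev_alpha ev_mul mems ev_lin_C)
    finally show "ev c (mul B (alpha B a) (mul B b d)) = ev c (mul B (mul B a b) (alpha B d))"
      using a b d \<open>c \<in> carrier C\<close> by (simp add: ev_mul mems)
  qed (use a b d in \<open>simp_all add: mems\<close>)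
qed

lemma hom_coalgebra_B: "hom_coalgebra B"
proof (intro hom_coalgebra.intro hom_coalgebra_axioms.intro hom_space_B)
  note VB = vspace_tensor[of B "tensor B B"] and VA = vspace_tensor[of A "tensor A A"]
  show "lin_on B (tensor B B) (comul B)" by (rule comul_B_lin)
  have "lin_on B ground (\<lambda>b. eA (ev oneC b))" by (intro lin)
  then show "lin_on B ground (counit B)"
    by (rule lin_on_cong[OF vs_B, rotated]) (rule counit_ev)
  fix b assume b: "b \<in> carrier B"
  show "counit B (alpha B b) = counit B b"
    using b by (simp add: counit_ev mems ev_alpha fA_eA iC_one oneC_mem)
  show "tensor_map B B B B (alpha B) (alpha B) (comul B b) = comul B (alpha B b)"
  proof (rule EV2_inj)
    fix c d assume c: "c \<in> carrier C" and d: "d \<in> carrier C"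
    have l: "lin_on (tensor B B) (tensor A A) (EV2 c d)" using c d by (intro lin)
    let ?g = "\<lambda>x y. tens A A (fA x) (fA y)"
    have "EV2 c d (tensor_map B B B B (alpha B) (alpha B) (comul B b)) =
      SwB b (\<lambda>x y. EV2 c d (tens B B (alpha B x) (alpha B y)))"
      unfolding tensor_map_def using b c d by (intro lin_on_sweedler[OF l] lin)
    also have "\<dots> = SwB b (\<lambda>x y. ?g (ev (iC c) x) (ev (iC d) y))"
      using b c d by (intro cong_B) (simp_all add: EV2_tens mems ev_alpha)
    also have "\<dots> = sweedler A A (dA (fA (ev (iC (mC (iC c) (iC d))) b))) ?g"
      using b c d by (intro sweedler_comul[OF vspace_tensor[of A A]] lin)
    also have "\<dots> = dA (fA (ev (iC (mC c d)) (alpha B b)))"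
    proof -
      have "mC c d \<in> carrier C" using c d by (intro lin)
      then show ?thesis
        using b c d
        by (simp add: ev_alpha iC_mult[symmetric] mems fA_dA[symmetric] tensor_map_def[symmetric])
    qed
    also have "\<dots> = EV2 c d (comul B (alpha B b))"
      using b c d by (simp add: EV2_def ev_comul mems)
    finally show "EV2 c d (tensor_map B B B B (alpha B) (alpha B) (comul B b)) =
      EV2 c d (comul B (alpha B b))" .
  next
    show "tensor_map B B B B (alpha B) (alpha B) (comul B b) \<in> carrier (tensor B B)"
      using b by (intro tensor_map_mem alpha_B_lin lin)
    show "comul B (alpha B b) \<in> carrier (tensor B B)" using b by (intro lin)
  qed
  show "SwB b (\<lambda>b1 b2. smul B (counit B b1) b2) = alpha B b"
  proof (rule ev_inj)
    have m: "smul B (counit B b1) b2 \<in> carrier B" if "b2 \<in> carrier B" for b1 b2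
      using that by (intro lin)
    then show "SwB b (\<lambda>b1 b2. smul B (counit B b1) b2) \<in> carrier B"
      using b by (intro sweedler_mem vs_B lin)
    fix c assume c: "c \<in> carrier C"
    have "ev c (SwB b (\<lambda>b1 b2. smul B (counit B b1) b2)) =
      SwB b (\<lambda>b1 b2. ev c (smul B (counit B b1) b2))"
      using b c by (intro lin_on_sweedler[OF ev_lin_B] m lin)
    also have "\<dots> = SwB b (\<lambda>b1 b2. smul A (eA (ev oneC b1)) (ev c b2))"
      using b c by (intro cong_B)
        (simp_all add: mems lin_on_smul[OF ev_lin_B] counit_ev)
    also have "\<dots> = SwA (fA (ev (iC (mC oneC c)) b)) (\<lambda>x y. smul A (eA x) y)"
      using b c by (intro sweedler_comul[OF vs(1)] lin)
    also have "\<dots> = ev c (alpha B b)"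
      using b c by (simp add: mC_one ev_alpha dA_counit mems)
    finally show "ev c (SwB b (\<lambda>b1 b2. smul B (counit B b1) b2)) =
      ev c (alpha B b)" .
  qed (use b in \<open>simp add: mems\<close>)
  show "SwB b (\<lambda>b1 b2. smul B (counit B b2) b1) = alpha B b"
  proof (rule ev_inj)
    have m: "smul B (counit B b1) b2 \<in> carrier B" if "b2 \<in> carrier B" for b1 b2
      using that by (intro lin)
    then show "SwB b (\<lambda>b1 b2. smul B (counit B b2) b1) \<in> carrier B"
      using b by (intro sweedler_mem vs_B lin)
    fix c assume c: "c \<in> carrier C"
    have "ev c (SwB b (\<lambda>b1 b2. smul B (counit B b2) b1)) =
      SwB b (\<lambda>b1 b2. ev c (smul B (counit B b2) b1))"
      using b c by (intro lin_on_sweedler[OF ev_lin_B] m lin)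
    also have "\<dots> = SwB b (\<lambda>b1 b2. smul A (eA (ev oneC b2)) (ev c b1))"
      using b c by (intro cong_B)
        (simp_all add: mems lin_on_smul[OF ev_lin_B] counit_ev)
    also have "\<dots> = SwA (fA (ev (iC (mC c oneC)) b)) (\<lambda>x y. smul A (eA y) x)"
      using b c by (intro sweedler_comul[OF vs(1)] lin)
    also have "\<dots> = ev c (alpha B b)"
      using b c by (simp add: mC_one ev_alpha dA_counit mems)
    finally show "ev c (SwB b (\<lambda>b1 b2. smul B (counit B b2) b1)) =
      ev c (alpha B b)" .
  qed (use b in \<open>simp add: mems\<close>)
  show "SwB b (\<lambda>b1 b2. SwB b1 (\<lambda>b11 b12.
      tens3 B B B b11 b12 (alpha B b2))) =
    SwB b (\<lambda>b1 b2. tens B (tensor B B) (alpha B b1) (comul B b2))"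
  proof (rule EV3_inj)
    fix c d e assume c: "c \<in> carrier C" and d: "d \<in> carrier C" and e: "e \<in> carrier C"
    have l: "lin_on (tensor B (tensor B B)) (tensor A (tensor A A)) (EV3 c d e)"
      using c d e by (intro EV3_lin)
    let ?x = "ev (iC (mC (iC (mC c d)) (iC e))) b"
    let ?f = "\<lambda>x y z. tens3 A A A (fA x) (fA y) (fA z)"
    have x: "?x \<in> carrier A" using b c d e by (intro lin)
    have dAf: "SwA (fA a) f = SwA a (\<lambda>x y. f (fA x) (fA y))"
      if "a \<in> carrier A" "bilin_on A A (tensor A (tensor A A)) f" for a f
      unfolding fA_dA[OF that(1)] using that
      by (intro sweedler_tensor_map[OF vs(1) vs(1) VA fA_lin fA_lin] lin_on_mem[OF dA_lin])
    have "EV3 c d e (SwB b (\<lambda>b1 b2. SwB b1 (\<lambda>b11 b12.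
        tens3 B B B b11 b12 (alpha B b2)))) =
      SwB b (\<lambda>b1 b2. SwB b1 (\<lambda>b11 b12.
        EV3 c d e (tens3 B B B b11 b12 (alpha B b2))))"
      using b by (intro lin_on_sweedler2[OF l] lin)
    also have "\<dots> = SwB b (\<lambda>b1 b2. SwB b1 (\<lambda>b11 b12.
        tens3 A A A (ev c b11) (ev d b12) (fA (ev (iC e) b2))))"
      using b c d e by (intro cong_B lin) (simp_all add: EV3_tens3 mems ev_alpha)
    also have "\<dots> = SwB b (\<lambda>b1 b2. SwA (fA (ev (iC (mC c d)) b1)) (\<lambda>u v.
        tens3 A A A u v (fA (ev (iC e) b2))))"
      using b c d e by (intro cong_B sweedler_comul[OF VA] lin)
    also have "\<dots> = SwA (fA ?x) (\<lambda>x y. SwA (fA x) (\<lambda>u v. tens3 A A A u v (fA y)))"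
      using b c d e by (intro sweedler_comul[OF VA] lin)
    also have "\<dots> = SwA (fA ?x) (\<lambda>x y. SwA x (\<lambda>u v. ?f u v y))"
      using b c d e by (intro cong_A dAf lin)
    also have "\<dots> = SwA (fA ?x) (\<lambda>x y. SwA y (?f x))"
      using b c d e by (intro coassoc_A[OF VA] lin)
    finally have 1: "EV3 c d e (SwB b (\<lambda>b1 b2. SwB b1 (\<lambda>b11 b12.
        tens3 B B B b11 b12 (alpha B b2)))) = SwA (fA ?x) (\<lambda>x y. SwA y (?f x))" .
    have "EV3 c d e (SwB b (\<lambda>b1 b2. tens B (tensor B B) (alpha B b1) (comul B b2))) =
      SwB b (\<lambda>b1 b2. EV3 c d e (tens B (tensor B B) (alpha B b1) (comul B b2)))"
      using b by (intro lin_on_sweedler[OF l] lin)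
    also have "\<dots> = SwB b (\<lambda>b1 b2. tens A (tensor A A) (fA (ev (iC c) b1)) (dA (fA (ev (iC (mC d e)) b2))))"
      using b c d e by (intro cong_B)
        (simp_all add: EV3_tens2 mems ev_alpha ev_comul EV2_def)
    also have "\<dots> = sweedler A A (dA (fA (ev (iC (mC (iC c) (iC (mC d e)))) b))) (\<lambda>x y.
        tens A (tensor A A) (fA x) (dA (fA y)))"
      using b c d e by (intro sweedler_comul[OF vspace_tensor[of A "tensor A A"]] lin)
    also have "ev (iC (mC (iC c) (iC (mC d e)))) b = ?x"
    proof -
      have "mC (iC c) (iC (mC d e)) = mC (iC (mC c d)) (iC e)"
        using c d e by (simp add: iC_mult mC_assoc lin_on_mem[OF iC_lin])
      then show ?thesis by simp
    qed
    also have "SwA (fA ?x) (\<lambda>x y. tens A (tensor A A) (fA x) (dA (fA y))) =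
      SwA (fA ?x) (\<lambda>x y. SwA y (?f x))"
    proof (rule cong_A, use b c d e in \<open>intro lin\<close>)
      fix u v assume u: "u \<in> carrier A" and v: "v \<in> carrier A"
      have t: "lin_on (tensor A A) (tensor A (tensor A A)) (tens A (tensor A A) (fA u))"
        using u by (intro lin)
      show "tens A (tensor A A) (fA u) (dA (fA v)) = SwA v (?f u)"
        unfolding fA_dA[OF v] tensor_map_def tens3_def using u v by (intro lin_on_sweedler[OF t] lin)
    qed
    finally show "EV3 c d e (SwB b (\<lambda>b1 b2. SwB b1 (\<lambda>b11 b12.
        tens3 B B B b11 b12 (alpha B b2)))) =
      EV3 c d e (SwB b (\<lambda>b1 b2. tens B (tensor B B) (alpha B b1) (comul B b2)))"
      using 1 by simp
  qed (intro lin b; assumption)+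
qed

lemma mul_tensor_alg: "mul (tensor_alg B B) S T =
    sweedler B B S (\<lambda>a b. sweedler B B T (\<lambda>a' b'. tens B B (mul B a a') (mul B b b')))"
  by (simp add: tensor_alg_def)

lemma mul_tensor_alg_mem [lin]:
  "\<lbrakk>S \<in> carrier (tensor B B); T \<in> carrier (tensor B B)\<rbrakk> \<Longrightarrow>
    mul (tensor_alg B B) S T \<in> carrier (tensor B B)"
  unfolding mul_tensor_alg by (intro lin)

text \<open>\<open>B \<otimes> B\<close> multiplies by the convolution of \<open>A \<otimes> A\<close> and \<open>C \<otimes> C\<close>, again up to the twist.\<close>

lemma EV2_mul:
  assumes S: "S \<in> carrier (tensor B B)" and T: "T \<in> carrier (tensor B B)"
    and c: "c \<in> carrier C" and d: "d \<in> carrier C"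
  shows "EV2 c d (mul (tensor_alg B B) S T) = tensor_map A A A A fA fA
    (conv2 (\<lambda>c d. EV2 c d S) (\<lambda>c d. EV2 c d T) (iC c) (iC d))"
proof -
  note V = vspace_tensor[of A A]
  have l: "lin_on (tensor B B) (tensor A A) (EV2 c d)" using c d by (intro lin)
  have ff: "lin_on (tensor A A) (tensor A A) (tensor_map A A A A fA fA)"
    by (intro lin fA_lin)
  have ic: "iC c \<in> carrier C" "iC d \<in> carrier C" using c d lin_on_mem[OF iC_lin] by auto
  let ?c = "\<lambda>x y. conv (\<lambda>c. ev c x) (\<lambda>c. ev c y)"
  let ?k = "\<lambda>a b a' b' c1 c2 d1 d2. SwR (ev c2 a') (\<lambda>x0 x1.
      SwR (ev d2 b') (\<lambda>y0 y1. tens A A (mA (ev (act x1 c1) a) x0) (mA (ev (act y1 d1) b) y0)))"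
  have conv_tens: "tens A A (?c a a' (iC c)) (?c b b' (iC d)) =
      SwC (iC c) (\<lambda>c1 c2. SwC (iC d) (?k a b a' b' c1 c2))"
    if m: "a \<in> carrier B" "b \<in> carrier B" "a' \<in> carrier B" "b' \<in> carrier B" for a b a' b'
  proof -
    have l1: "lin_on A (tensor A A) (\<lambda>x. tens A A x (?c b b' (iC d)))"
      using m d by (intro lin)
    have l2: "lin_on A (tensor A A) (tens A A x)" if "x \<in> carrier A" for x
      using that by (intro lin)
    have "tens A A (?c a a' (iC c)) (?c b b' (iC d)) =
      SwC (iC c) (\<lambda>c1 c2. SwR (ev c2 a') (\<lambda>x0 x1.
        tens A A (mA (ev (act x1 c1) a) x0) (?c b b' (iC d))))"
      unfolding conv_def[of "\<lambda>c. ev c a"] using m c d by (intro lin_on_sweedler2[OF l1] lin)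
    also have "\<dots> = SwC (iC c) (\<lambda>c1 c2. SwR (ev c2 a') (\<lambda>x0 x1.
        SwC (iC d) (\<lambda>d1 d2. SwR (ev d2 b') (\<lambda>y0 y1.
          tens A A (mA (ev (act x1 c1) a) x0) (mA (ev (act y1 d1) b) y0)))))"
      unfolding conv_def using m c d
      by (intro cong_A cong_C lin_on_sweedler2[OF l2] lin)
    also have "\<dots> = SwC (iC c) (\<lambda>c1 c2. SwC (iC d) (?k a b a' b' c1 c2))"
      by (intro arg_cong[where f = "SwC (iC c)"] ext sweedler_swap)
    finally show ?thesis .
  qed
  have "EV2 c d (mul (tensor_alg B B) S T) =
    sweedler B B S (\<lambda>a b. sweedler B B T (\<lambda>a' b'. EV2 c d (tens B B (mul B a a') (mul B b b'))))"
    unfolding mul_tensor_alg using S T by (intro lin_on_sweedler2[OF l] lin)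
  also have "\<dots> = sweedler B B S (\<lambda>a b. sweedler B B T (\<lambda>a' b'.
      tensor_map A A A A fA fA (tens A A (?c a a' (iC c)) (?c b b' (iC d)))))"
    using S T c d ic by (intro cong_B)
      (simp_all add: EV2_tens ev_mul mems tensor_map_tens fA_lin conv_ev_mem)
  also have "\<dots> = tensor_map A A A A fA fA (sweedler B B S (\<lambda>a b. sweedler B B T (\<lambda>a' b'.
      tens A A (?c a a' (iC c)) (?c b b' (iC d)))))"
    using S T c d by (intro lin_on_sweedler2[OF ff, symmetric] lin)
  also have "sweedler B B S (\<lambda>a b. sweedler B B T (\<lambda>a' b'. tens A A (?c a a' (iC c)) (?c b b' (iC d)))) =
    sweedler B B S (\<lambda>a b. sweedler B B T (\<lambda>a' b'.
      SwC (iC c) (\<lambda>c1 c2. SwC (iC d) (?k a b a' b' c1 c2))))"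
    using S T by (intro cong_B conv_tens)
  also have "\<dots> = SwC (iC c) (\<lambda>c1 c2. SwC (iC d) (\<lambda>d1 d2.
      sweedler B B T (\<lambda>a' b'. sweedler B B S (\<lambda>a b. ?k a b a' b' c1 c2 d1 d2))))"
    by (simp only: sweedler_swap[of B B T C C] sweedler_swap[of B B S C C] sweedler_swap[of B B S B B T])
  also have "\<dots> = conv2 (\<lambda>c d. EV2 c d S) (\<lambda>c d. EV2 c d T) (iC c) (iC d)"
    unfolding conv2_def
  proof (intro cong_C lin c d)
    fix c1 c2 d1 d2
    assume m: "c1 \<in> carrier C" "c2 \<in> carrier C" "d1 \<in> carrier C" "d2 \<in> carrier C"
    let ?g = "\<lambda>x y. SwR x (\<lambda>x0 x1. SwR y (\<lambda>y0 y1.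
        sweedler A A (EV2 (act x1 c1) (act y1 d1) S) (\<lambda>p q. tens A A (mA p x0) (mA q y0))))"
    have "sweedler B B T (\<lambda>a' b'. sweedler B B S (\<lambda>a b. ?k a b a' b' c1 c2 d1 d2)) =
      sweedler B B T (\<lambda>a' b'. SwR (ev c2 a') (\<lambda>x0 x1.
        SwR (ev d2 b') (\<lambda>y0 y1. sweedler B B S (\<lambda>a b.
          tens A A (mA (ev (act x1 c1) a) x0) (mA (ev (act y1 d1) b) y0)))))"
      by (simp only: sweedler_swap[of B B S A H])
    also have "\<dots> = sweedler B B T (\<lambda>a' b'. ?g (ev c2 a') (ev d2 b'))"
      using m S T by (intro cong_B cong_A sweedler_EV2[OF V] lin)
    also have "\<dots> = sweedler A A (EV2 c2 d2 T) ?g"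
      using m S T by (intro sweedler_EV2[OF V] lin)
    finally show "sweedler B B T (\<lambda>a' b'. sweedler B B S (\<lambda>a b. ?k a b a' b' c1 c2 d1 d2)) =
      sweedler A A (EV2 c2 d2 T) ?g" .
  qed
  finally show ?thesis .
qed

lemma conv2_cong:
  assumes "\<And>c d. \<lbrakk>c \<in> carrier C; d \<in> carrier C\<rbrakk> \<Longrightarrow> F c d = F' c d"
    and "\<And>c d. \<lbrakk>c \<in> carrier C; d \<in> carrier C\<rbrakk> \<Longrightarrow> G c d = G' c d"
    and "\<And>c d. \<lbrakk>c \<in> carrier C; d \<in> carrier C\<rbrakk> \<Longrightarrow> F' c d \<in> carrier (tensor A A)"
    and "\<And>c d. \<lbrakk>c \<in> carrier C; d \<in> carrier C\<rbrakk> \<Longrightarrow> G' c d \<in> carrier (tensor A A)"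
    and "c \<in> carrier C" "d \<in> carrier C"
  shows "conv2 F G c d = conv2 F' G' c d"
  unfolding conv2_def
  by (intro cong_C sweedler_cong[OF vs(1)] lin_on_mem[OF dC_lin]
      lin_on_mem[OF rho_lin] bilin_on_mem[OF act_bilin] assms refl)

lemma hom_bialgebra_B: "hom_bialgebra B"
proof (intro hom_bialgebra.intro hom_bialgebra_axioms.intro hom_algebra_B hom_coalgebra_B)
  note V = vspace_tensor[of A A]
  show "hom_alg_morphism B (tensor_alg B B) (comul B)"
    unfolding hom_alg_morphism_def
  proof (intro conjI ballI)
    show "lin_on B (tensor_alg B B) (comul B)"
      using comul_B_lin by (simp add: lin_on_def tensor_alg_def)
    fix a assume a: "a \<in> carrier B"
    show "comul B (alpha B a) = alpha (tensor_alg B B) (comul B a)"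
      using hom_coalgebra.comul_alpha[OF hom_coalgebra_B a] by (simp add: tensor_alg_def)
    fix b assume b: "b \<in> carrier B"
    show "comul B (mul B a b) = mul (tensor_alg B B) (comul B a) (comul B b)"
    proof (rule EV2_inj)
      fix c d assume c: "c \<in> carrier C" and d: "d \<in> carrier C"
      have ic: "iC c \<in> carrier C" "iC d \<in> carrier C" using c d lin_on_mem[OF iC_lin] by auto
      have cd: "mC c d \<in> carrier C" using c d by (intro lin)
      let ?a = "\<lambda>x. fA (ev (iC x) a)" and ?b = "\<lambda>x. fA (ev (iC x) b)"
      have "EV2 c d (mul (tensor_alg B B) (comul B a) (comul B b)) = tensor_map A A A A fA fA
        (conv2 (\<lambda>c d. EV2 c d (comul B a)) (\<lambda>c d. EV2 c d (comul B b)) (iC c) (iC d))"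
        using a b by (intro EV2_mul c d lin)
      also have "conv2 (\<lambda>c d. EV2 c d (comul B a)) (\<lambda>c d. EV2 c d (comul B b)) (iC c) (iC d) =
        conv2 (\<lambda>c d. dA (?a (mC c d))) (\<lambda>c d. dA (?b (mC c d))) (iC c) (iC d)"
        using a b by (intro conv2_cong ic) (simp_all add: EV2_def ev_comul | intro lin)+
      also have "\<dots> = dA (conv ?a ?b (mC (iC c) (iC d)))"
        using a b c d by (intro comult_conv[symmetric] lin)
      also have "\<dots> = dA (fA (conv (\<lambda>x. ev x a) (\<lambda>x. ev x b) (iC (mC (iC c) (iC d)))))"
        using a b c d by (subst conv_twist) (intro lin refl; assumption)+
      also have "\<dots> = dA (ev (iC (mC c d)) (mul B a b))"
        using a b c d cd by (simp add: ev_mul mems iC_mult bilin_on_mem[OF mC_bilin])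
      also have "tensor_map A A A A fA fA \<dots> = dA (fA (ev (iC (mC c d)) (mul B a b)))"
        using a b cd by (simp add: fA_dA mems)
      also have "\<dots> = EV2 c d (comul B (mul B a b))"
        using a b c d by (simp add: EV2_def ev_comul mems)
      finally show "EV2 c d (comul B (mul B a b)) =
        EV2 c d (mul (tensor_alg B B) (comul B a) (comul B b))" ..
    qed (intro lin a b)+
  next
    have "comul B (one B) = tens B B (one B) (one B)"
    proof (rule EV2_inj)
      fix c d assume c: "c \<in> carrier C" and d: "d \<in> carrier C"
      have cd: "mC c d \<in> carrier C" using c d by (intro lin)
      have t1: "tens A A (smul A r a) b = smul (tensor A A) r (tens A A a b)"
        if "a \<in> carrier A" "b \<in> carrier A" for r a b
        using lin_on_smul[of A "tensor A A" "\<lambda>a. tens A A a b"] that by (simp add: tens_lin1 lin_on_id)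
      have t2: "tens A A a (smul A r b) = smul (tensor A A) r (tens A A a b)"
        if "a \<in> carrier A" "b \<in> carrier A" for r a b
        using lin_on_smul[of A "tensor A A" "\<lambda>b. tens A A a b"] that by (simp add: tens_lin2 lin_on_id)
      have "EV2 c d (comul B (one B)) = dA (fA (smul A (eC c * eC d) oneA))"
        using c d cd by (simp add: EV2_def ev_comul mems ev_one iC_eC eC_mult)
      also have "\<dots> = smul (tensor A A) (eC c * eC d) (tens A A oneA oneA)"
        by (simp add: lin_on_smul[OF fA_lin] lin_on_smul[OF dA_lin] oneA_mem fA_one dA_one)
      also have "\<dots> = EV2 c d (tens B B (one B) (one B))"
        using c d by (simp add: EV2_tens mems ev_one t1 t2 oneA_mem vspace_smul[OF vs(1)]
            vspace_smul_simps[OF V] mult.commute)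
      finally show "EV2 c d (comul B (one B)) = EV2 c d (tens B B (one B) (one B))" .
    qed (intro lin)+
    then show "comul B (one B) = one (tensor_alg B B)" by (simp add: tensor_alg_def)
  qed
  show "hom_alg_morphism B ground_alg (counit B)"
    unfolding hom_alg_morphism_def
  proof (intro conjI ballI)
    show "lin_on B ground_alg (counit B)"
      using hom_coalgebra.counit_linear[OF hom_coalgebra_B]
      by (simp add: lin_on_def ground_alg_def)
    show "counit B (one B) = one ground_alg"
      by (simp add: ground_alg_def counit_ev mems ev_one oneC_mem eC_one vspace_smul_simps[OF vs(1)] eA_one)
    fix a assume a: "a \<in> carrier B"
    show "counit B (alpha B a) = alpha ground_alg (counit B a)"
      using hom_coalgebra.counit_alpha[OF hom_coalgebra_B a] by (simp add: ground_alg_def)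
    fix b assume b: "b \<in> carrier B"
    show "counit B (mul B a b) = mul ground_alg (counit B a) (counit B b)"
      using a b by (simp add: ground_alg_def counit_ev mems ev_mul oneC_mem iC_one fA_eA conv_ev_mem
          counit_conv ev_lin_C)
  qed
qed

lemma EV2_flip:
  assumes "c \<in> carrier C" "d \<in> carrier C" "t \<in> carrier (tensor B B)"
  shows "EV2 c d (flip B B t) = flip A A (EV2 d c t)"
proof -
  note V = vspace_tensor[of A A]
  have "EV2 c d (flip B B t) = sweedler B B t (\<lambda>x y. tens A A (ev c y) (ev d x))"
    unfolding EV2_def tensor_map_def using assms by (intro sweedler_flip[OF vs_B vs_B V] lin)
  also have "\<dots> = flip A A (EV2 d c t)"
    unfolding flip_def using assms by (intro sweedler_EV2[OF V] lin)
  finally show ?thesis .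
qed

text \<open>The element \<open>R\<close> comes from here: bilinearity recovers \<open>F\<close> from its finitely many values at the \<open>bas i\<close>,
  and these can be lifted to \<open>B \<otimes> B\<close> one by one.\<close>

lemma EV2_surj:
  assumes F: "bilin_on C C (tensor A A) F"
  obtains R where "R \<in> carrier (tensor B B)"
    "\<And>c d. \<lbrakk>c \<in> carrier C; d \<in> carrier C\<rbrakk> \<Longrightarrow> EV2 c d R = F c d"
proof -
  note V = vspace_tensor[of A A] and VB = vspace_tensor[of B B]
  define L where "L i j = tensor_map A A B B (lft i) (lft j)" for i j
  define R where "R = (\<Sum>i\<in>I. \<Sum>j\<in>I. L i j (F (bas i) (bas j)))"
  have L: "lin_on (tensor A A) (tensor B B) (L i j)" if "i \<in> I" "j \<in> I" for i j
    unfolding L_def using that by (intro lin lft_lin)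
  have Fm: "F c d \<in> carrier (tensor A A)" if "c \<in> carrier C" "d \<in> carrier C" for c d
    using bilin_on_mem[OF F that] .
  have Lm: "L i j (F (bas i) (bas j)) \<in> carrier (tensor B B)" if "i \<in> I" "j \<in> I" for i j
    by (intro lin_on_mem[OF L] Fm bas_mem that)
  have R: "R \<in> carrier (tensor B B)"
    unfolding R_def by (intro vspace_sum VB Lm)
  have "EV2 c d R = F c d" if c: "c \<in> carrier C" and d: "d \<in> carrier C" for c d
  proof -
    have l: "lin_on (tensor B B) (tensor A A) (EV2 c d)" using c d by (intro lin)
    have L2: "EV2 c d (L i j t) = smul (tensor A A) (crd i c) (smul (tensor A A) (crd j d) t)"
      if i: "i \<in> I" and j: "j \<in> I" and t: "t \<in> carrier (tensor A A)" for i j t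
    proof (rule lin_on_tensor_eqI[OF vs(1) V _ _ _ t])
      show "lin_on (tensor A A) (tensor A A) (\<lambda>t. EV2 c d (L i j t))"
        by (rule lin_on_comp[OF l L[OF i j]])
      show "lin_on (tensor A A) (tensor A A) (\<lambda>t. smul (tensor A A) (crd i c) (smul (tensor A A) (crd j d) t))"
        by (intro lin)
      fix a b assume a: "a \<in> carrier A" and b: "b \<in> carrier A"
      have "EV2 c d (L i j (tens A A a b)) = tens A A (smul A (crd i c) a) (smul A (crd j d) b)"
        unfolding L_def using a b c d i j
        by (simp add: tensor_map_tens lft_lin EV2_tens lin_on_mem[OF lft_lin] ev_lft)
      also have "\<dots> = smul (tensor A A) (crd i c) (tens A A a (smul A (crd j d) b))"
        using b by (intro lin_on_smul[of A _ "\<lambda>a. tens A A a (smul A (crd j d) b)"] lin a)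
      also have "tens A A a (smul A (crd j d) b) = smul (tensor A A) (crd j d) (tens A A a b)"
        using a by (intro lin_on_smul[of A _ "tens A A a"] lin b)
      finally show "EV2 c d (L i j (tens A A a b)) =
        smul (tensor A A) (crd i c) (smul (tensor A A) (crd j d) (tens A A a b))" .
    qed
    have l1: "lin_on C (tensor A A) (\<lambda>c. F c d)" if "d \<in> carrier C" for d
      using F that by (simp add: bilin_on_def)
    have l2: "lin_on C (tensor A A) (F c)" if "c \<in> carrier C" for c
      using F that by (simp add: bilin_on_def)
    have sm: "smul C r (bas i) \<in> carrier C" if "i \<in> I" for i r
      using that by (intro vspace_smul vs bas_mem)
    have "EV2 c d R = (\<Sum>i\<in>I. \<Sum>j\<in>I. EV2 c d (L i j (F (bas i) (bas j))))"
      unfolding R_def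
      by (subst lin_on_sum[OF VB V l], intro vspace_sum VB Lm, assumption+)
        (intro sum.cong refl lin_on_sum[OF VB V l] Lm)
    also have "\<dots> = (\<Sum>i\<in>I. \<Sum>j\<in>I. F (smul C (crd i c) (bas i)) (smul C (crd j d) (bas j)))"
      by (intro sum.cong refl)
        (simp add: L2 Fm bas_mem lin_on_smul[OF l1] lin_on_smul[OF l2] sm vspace_smul_simps(6)[OF V] mult.commute)
    also have "\<dots> = (\<Sum>i\<in>I. F (smul C (crd i c) (bas i)) (\<Sum>j\<in>I. smul C (crd j d) (bas j)))"
      by (intro sum.cong refl lin_on_sum[OF vs(3) V l2, symmetric] sm)
    also have "\<dots> = F (\<Sum>i\<in>I. smul C (crd i c) (bas i)) (\<Sum>j\<in>I. smul C (crd j d) (bas j))"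
      by (intro lin_on_sum[OF vs(3) V l1, symmetric] sm vspace_sum vs)
    also have "\<dots> = F c d" by (simp only: crd_bas c d)
    finally show ?thesis .
  qed
  with R show ?thesis using that by blast
qed

text \<open>The values of \<open>S\<^sup>1\<^sup>3 T\<^sup>2\<^sup>3\<close>; the structure map in the first two factors is multiplication by the unit.\<close>

lemma EV3_mul_13_23:
  assumes S: "S \<in> carrier (tensor B B)" and T: "T \<in> carrier (tensor B B)"
    and c: "c \<in> carrier C" and d: "d \<in> carrier C" and e: "e \<in> carrier C"
  shows "EV3 c d e (sweedler B B S (\<lambda>r1 r2. sweedler B B T (\<lambda>s1 s2.
      tens3 B B B (alpha B r1) (alpha B s1) (mul B r2 s2)))) =
    SwC (iC e) (\<lambda>e1 e2. sweedler A A (EV2 (iC d) e2 T) (\<lambda>s1 s2. SwR s2 (\<lambda>a0 a1.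
      sweedler A A (EV2 (iC c) (act a1 e1) S) (\<lambda>r1 r2. tens3 A A A (fA r1) (fA s1) (fA (mA r2 a0))))))"
proof -
  note V = vspace_tensor[of A "tensor A A"]
  let ?F = "\<lambda>x y z. tens3 A A A (fA x) (fA y) (fA z)"
  have l: "lin_on (tensor B (tensor B B)) (tensor A (tensor A A)) (EV3 c d e)"
    using c d e by (intro EV3_lin)
  have "EV3 c d e (sweedler B B S (\<lambda>r1 r2. sweedler B B T (\<lambda>s1 s2.
      tens3 B B B (alpha B r1) (alpha B s1) (mul B r2 s2)))) =
    sweedler B B S (\<lambda>r1 r2. sweedler B B T (\<lambda>s1 s2.
      EV3 c d e (tens3 B B B (alpha B r1) (alpha B s1) (mul B r2 s2))))"
    using S T by (intro lin_on_sweedler2[OF l] lin)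
  also have "\<dots> = sweedler B B S (\<lambda>r1 r2. sweedler B B T (\<lambda>s1 s2.
      SwC (iC e) (\<lambda>e1 e2. SwR (ev e2 s2) (\<lambda>a0 a1.
        ?F (ev (iC c) r1) (ev (iC d) s1) (mA (ev (act a1 e1) r2) a0)))))"
  proof (intro cong_B S T)
    fix r1 r2 s1 s2 assume m: "r1 \<in> carrier B" "r2 \<in> carrier B" "s1 \<in> carrier B" "s2 \<in> carrier B"
    have g: "lin_on A (tensor A (tensor A A)) (?F (ev (iC c) r1) (ev (iC d) s1))"
      using m c d by (intro lin)
    have "EV3 c d e (tens3 B B B (alpha B r1) (alpha B s1) (mul B r2 s2)) =
      ?F (ev (iC c) r1) (ev (iC d) s1) (conv (\<lambda>x. ev x r2) (\<lambda>x. ev x s2) (iC e))"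
      using m c d e by (simp add: EV3_tens3 ev_alpha ev_mul mems)
    also have "\<dots> = SwC (iC e) (\<lambda>e1 e2. SwR (ev e2 s2) (\<lambda>a0 a1.
        ?F (ev (iC c) r1) (ev (iC d) s1) (mA (ev (act a1 e1) r2) a0)))"
      unfolding conv_def using m e by (intro lin_on_sweedler2[OF g] lin)
    finally show "EV3 c d e (tens3 B B B (alpha B r1) (alpha B s1) (mul B r2 s2)) = \<dots>" .
  qed
  also have "\<dots> = SwC (iC e) (\<lambda>e1 e2. sweedler B B T (\<lambda>s1 s2.
      SwR (ev e2 s2) (\<lambda>a0 a1. sweedler B B S (\<lambda>r1 r2.
        ?F (ev (iC c) r1) (ev (iC d) s1) (mA (ev (act a1 e1) r2) a0)))))"
    by (simp only: sweedler_swap[of B B T C C] sweedler_swap[of B B S C C] sweedler_swap[of B B S B B T]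
        sweedler_swap[of B B S A H])
  also have "\<dots> = SwC (iC e) (\<lambda>e1 e2. sweedler B B T (\<lambda>s1 s2.
      SwR (ev e2 s2) (\<lambda>a0 a1. sweedler A A (EV2 (iC c) (act a1 e1) S) (\<lambda>r1 r2.
        ?F r1 (ev (iC d) s1) (mA r2 a0)))))"
    using S T c d e by (intro cong_B cong_C
        cong_A sweedler_EV2[OF V] lin)
  also have "\<dots> = SwC (iC e) (\<lambda>e1 e2. sweedler A A (EV2 (iC d) e2 T) (\<lambda>s1 s2.
      SwR s2 (\<lambda>a0 a1. sweedler A A (EV2 (iC c) (act a1 e1) S) (\<lambda>r1 r2.
        ?F r1 s1 (mA r2 a0)))))"
    using S T c d e by (intro cong_C sweedler_EV2[OF V] lin)
  finally show ?thesis .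
qed

lemma EV3_mul_13_12:
  assumes S: "S \<in> carrier (tensor B B)" and T: "T \<in> carrier (tensor B B)"
    and c: "c \<in> carrier C" and d: "d \<in> carrier C" and e: "e \<in> carrier C"
  shows "EV3 c d e (sweedler B B S (\<lambda>r1 r2. sweedler B B T (\<lambda>s1 s2.
      tens3 B B B (mul B r1 s1) (alpha B s2) (alpha B r2)))) =
    SwC (iC c) (\<lambda>c1 c2. sweedler A A (EV2 c2 (iC d) T) (\<lambda>s1 s2. SwR s1 (\<lambda>a0 a1.
      sweedler A A (EV2 (act a1 c1) (iC e) S) (\<lambda>r1 r2. tens3 A A A (fA (mA r1 a0)) (fA s2) (fA r2)))))"
proof -
  note V = vspace_tensor[of A "tensor A A"]
  let ?F = "\<lambda>x y z. tens3 A A A (fA x) (fA y) (fA z)"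
  have l: "lin_on (tensor B (tensor B B)) (tensor A (tensor A A)) (EV3 c d e)"
    using c d e by (intro EV3_lin)
  have "EV3 c d e (sweedler B B S (\<lambda>r1 r2. sweedler B B T (\<lambda>s1 s2.
      tens3 B B B (mul B r1 s1) (alpha B s2) (alpha B r2)))) =
    sweedler B B S (\<lambda>r1 r2. sweedler B B T (\<lambda>s1 s2.
      EV3 c d e (tens3 B B B (mul B r1 s1) (alpha B s2) (alpha B r2))))"
    using S T by (intro lin_on_sweedler2[OF l] lin)
  also have "\<dots> = sweedler B B S (\<lambda>r1 r2. sweedler B B T (\<lambda>s1 s2.
      SwC (iC c) (\<lambda>c1 c2. SwR (ev c2 s1) (\<lambda>a0 a1.
        ?F (mA (ev (act a1 c1) r1) a0) (ev (iC d) s2) (ev (iC e) r2)))))"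
  proof (intro cong_B S T)
    fix r1 r2 s1 s2 assume m: "r1 \<in> carrier B" "r2 \<in> carrier B" "s1 \<in> carrier B" "s2 \<in> carrier B"
    have g: "lin_on A (tensor A (tensor A A)) (\<lambda>x. ?F x (ev (iC d) s2) (ev (iC e) r2))"
      using m d e by (intro lin)
    have "EV3 c d e (tens3 B B B (mul B r1 s1) (alpha B s2) (alpha B r2)) =
      ?F (conv (\<lambda>x. ev x r1) (\<lambda>x. ev x s1) (iC c)) (ev (iC d) s2) (ev (iC e) r2)"
      using m c d e by (simp add: EV3_tens3 ev_alpha ev_mul mems)
    also have "\<dots> = SwC (iC c) (\<lambda>c1 c2. SwR (ev c2 s1) (\<lambda>a0 a1.
        ?F (mA (ev (act a1 c1) r1) a0) (ev (iC d) s2) (ev (iC e) r2)))"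
      unfolding conv_def using m c by (intro lin_on_sweedler2[OF g] lin)
    finally show "EV3 c d e (tens3 B B B (mul B r1 s1) (alpha B s2) (alpha B r2)) = \<dots>" .
  qed
  also have "\<dots> = SwC (iC c) (\<lambda>c1 c2. sweedler B B T (\<lambda>s1 s2.
      SwR (ev c2 s1) (\<lambda>a0 a1. sweedler B B S (\<lambda>r1 r2.
        ?F (mA (ev (act a1 c1) r1) a0) (ev (iC d) s2) (ev (iC e) r2)))))"
    by (simp only: sweedler_swap[of B B T C C] sweedler_swap[of B B S C C] sweedler_swap[of B B S B B T]
        sweedler_swap[of B B S A H])
  also have "\<dots> = SwC (iC c) (\<lambda>c1 c2. sweedler B B T (\<lambda>s1 s2.
      SwR (ev c2 s1) (\<lambda>a0 a1. sweedler A A (EV2 (act a1 c1) (iC e) S) (\<lambda>r1 r2.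
        ?F (mA r1 a0) (ev (iC d) s2) r2))))"
    using S T c d e by (intro cong_B cong_C
        cong_A sweedler_EV2[OF V] lin)
  also have "\<dots> = SwC (iC c) (\<lambda>c1 c2. sweedler A A (EV2 c2 (iC d) T) (\<lambda>s1 s2.
      SwR s1 (\<lambda>a0 a1. sweedler A A (EV2 (act a1 c1) (iC e) S) (\<lambda>r1 r2.
        ?F (mA r1 a0) s2 r2))))"
    using S T c d e by (intro cong_C sweedler_EV2[OF V] lin)
  finally show ?thesis .
qed

end

text \<open>Tensor products see the carrier and the scalars of a structure only, so that the products formed
  over \<open>B\<close>, over its tensor square as an algebra and over the underlying spaces agree.\<close>

lemma vspace_cong:
  assumes "carrier V = carrier V'" "smul V = smul V'" "carrier W = carrier W'" "smul W = smul W'"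
  shows "tens V W = tens V' W'" "tensor V W = tensor V' W'" "sweedler V W = sweedler V' W'"
proof -
  have b: "bilin_on V W ground = bilin_on V' W' ground"
    by (simp add: fun_eq_iff bilin_on_def lin_on_def assms)
  show t: "tens V W = tens V' W'" by (simp add: tens_def fun_eq_iff b)
  show "tensor V W = tensor V' W'" by (simp add: tensor_def t assms)
  show "sweedler V W = sweedler V' W'"
    by (simp add: fun_eq_iff sweedler_def represents_def t assms)
qed

locale braided_smash_evaluation =
  smash_evaluation A H C mA oneA dA eA mH oneH dH eH mC oneC dC eC rho act
    fA iA fH fC iC B ev I bas crd lft +
  ordinary_braided_datum A H C mA oneA dA eA mH oneH dH eH mC oneC dC eC rho act Q
  for A :: "('k::field, 'a::ab_group_add, 'x) vspace_scheme"
    and H :: "('k, 'h::ab_group_add, 'y) vspace_scheme"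
    and C :: "('k, 'c::ab_group_add, 'z) vspace_scheme"
    and mA oneA dA eA mH oneH dH eH mC oneC dC eC rho act fA iA fH fC iC
    and B :: "('k, 'b::ab_group_add) hom_bialg" and ev
    and I :: "'i set" and bas crd lft Q
begin

lemma tensor_alg_B:
  "tens B (tensor_alg B B) = tens B (tensor B B)" "sweedler B (tensor_alg B B) = sweedler B (tensor B B)"
  by (rule vspace_cong; simp add: tensor_alg_def)+

abbreviation mul3 where "mul3 \<equiv> mul (tensor_alg B (tensor_alg B B))"

lemma mul3_eq: "mul3 S T = sweedler B (tensor B B) S (\<lambda>a x. sweedler B (tensor B B) T (\<lambda>a' x'.
    tens B (tensor B B) (mul B a a') (mul (tensor_alg B B) x x')))"
  by (simp add: tensor_alg_def[of B "tensor_alg B B"] tensor_alg_B)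

lemma mul_tensor_alg_lin [lin]:
  "T \<in> carrier (tensor B B) \<Longrightarrow> lin_on X (tensor B B) g \<Longrightarrow>
    lin_on X (tensor B B) (\<lambda>x. mul (tensor_alg B B) (g x) T)"
  "S \<in> carrier (tensor B B) \<Longrightarrow> lin_on X (tensor B B) g \<Longrightarrow>
    lin_on X (tensor B B) (\<lambda>x. mul (tensor_alg B B) S (g x))"
  unfolding mul_tensor_alg by (intro lin; assumption)+

lemma mul3_lin [lin]:
  "T \<in> carrier (tensor B (tensor B B)) \<Longrightarrow> lin_on X (tensor B (tensor B B)) g \<Longrightarrow>
    lin_on X (tensor B (tensor B B)) (\<lambda>x. mul3 (g x) T)"
  "S \<in> carrier (tensor B (tensor B B)) \<Longrightarrow> lin_on X (tensor B (tensor B B)) g \<Longrightarrow>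
    lin_on X (tensor B (tensor B B)) (\<lambda>x. mul3 S (g x))"
  unfolding mul3_eq by (intro lin; assumption)+

lemma mul_tens:
  assumes "a \<in> carrier B" "b \<in> carrier B" "a' \<in> carrier B" "b' \<in> carrier B"
  shows "mul (tensor_alg B B) (tens B B a b) (tens B B a' b') = tens B B (mul B a a') (mul B b b')"
proof -
  note V = vspace_tensor[of B B]
  have "mul (tensor_alg B B) (tens B B a b) (tens B B a' b') =
    sweedler B B (tens B B a' b') (\<lambda>a' b'. tens B B (mul B a a') (mul B b b'))"
    unfolding mul_tensor_alg using assms by (intro sweedler_tens[OF V] lin)
  also have "\<dots> = tens B B (mul B a a') (mul B b b')"
    using assms by (intro sweedler_tens[OF V] lin)
  finally show ?thesis .
qed

lemma mul3_tens3:
  assumes "a \<in> carrier B" "b \<in> carrier B" "c \<in> carrier B"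
    and "a' \<in> carrier B" "b' \<in> carrier B" "c' \<in> carrier B"
  shows "mul3 (tens3 B B B a b c) (tens3 B B B a' b' c') =
    tens3 B B B (mul B a a') (mul B b b') (mul B c c')"
proof -
  note V = vspace_tensor[of B "tensor B B"]
  have "mul3 (tens3 B B B a b c) (tens3 B B B a' b' c') =
    sweedler B (tensor B B) (tens3 B B B a' b' c') (\<lambda>a' x'.
      tens B (tensor B B) (mul B a a') (mul (tensor_alg B B) (tens B B b c) x'))"
    unfolding mul3_eq tens3_def[of B B B a b c] using assms by (intro sweedler_tens[OF V] lin)
  also have "\<dots> = tens B (tensor B B) (mul B a a') (mul (tensor_alg B B) (tens B B b c) (tens B B b' c'))"
    unfolding tens3_def[of B B B a' b' c'] using assms by (intro sweedler_tens[OF V] lin)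
  also have "\<dots> = tens3 B B B (mul B a a') (mul B b b') (mul B c c')"
    using assms by (simp add: mul_tens tens3_def)
  finally show ?thesis .
qed

lemma mul3_sweedler:
  assumes R: "R \<in> carrier (tensor B B)"
    and f: "\<And>x y. x \<in> carrier B \<Longrightarrow> y \<in> carrier B \<Longrightarrow> f x y \<in> carrier (tensor B (tensor B B))"
    and g: "\<And>x y. x \<in> carrier B \<Longrightarrow> y \<in> carrier B \<Longrightarrow> g x y \<in> carrier (tensor B (tensor B B))"
  shows "mul3 (sweedler B B R f) (sweedler B B R g) =
    sweedler B B R (\<lambda>r1 r2. sweedler B B R (\<lambda>s1 s2. mul3 (f r1 r2) (g s1 s2)))"
proof -
  note V = vspace_tensor[of B "tensor B B"]
  have sg: "sweedler B B R g \<in> carrier (tensor B (tensor B B))"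
    using R g by (intro sweedler_mem vs_B V)
  have l: "lin_on (tensor B (tensor B B)) (tensor B (tensor B B)) (\<lambda>S. mul3 S (sweedler B B R g))"
    by (intro mul3_lin sg lin_on_id)
  have l': "lin_on (tensor B (tensor B B)) (tensor B (tensor B B)) (mul3 S)"
    if "S \<in> carrier (tensor B (tensor B B))" for S
    by (intro mul3_lin that lin_on_id)
  have "mul3 (sweedler B B R f) (sweedler B B R g) =
    sweedler B B R (\<lambda>r1 r2. mul3 (f r1 r2) (sweedler B B R g))"
    by (intro lin_on_sweedler[OF l] vs_B V R f)
  also have "\<dots> = sweedler B B R (\<lambda>r1 r2. sweedler B B R (\<lambda>s1 s2. mul3 (f r1 r2) (g s1 s2)))"
    by (intro cong_B lin_on_sweedler[OF l'] vs_B V R f g)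
  finally show ?thesis .
qed

text \<open>The identities for \<open>Rm\<close> hold at \<open>(iC c, iC d)\<close> and \<open>(iC c, iC d, iC e)\<close>; applying \<open>fA\<close> in every tensor factor
  gives the required ones at \<open>(c, d)\<close> and \<open>(c, d, e)\<close>.\<close>

theorem quasitriangular_B: "quasitriangular_hom_bialgebra B"
proof -
  note V = vspace_tensor[of A "tensor A A"]
  interpret HB: hom_bialgebra B by (rule hom_bialgebra_B)
  have "bilin_on C C (tensor A A) Rm" by (intro lin)
  then obtain R where R: "R \<in> carrier (tensor B B)"
    and EV_R: "\<And>c d. \<lbrakk>c \<in> carrier C; d \<in> carrier C\<rbrakk> \<Longrightarrow> EV2 c d R = Rm c d"
    using EV2_surj by blast
  let ?F = "\<lambda>x y z. tens3 A A A (fA x) (fA y) (fA z)"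
  have F: "trilin_on A A A (tensor A (tensor A A)) ?F" by (intro lin)
  have natural: "mul (tensor_alg B B) (flip B B (comul B b)) R = mul (tensor_alg B B) R (comul B b)"
    if b: "b \<in> carrier B" for b
  proof (rule EV2_inj)
    fix c d assume c: "c \<in> carrier C" and d: "d \<in> carrier C"
    have ic: "iC c \<in> carrier C" "iC d \<in> carrier C" using c d lin_on_mem[OF iC_lin] by auto
    let ?b = "\<lambda>x. fA (ev (iC x) b)"
    have EV_b: "EV2 c d (comul B b) = dA (?b (mC c d))" if "c \<in> carrier C" "d \<in> carrier C" for c d
      using b that by (simp add: EV2_def ev_comul)
    have EV_fb: "EV2 c d (flip B B (comul B b)) = flip A A (dA (?b (mC d c)))"
      if "c \<in> carrier C" "d \<in> carrier C" for c d
      using b that by (simp add: EV2_flip EV_b mems)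
    have "EV2 c d (mul (tensor_alg B B) (flip B B (comul B b)) R) = tensor_map A A A A fA fA
        (conv2 (\<lambda>c d. EV2 c d (flip B B (comul B b))) (\<lambda>c d. EV2 c d R) (iC c) (iC d))"
      by (intro EV2_mul lin R b c d)
    also have "conv2 (\<lambda>c d. EV2 c d (flip B B (comul B b))) (\<lambda>c d. EV2 c d R) (iC c) (iC d) =
      conv2 (\<lambda>c d. flip A A (dA (?b (mC d c)))) Rm (iC c) (iC d)"
      by (intro conv2_cong ic EV_fb EV_R lin b; assumption)
    also have "\<dots> = conv2 Rm (\<lambda>c d. dA (?b (mC c d))) (iC c) (iC d)"
      by (intro Rm_natural lin b c d)
    also have "\<dots> = conv2 (\<lambda>c d. EV2 c d R) (\<lambda>c d. EV2 c d (comul B b)) (iC c) (iC d)"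
      by (intro conv2_cong[symmetric] ic EV_b EV_R lin b; assumption)
    also have "tensor_map A A A A fA fA \<dots> = EV2 c d (mul (tensor_alg B B) R (comul B b))"
      by (intro EV2_mul[symmetric] lin R b c d)
    finally show "EV2 c d (mul (tensor_alg B B) (flip B B (comul B b)) R) =
      EV2 c d (mul (tensor_alg B B) R (comul B b))" .
  qed (intro lin R b; assumption)+
  let ?R12 = "sweedler B B R (\<lambda>r1 r2. tens3 B B B r1 r2 (one B))"
  let ?R13 = "sweedler B B R (\<lambda>r1 r2. tens3 B B B r1 (one B) r2)"
  let ?R23 = "sweedler B B R (\<lambda>r1 r2. tens3 B B B (one B) r1 r2)"
  have R1323: "mul3 ?R13 ?R23 = sweedler B B R (\<lambda>r1 r2. sweedler B B R (\<lambda>s1 s2.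
      tens3 B B B (alpha B r1) (alpha B s1) (mul B r2 s2)))"
    by (subst mul3_sweedler) (intro R lin; assumption | intro cong_B R,
      simp add: mul3_tens3 mems HB.one_mul HB.mul_one)+
  have R1312: "mul3 ?R13 ?R12 = sweedler B B R (\<lambda>r1 r2. sweedler B B R (\<lambda>s1 s2.
      tens3 B B B (mul B r1 s1) (alpha B s2) (alpha B r2)))"
    by (subst mul3_sweedler) (intro R lin; assumption | intro cong_B R,
      simp add: mul3_tens3 mems HB.one_mul HB.mul_one)+
  have hexagon1: "sweedler B B R (\<lambda>r1 r2. SwB r1 (\<lambda>r11 r12.
      tens3 B B B r11 r12 (alpha B r2))) = mul3 ?R13 ?R23"
    unfolding R1323
  proof (rule EV3_inj)
    fix c d e assume c: "c \<in> carrier C" and d: "d \<in> carrier C" and e: "e \<in> carrier C"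
    have ic: "iC c \<in> carrier C" "iC d \<in> carrier C" "iC e \<in> carrier C" using c d e lin_on_mem[OF iC_lin] by auto
    have l: "lin_on (tensor B (tensor B B)) (tensor A (tensor A A)) (EV3 c d e)"
      using c d e by (intro EV3_lin)
    let ?g = "\<lambda>u v. SwA (fA u) (\<lambda>x y. tens3 A A A x y (fA v))"
    have "EV3 c d e (sweedler B B R (\<lambda>r1 r2. SwB r1 (\<lambda>r11 r12.
        tens3 B B B r11 r12 (alpha B r2)))) =
      sweedler B B R (\<lambda>r1 r2. SwB r1 (\<lambda>r11 r12.
        EV3 c d e (tens3 B B B r11 r12 (alpha B r2))))"
      by (intro lin_on_sweedler2[OF l] lin R)
    also have "\<dots> = sweedler B B R (\<lambda>r1 r2. SwB r1 (\<lambda>r11 r12.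
        tens3 A A A (ev c r11) (ev d r12) (fA (ev (iC e) r2))))"
      using c d e by (intro cong_B lin R) (simp_all add: EV3_tens3 mems ev_alpha)
    also have "\<dots> = sweedler B B R (\<lambda>r1 r2. ?g (ev (iC (mC c d)) r1) (ev (iC e) r2))"
      by (intro cong_B sweedler_comul[OF V] lin R c d e)
    also have "\<dots> = sweedler A A (Rm (mC (iC c) (iC d)) (iC e)) ?g"
      using EV_R[of "iC (mC c d)" "iC e"] ic c d
      by (subst sweedler_EV2[OF V]) (intro lin R c d e; assumption | simp add: iC_mult bilin_on_mem[OF mC_bilin])+
    also have "\<dots> = sweedler A A (Rm (mC (iC c) (iC d)) (iC e)) (\<lambda>u v. SwA u (\<lambda>x y. ?F x y v))"
    proof (intro cong_A lin c d e)
      fix u v assume u: "u \<in> carrier A" and v: "v \<in> carrier A"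
      show "?g u v = SwA u (\<lambda>x y. ?F x y v)"
        unfolding fA_dA[OF u]
        by (intro sweedler_tensor_map[OF vs(1) vs(1) V fA_lin fA_lin] lin u v)
    qed
    also have "\<dots> = EV3 c d e (sweedler B B R (\<lambda>r1 r2. sweedler B B R (\<lambda>s1 s2.
        tens3 B B B (alpha B r1) (alpha B s1) (mul B r2 s2))))"
      unfolding Rm_hexagon1[OF V F ic] EV3_mul_13_23[OF R R c d e]
      using ic by (intro sweedler_cong[OF vs(3)] sweedler_cong[OF vs(1)] EV_R[symmetric]
          lin_on_mem[OF dC_lin] lin_on_mem[OF rho_lin] bilin_on_mem[OF act_bilin] EV2_mem R refl)
    finally show "EV3 c d e (sweedler B B R (\<lambda>r1 r2. SwB r1 (\<lambda>r11 r12.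
        tens3 B B B r11 r12 (alpha B r2)))) = \<dots>" .
  qed (intro lin R; assumption)+
  have hexagon2: "sweedler B B R (\<lambda>r1 r2. tens B (tensor B B) (alpha B r1) (comul B r2)) = mul3 ?R13 ?R12"
    unfolding R1312
  proof (rule EV3_inj)
    fix c d e assume c: "c \<in> carrier C" and d: "d \<in> carrier C" and e: "e \<in> carrier C"
    have ic: "iC c \<in> carrier C" "iC d \<in> carrier C" "iC e \<in> carrier C" using c d e lin_on_mem[OF iC_lin] by auto
    have l: "lin_on (tensor B (tensor B B)) (tensor A (tensor A A)) (EV3 c d e)"
      using c d e by (intro EV3_lin)
    let ?g = "\<lambda>u v. tens A (tensor A A) (fA u) (dA (fA v))"
    have "EV3 c d e (sweedler B B R (\<lambda>r1 r2. tens B (tensor B B) (alpha B r1) (comul B r2))) =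
      sweedler B B R (\<lambda>r1 r2. EV3 c d e (tens B (tensor B B) (alpha B r1) (comul B r2)))"
      by (intro lin_on_sweedler[OF l] lin R)
    also have "\<dots> = sweedler B B R (\<lambda>r1 r2. ?g (ev (iC c) r1) (ev (iC (mC d e)) r2))"
      using c d e by (intro cong_B R)
        (simp add: EV3_tens2 mems ev_alpha EV2_def ev_comul)
    also have "\<dots> = sweedler A A (Rm (iC c) (mC (iC d) (iC e))) ?g"
      using EV_R[of "iC c" "iC (mC d e)"] ic d e
      by (subst sweedler_EV2[OF V]) (intro lin R c d e; assumption | simp add: iC_mult bilin_on_mem[OF mC_bilin])+
    also have "\<dots> = sweedler A A (Rm (iC c) (mC (iC d) (iC e))) (\<lambda>u v. SwA v (\<lambda>x y. ?F u x y))"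
    proof (intro cong_A lin c d e)
      fix u v assume u: "u \<in> carrier A" and v: "v \<in> carrier A"
      have t: "lin_on (tensor A A) (tensor A (tensor A A)) (tens A (tensor A A) (fA u))"
        by (intro lin u)
      show "?g u v = SwA v (\<lambda>x y. ?F u x y)"
        unfolding fA_dA[OF v] tensor_map_def tens3_def by (intro lin_on_sweedler[OF t] lin u v)
    qed
    also have "\<dots> = EV3 c d e (sweedler B B R (\<lambda>r1 r2. sweedler B B R (\<lambda>s1 s2.
        tens3 B B B (mul B r1 s1) (alpha B s2) (alpha B r2))))"
      unfolding Rm_hexagon2[OF V F ic] EV3_mul_13_12[OF R R c d e]
      using ic by (intro sweedler_cong[OF vs(3)] sweedler_cong[OF vs(1)] EV_R[symmetric]
          lin_on_mem[OF dC_lin] lin_on_mem[OF rho_lin] bilin_on_mem[OF act_bilin] EV2_mem R refl)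
    finally show "EV3 c d e (sweedler B B R (\<lambda>r1 r2. tens B (tensor B B) (alpha B r1) (comul B r2))) = \<dots>" .
  qed (intro lin R; assumption)+
  show ?thesis
    unfolding quasitriangular_hom_bialgebra_def quasitriangular_hom_bialgebra_axioms_def Let_def
    using hom_bialgebra_B R natural hexagon1 hexagon2 by blast
qed

end

section \<open>Untwisting Hom-structures\<close>

text \<open>The untwisted operations.  If \<open>\<alpha>\<close> is bijective, then \<open>1 a = \<alpha>(a)\<close> and \<open>\<alpha>(a) (b c) = (a b) \<alpha>(c)\<close> say that
  \<open>\<alpha>\<inverse>(a b)\<close> is unital and associative, and dually for the coproduct.\<close>

definition ainv :: "('k, 'a, 'z) hom_space_scheme \<Rightarrow> 'a \<Rightarrow> 'a" where
  "ainv V = inv_into (carrier V) (alpha V)"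

definition umul :: "('k, 'a, 'z) hom_alg_scheme \<Rightarrow> 'a \<Rightarrow> 'a \<Rightarrow> 'a" where
  "umul A a b = ainv A (mul A a b)"

definition ucomul :: "('k, 'c, 'z) hom_bialg_scheme \<Rightarrow> 'c \<Rightarrow> ('c, 'c, 'k) tensor" where
  "ucomul C c = comul C (ainv C c)"

lemma alpha_pow_simps:
  "alpha_pow V (-1) x = ainv V x" "alpha_pow V (-2) x = ainv V (ainv V x)"
  "alpha_pow V (-3) x = ainv V (ainv V (ainv V x))"
  "alpha_pow V (-4) x = ainv V (ainv V (ainv V (ainv V x)))"
  "alpha_pow V 2 x = alpha V (alpha V x)"
  by (simp_all add: alpha_pow_def ainv_def eval_nat_numeral)

context hom_space
begin

lemma vspace_V: "vspace V"
  by (rule vspace_axioms)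

lemma alpha_mem: "x \<in> carrier V \<Longrightarrow> alpha V x \<in> carrier V"
  using lin_on_mem[OF alpha_linear] .

lemma ainv_mem: "x \<in> carrier V \<Longrightarrow> ainv V x \<in> carrier V"
  unfolding ainv_def using alpha_bij by (metis bij_betw_imp_surj_on inv_into_into)

lemma alpha_ainv: "x \<in> carrier V \<Longrightarrow> alpha V (ainv V x) = x"
  unfolding ainv_def using alpha_bij by (metis bij_betw_imp_surj_on f_inv_into_f)

lemma ainv_alpha: "x \<in> carrier V \<Longrightarrow> ainv V (alpha V x) = x"
  unfolding ainv_def using alpha_bij by (metis bij_betw_inv_into_left)

lemma ainv_eqI: "x \<in> carrier V \<Longrightarrow> alpha V x = y \<Longrightarrow> ainv V y = x"
  using ainv_alpha by blast

lemma ainv_linear: "lin_on V V (ainv V)"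
  by (rule lin_onI)
    (auto intro!: ainv_mem ainv_eqI vspace_add[OF vspace_V] vspace_smul[OF vspace_V]
      simp: lin_on_add[OF alpha_linear] lin_on_smul[OF alpha_linear] alpha_ainv ainv_mem)

lemmas space_lin = vspace_V alpha_mem ainv_mem lin_on_comp[OF alpha_linear] lin_on_comp[OF ainv_linear]

end

context hom_algebra
begin

lemma mul_mem: "a \<in> carrier A \<Longrightarrow> b \<in> carrier A \<Longrightarrow> mul A a b \<in> carrier A"
  using bilin_on_mem[OF mul_bilinear] .

lemma ainv_mul: "a \<in> carrier A \<Longrightarrow> b \<in> carrier A \<Longrightarrow> ainv A (mul A a b) = mul A (ainv A a) (ainv A b)"
  by (rule ainv_eqI) (simp_all add: mul_mem ainv_mem alpha_mul alpha_ainv)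

lemma ainv_one: "ainv A (one A) = one A"
  by (rule ainv_eqI) (simp_all add: one_carrier alpha_one)

lemmas alg_lin = space_lin mul_mem one_carrier bilin_on_lin1[OF mul_bilinear] bilin_on_lin2[OF mul_bilinear]

lemma umul_bilinear: "bilin_on A A A (umul A)"
  unfolding umul_def by (intro lin alg_lin)

lemma umul_assoc:
  assumes "a \<in> carrier A" "b \<in> carrier A" "c \<in> carrier A"
  shows "umul A a (umul A b c) = umul A (umul A a b) c"
  using hom_assoc[of "ainv A (ainv A a)" "ainv A (ainv A b)" "ainv A (ainv A c)"] assms
  by (simp add: umul_def ainv_mul ainv_mem mul_mem alpha_ainv)

lemma umul_one: "a \<in> carrier A \<Longrightarrow> umul A (one A) a = a" "a \<in> carrier A \<Longrightarrow> umul A a (one A) = a"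
  by (simp_all add: umul_def one_mul mul_one ainv_alpha)

lemma alpha_umul_eq_mul: "a \<in> carrier A \<Longrightarrow> b \<in> carrier A \<Longrightarrow> alpha A (umul A a b) = mul A a b"
  by (simp add: umul_def mul_mem alpha_ainv)

lemma alpha_umul: "a \<in> carrier A \<Longrightarrow> b \<in> carrier A \<Longrightarrow> alpha A (umul A a b) = umul A (alpha A a) (alpha A b)"
  by (simp add: umul_def ainv_mul alpha_mul mul_mem ainv_mem alpha_mem alpha_ainv ainv_alpha)

lemma ainv_umul: "a \<in> carrier A \<Longrightarrow> b \<in> carrier A \<Longrightarrow> ainv A (umul A a b) = umul A (ainv A a) (ainv A b)"
  by (simp add: umul_def ainv_mul mul_mem ainv_mem)

end

context hom_coalgebra
begin

lemma comul_mem: "c \<in> carrier C \<Longrightarrow> comul C c \<in> carrier (tensor C C)"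
  using lin_on_mem[OF comul_linear] .

lemmas coalg_lin = space_lin comul_mem lin_on_comp[OF comul_linear] lin_on_comp[OF counit_linear]

lemma counit_ainv: "c \<in> carrier C \<Longrightarrow> counit C (ainv C c) = counit C c"
  using counit_alpha[of "ainv C c"] by (simp add: ainv_mem alpha_ainv)

lemma sweedler_comul_alpha:
  assumes "vspace U" "bilin_on C C U f" "c \<in> carrier C"
  shows "sweedler C C (comul C (alpha C c)) f = sweedler C C (comul C c) (\<lambda>x y. f (alpha C x) (alpha C y))"
  unfolding comul_alpha[OF assms(3), symmetric]
  by (intro sweedler_tensor_map[OF vspace_V vspace_V assms(1) alpha_linear alpha_linear] comul_mem assms)

lemma tensor_map_ainv_comul:
  assumes "c \<in> carrier C"
  shows "comul C (ainv C c) = tensor_map C C C C (ainv C) (ainv C) (comul C c)"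
proof -
  have c: "c = alpha C (ainv C c)" using assms by (simp add: alpha_ainv)
  have "tensor_map C C C C (ainv C) (ainv C) (comul C c) =
    sweedler C C (comul C (ainv C c)) (\<lambda>x y. tens C C (ainv C (alpha C x)) (ainv C (alpha C y)))"
    by (subst c, unfold tensor_map_def)
      (intro sweedler_comul_alpha[OF vspace_tensor[of C C]] lin coalg_lin assms)
  also have "\<dots> = sweedler C C (comul C (ainv C c)) (tens C C)"
    by (intro sweedler_cong[OF vspace_V refl] comul_mem ainv_mem assms) (simp add: ainv_alpha)
  also have "\<dots> = comul C (ainv C c)"
    by (intro sweedler_tens_self vspace_V comul_mem ainv_mem assms)
  finally show ?thesis ..
qed

lemma sweedler_comul_ainv:
  assumes "vspace U" "bilin_on C C U f" "c \<in> carrier C"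
  shows "sweedler C C (comul C (ainv C c)) f = sweedler C C (comul C c) (\<lambda>x y. f (ainv C x) (ainv C y))"
  unfolding tensor_map_ainv_comul[OF assms(3)]
  by (intro sweedler_tensor_map[OF vspace_V vspace_V assms(1) ainv_linear ainv_linear] comul_mem assms)

lemma ucomul_linear: "lin_on C (tensor C C) (ucomul C)"
  unfolding ucomul_def by (intro lin coalg_lin)

lemma ucomul_alpha: "c \<in> carrier C \<Longrightarrow> ucomul C (alpha C c) = tensor_map C C C C (alpha C) (alpha C) (ucomul C c)"
  by (simp add: ucomul_def comul_alpha ainv_mem ainv_alpha alpha_ainv)

lemma ucomul_ainv: "c \<in> carrier C \<Longrightarrow> ucomul C (ainv C c) = tensor_map C C C C (ainv C) (ainv C) (ucomul C c)"
  by (simp add: ucomul_def tensor_map_ainv_comul ainv_mem)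

lemma ucomul_counit:
  assumes "c \<in> carrier C"
  shows "sweedler C C (ucomul C c) (\<lambda>c1 c2. smul C (counit C c1) c2) = c"
    "sweedler C C (ucomul C c) (\<lambda>c1 c2. smul C (counit C c2) c1) = c"
  using assms by (simp_all add: ucomul_def counit_left counit_right ainv_mem alpha_ainv)

lemma hom_coassoc_test:
  assumes "vspace U" "trilin_on C C C U f" "c \<in> carrier C"
  shows "sweedler C C (comul C c) (\<lambda>c1 c2. sweedler C C (comul C c1) (\<lambda>x y. f x y (alpha C c2))) =
    sweedler C C (comul C c) (\<lambda>c1 c2. sweedler C C (comul C c2) (f (alpha C c1)))" (is "?l = ?r")
proof -
  note l = sweedler3_lin[OF vspace_V vspace_V assms(1,2)]
  have "?l = sweedler3 C C C (sweedler C C (comul C c) (\<lambda>c1 c2. sweedler C C (comul C c1) (\<lambda>x y.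
      tens3 C C C x y (alpha C c2)))) f"
    by (subst lin_on_sweedler2[OF l])
      (intro lin coalg_lin assms sweedler_cong refl sweedler3_tens[OF vspace_V assms(1,2), symmetric]; assumption)+
  also have "\<dots> = ?r"
    unfolding hom_coassoc[OF assms(3)]
    by (subst lin_on_sweedler[OF l])
      (intro lin coalg_lin assms sweedler_cong refl sweedler3_tens2[OF vspace_V assms(1,2)]; assumption)+
  finally show ?thesis .
qed

lemma ucomul_coassoc:
  assumes c: "c \<in> carrier C"
  shows "sweedler C C (ucomul C c) (\<lambda>c1 c2. sweedler C C (ucomul C c1) (\<lambda>x y. tens3 C C C x y c2)) =
    sweedler C C (ucomul C c) (\<lambda>c1 c2. tens C (tensor C C) c1 (ucomul C c2))"
proof -
  note V = vspace_tensor[of C "tensor C C"]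
  let ?f = "\<lambda>x y z. tens3 C C C (ainv C x) (ainv C y) (ainv C z)"
  have "sweedler C C (ucomul C c) (\<lambda>c1 c2. sweedler C C (ucomul C c1) (\<lambda>x y. tens3 C C C x y c2)) =
    sweedler C C (ucomul C c) (\<lambda>c1 c2. sweedler C C (comul C c1) (\<lambda>x y. ?f x y (alpha C c2)))"
    unfolding ucomul_def
  proof (rule sweedler_cong[OF vspace_V refl], intro coalg_lin c)
    fix c1 c2 assume m: "c1 \<in> carrier C" "c2 \<in> carrier C"
    show "sweedler C C (comul C (ainv C c1)) (\<lambda>x y. tens3 C C C x y c2) =
      sweedler C C (comul C c1) (\<lambda>x y. ?f x y (alpha C c2))"
      using m by (simp only: ainv_alpha) (intro sweedler_comul_ainv[OF V] lin)
  qed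
  also have "\<dots> = sweedler C C (ucomul C c) (\<lambda>c1 c2. sweedler C C (comul C c2) (?f (alpha C c1)))"
    unfolding ucomul_def by (intro hom_coassoc_test[OF V] lin coalg_lin c)
  also have "\<dots> = sweedler C C (ucomul C c) (\<lambda>c1 c2. tens C (tensor C C) c1 (ucomul C c2))"
    unfolding ucomul_def
  proof (rule sweedler_cong[OF vspace_V refl], intro coalg_lin c)
    fix c1 c2 assume m: "c1 \<in> carrier C" "c2 \<in> carrier C"
    have l: "lin_on (tensor C C) (tensor C (tensor C C)) (tens C (tensor C C) c1)"
      using m by (intro lin)
    show "sweedler C C (comul C c2) (?f (alpha C c1)) = tens C (tensor C C) c1 (comul C (ainv C c2))"
      using m unfolding tensor_map_ainv_comul[OF m(2)] tensor_map_def tens3_def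
      by (simp only: ainv_alpha) (intro lin_on_sweedler[OF l, symmetric] lin coalg_lin)
  qed
  finally show ?thesis .
qed

end

context hom_bialgebra
begin

lemmas bialg_lin = alg_lin coalg_lin

lemma comul_mult: "a \<in> carrier B \<Longrightarrow> b \<in> carrier B \<Longrightarrow>
    comul B (mul B a b) = sweedler B B (comul B a) (\<lambda>a1 a2. sweedler B B (comul B b) (\<lambda>b1 b2.
      tens B B (mul B a1 b1) (mul B a2 b2)))"
  using comul_morphism by (simp add: hom_alg_morphism_def tensor_alg_def)

lemma counit_mult: "a \<in> carrier B \<Longrightarrow> b \<in> carrier B \<Longrightarrow> counit B (mul B a b) = counit B a * counit B b"
  using counit_morphism by (simp add: hom_alg_morphism_def ground_alg_def)

lemma counit_one: "counit B (one B) = 1"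
  using counit_morphism by (simp add: hom_alg_morphism_def ground_alg_def)

lemma ucomul_one: "ucomul B (one B) = tens B B (one B) (one B)"
  using comul_morphism by (simp add: hom_alg_morphism_def tensor_alg_def ucomul_def ainv_one)

lemma counit_umul: "a \<in> carrier B \<Longrightarrow> b \<in> carrier B \<Longrightarrow> counit B (umul B a b) = counit B a * counit B b"
  by (simp add: umul_def counit_ainv mul_mem counit_mult)

lemma ucomul_umul:
  assumes "a \<in> carrier B" "b \<in> carrier B"
  shows "ucomul B (umul B a b) = sweedler B B (ucomul B a) (\<lambda>a1 a2. sweedler B B (ucomul B b) (\<lambda>b1 b2.
      tens B B (umul B a1 b1) (umul B a2 b2)))"
proof -
  note V = vspace_tensor[of B B]
  have "ucomul B (umul B a b) = comul B (ainv B (mul B (ainv B a) (ainv B b)))"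
    using assms by (simp add: ucomul_def umul_def ainv_mul)
  also have "\<dots> = sweedler B B (comul B (mul B (ainv B a) (ainv B b)))
      (\<lambda>x y. tens B B (ainv B x) (ainv B y))"
    using assms by (subst tensor_map_ainv_comul) (simp_all add: tensor_map_def ainv_mem mul_mem)
  also have "\<dots> = sweedler B B (ucomul B a) (\<lambda>a1 a2. sweedler B B (ucomul B b) (\<lambda>b1 b2.
      tens B B (umul B a1 b1) (umul B a2 b2)))"
    unfolding ucomul_def umul_def comul_mult[OF ainv_mem[OF assms(1)] ainv_mem[OF assms(2)]]
    by (rule sweedler_tens2[OF V]) (intro lin bialg_lin assms; assumption)+
  finally show ?thesis .
qed

end


definition ucoact ::
  "('k, 'a, 'z) hom_space_scheme \<Rightarrow> ('a \<Rightarrow> ('a, 'h, 'k) tensor) \<Rightarrow> 'a \<Rightarrow> ('a, 'h, 'k) tensor" where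
  "ucoact A \<rho> a = \<rho> (ainv A a)"

definition uact :: "('k, 'c, 'z) hom_space_scheme \<Rightarrow> ('h \<Rightarrow> 'c \<Rightarrow> 'c) \<Rightarrow> 'h \<Rightarrow> 'c \<Rightarrow> 'c" where
  "uact C act h c = ainv C (act h c)"

context monoidal_doi_hopf_datum
begin

abbreviation SwA where "SwA a f \<equiv> sweedler A A (comul A a) f"
abbreviation SwH where "SwH h f \<equiv> sweedler H H (comul H h) f"
abbreviation SwC where "SwC c f \<equiv> sweedler C C (comul C c) f"
abbreviation SwR where "SwR a f \<equiv> sweedler A H (\<rho> a) f"
abbreviation SuA where "SuA a f \<equiv> sweedler A A (ucomul A a) f"
abbreviation SuH where "SuH h f \<equiv> sweedler H H (ucomul H h) f"
abbreviation SuC where "SuC c f \<equiv> sweedler C C (ucomul C c) f"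
abbreviation SuR where "SuR a f \<equiv> sweedler A H (ucoact A \<rho> a) f"

lemmas V = A.vspace_V vspace_V C.vspace_V

lemmas cong_A = sweedler_cong[OF V(1) refl] and cong_C = sweedler_cong[OF V(3) refl]

lemma act_mem: "h \<in> carrier H \<Longrightarrow> c \<in> carrier C \<Longrightarrow> act h c \<in> carrier C"
  using bilin_on_mem[OF act_bilinear] .

lemma coact_mem: "a \<in> carrier A \<Longrightarrow> \<rho> a \<in> carrier (tensor A H)"
  using lin_on_mem[OF coact_linear] .

lemmas mem = A.mul_mem A.ainv_mem A.alpha_mem A.one_carrier C.mul_mem C.ainv_mem C.alpha_mem
  C.one_carrier mul_mem ainv_mem alpha_mem one_carrier act_mem

lemmas inv = A.ainv_alpha A.alpha_ainv C.ainv_alpha C.alpha_ainv ainv_alpha alpha_ainv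

lemmas datum_lin = lin A.bialg_lin C.bialg_lin bialg_lin lin_on_comp[OF coact_linear] coact_mem act_mem
  bilin_on_lin1[OF act_bilinear] bilin_on_lin2[OF act_bilinear]

lemma ainv_act: "h \<in> carrier H \<Longrightarrow> c \<in> carrier C \<Longrightarrow> ainv C (act h c) = act (ainv H h) (ainv C c)"
  by (rule C.ainv_eqI) (simp_all add: mem alpha_act inv)

lemma sweedler_coact_alpha:
  assumes "vspace U" "bilin_on A H U f" "a \<in> carrier A"
  shows "SwR (alpha A a) f = SwR a (\<lambda>x y. f (alpha A x) (alpha H y))"
  unfolding coact_alpha[OF assms(3), symmetric]
  by (intro sweedler_tensor_map[OF V(1) V(1) assms(1) A.alpha_linear alpha_linear] coact_mem assms)

lemma coact_ainv:
  assumes "a \<in> carrier A"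
  shows "\<rho> (ainv A a) = tensor_map A H A H (ainv A) (ainv H) (\<rho> a)"
proof -
  have a: "a = alpha A (ainv A a)" using assms by (simp add: inv)
  have "tensor_map A H A H (ainv A) (ainv H) (\<rho> a) =
    SwR (ainv A a) (\<lambda>x y. tens A H (ainv A (alpha A x)) (ainv H (alpha H y)))"
    by (subst a, unfold tensor_map_def)
      (intro sweedler_coact_alpha[OF vspace_tensor[of A H]] datum_lin assms)
  also have "\<dots> = SwR (ainv A a) (tens A H)"
    by (intro cong_A coact_mem A.ainv_mem assms) (simp add: inv)
  also have "\<dots> = \<rho> (ainv A a)"
    by (intro sweedler_tens_self V coact_mem A.ainv_mem assms)
  finally show ?thesis ..
qed

lemma sweedler_coact_ainv:
  assumes "vspace U" "bilin_on A H U f" "a \<in> carrier A"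
  shows "SwR (ainv A a) f = SwR a (\<lambda>x y. f (ainv A x) (ainv H y))"
  unfolding coact_ainv[OF assms(3)]
  by (intro sweedler_tensor_map[OF V(1) V(1) assms(1) A.ainv_linear ainv_linear] coact_mem assms)

lemma ucoact_coassoc:
  assumes a: "a \<in> carrier A"
  shows "SuR a (\<lambda>a0 a1. SuR a0 (\<lambda>x y. tens3 A H H x y a1)) =
    SuR a (\<lambda>a0 a1. tens A (tensor H H) a0 (ucomul H a1))"
proof -
  note VT = vspace_tensor[of A "tensor H H"]
  let ?f = "\<lambda>x y z. tens3 A H H (ainv A x) (ainv H y) (ainv H z)"
  have f: "trilin_on A H H (tensor A (tensor H H)) ?f" by (intro datum_lin)
  note l = sweedler3_lin[OF V(1,2) VT f]
  have "SuR a (\<lambda>a0 a1. SuR a0 (\<lambda>x y. tens3 A H H x y a1)) =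
    SwR (ainv A a) (\<lambda>a0 a1. SwR a0 (\<lambda>x y. ?f x y (alpha H a1)))"
    unfolding ucoact_def
  proof (rule cong_A, intro datum_lin a)
    fix a0 a1 assume m: "a0 \<in> carrier A" "a1 \<in> carrier H"
    show "SwR (ainv A a0) (\<lambda>x y. tens3 A H H x y a1) =
      SwR a0 (\<lambda>x y. ?f x y (alpha H a1))"
      using m by (simp only: inv) (intro sweedler_coact_ainv[OF VT] datum_lin)
  qed
  also have "\<dots> = sweedler3 A H H (SwR (ainv A a) (\<lambda>a0 a1. SwR a0 (\<lambda>x y.
      tens3 A H H x y (alpha H a1)))) ?f"
    by (subst lin_on_sweedler2[OF l])
      (intro datum_lin a sweedler_cong refl sweedler3_tens[OF V(2) VT f, symmetric]; assumption)+
  also have "\<dots> = SwR (ainv A a) (\<lambda>a0 a1. SwH a1 (?f (alpha A a0)))"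
    unfolding coact_coassoc[OF A.ainv_mem[OF a]]
    by (subst lin_on_sweedler[OF l])
      (intro datum_lin a sweedler_cong refl sweedler3_tens2[OF V(2) VT f]; assumption)+
  also have "\<dots> = SuR a (\<lambda>a0 a1. tens A (tensor H H) a0 (ucomul H a1))"
    unfolding ucoact_def ucomul_def
  proof (rule cong_A, intro datum_lin a)
    fix a0 a1 assume m: "a0 \<in> carrier A" "a1 \<in> carrier H"
    have l: "lin_on (tensor H H) (tensor A (tensor H H)) (tens A (tensor H H) a0)"
      using m by (intro lin)
    show "SwH a1 (?f (alpha A a0)) = tens A (tensor H H) a0 (comul H (ainv H a1))"
      using m unfolding tensor_map_ainv_comul[OF m(2)] tensor_map_def tens3_def
      by (simp only: inv) (intro lin_on_sweedler[OF l, symmetric] datum_lin)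
  qed
  finally show ?thesis .
qed

lemma ucoact_umul:
  assumes "a \<in> carrier A" "b \<in> carrier A"
  shows "ucoact A \<rho> (umul A a b) = SuR a (\<lambda>a0 a1. SuR b (\<lambda>b0 b1.
      tens A H (umul A a0 b0) (umul H a1 b1)))"
proof -
  note VT = vspace_tensor[of A H]
  have "ucoact A \<rho> (umul A a b) = \<rho> (ainv A (mul A (ainv A a) (ainv A b)))"
    using assms by (simp add: ucoact_def umul_def A.ainv_mul)
  also have "\<dots> = SwR (mul A (ainv A a) (ainv A b)) (\<lambda>x y. tens A H (ainv A x) (ainv H y))"
    using assms by (subst coact_ainv) (simp_all add: tensor_map_def mem)
  also have "\<rho> (mul A (ainv A a) (ainv A b)) = SwR (ainv A a) (\<lambda>a0 a1.
      SwR (ainv A b) (\<lambda>b0 b1. tens A H (mul A a0 b0) (mul H a1 b1)))"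
    using assms by (simp add: coact_mul mem tensor_alg_def)
  also have "sweedler A H \<dots> (\<lambda>x y. tens A H (ainv A x) (ainv H y)) =
    SuR a (\<lambda>a0 a1. SuR b (\<lambda>b0 b1.
      tens A H (umul A a0 b0) (umul H a1 b1)))"
    unfolding ucoact_def umul_def
    by (rule sweedler_tens2[OF VT]) (intro datum_lin assms; assumption)+
  finally show ?thesis .
qed

lemma ucomul_uact:
  assumes "h \<in> carrier H" "c \<in> carrier C"
  shows "ucomul C (uact C act h c) = SuH h (\<lambda>h1 h2. SuC c (\<lambda>c1 c2.
      tens C C (uact C act h1 c1) (uact C act h2 c2)))"
proof -
  note VT = vspace_tensor[of C C]
  have "ucomul C (uact C act h c) = comul C (ainv C (act (ainv H h) (ainv C c)))"
    using assms by (simp add: ucomul_def uact_def ainv_act)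
  also have "\<dots> = SwC (act (ainv H h) (ainv C c)) (\<lambda>x y. tens C C (ainv C x) (ainv C y))"
    using assms by (subst C.tensor_map_ainv_comul) (simp_all add: tensor_map_def mem)
  also have "\<dots> = SuH h (\<lambda>h1 h2. SuC c (\<lambda>c1 c2.
      tens C C (uact C act h1 c1) (uact C act h2 c2)))"
    unfolding ucomul_def uact_def comul_act[OF ainv_mem[OF assms(1)] C.ainv_mem[OF assms(2)]]
    by (rule sweedler_tens2[OF VT]) (intro datum_lin assms; assumption)+
  finally show ?thesis .
qed

lemma uact_uact:
  assumes "h \<in> carrier H" "g \<in> carrier H" "c \<in> carrier C"
  shows "uact C act h (uact C act g c) = uact C act (umul H h g) c"
  using act_act[of "ainv H (ainv H h)" "ainv H (ainv H g)" "ainv C (ainv C c)"] assms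
  by (simp add: uact_def umul_def ainv_act ainv_mul mem inv)

text \<open>The Hom-condition for \<open>\<alpha>\<inverse>(b)\<close>, \<open>\<alpha>(c)\<close> and \<open>\<alpha>(d)\<close>, with \<open>\<alpha>\<inverse> \<otimes> \<alpha>\<inverse> \<otimes> \<alpha>\<^sup>-\<^sup>3\<close> applied to both sides: the square of
  \<open>\<alpha>\<close> in it is absorbed by equivariance of the action.\<close>

lemma monoidal_untwisted:
  assumes b: "b \<in> carrier A" and c: "c \<in> carrier C" and d: "d \<in> carrier C"
  shows "SuR b (\<lambda>a0 a1. SuA a0 (\<lambda>x y.
      tens3 A A C x y (uact C act a1 (umul C c d)))) =
    SuA b (\<lambda>a1 a2. SuR a1 (\<lambda>x0 x1. SuR a2 (\<lambda>y0 y1.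
      tens3 A A C x0 y0 (umul C (uact C act x1 c) (uact C act y1 d)))))"
proof -
  note VT = vspace_tensor[of A "tensor A C"]
  let ?f = "\<lambda>x y z. tens3 A A C (ainv A x) (ainv A y) (ainv C (ainv C (ainv C z)))"
  have f: "trilin_on A A C (tensor A (tensor A C)) ?f" by (intro datum_lin)
  note l = sweedler3_lin[OF V(1,1) VT f]
  have m': "ainv A b \<in> carrier A" "alpha C c \<in> carrier C" "alpha C d \<in> carrier C"
    using b c d by (simp_all add: mem)
  have "SuR b (\<lambda>a0 a1. SuA a0 (\<lambda>x y.
      tens3 A A C x y (uact C act a1 (umul C c d)))) =
    SwR (ainv A b) (\<lambda>a0 a1. SwA a0 (\<lambda>x y.
      ?f x y (act (alpha H (alpha H a1)) (mul C (alpha C c) (alpha C d)))))"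
    unfolding ucoact_def ucomul_def uact_def umul_def
  proof (rule cong_A, intro datum_lin b)
    fix a0 a1 assume m: "a0 \<in> carrier A" "a1 \<in> carrier H"
    have "ainv C (ainv C (ainv C (act (alpha H (alpha H a1)) (mul C (alpha C c) (alpha C d))))) =
      ainv C (act a1 (ainv C (mul C c d)))"
      using m c d by (simp add: ainv_act C.ainv_mul mem inv)
    then show "SwA (ainv A a0) (\<lambda>x y. tens3 A A C x y (ainv C (act a1 (ainv C (mul C c d))))) =
      SwA a0 (\<lambda>x y. ?f x y (act (alpha H (alpha H a1)) (mul C (alpha C c) (alpha C d))))"
      using m c d by (simp only:) (intro A.sweedler_comul_ainv[OF VT] datum_lin)
  qed
  also have "\<dots> = sweedler3 A A C (SwR (ainv A b) (\<lambda>a0 a1. SwA a0 (\<lambda>x y.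
      tens3 A A C x y (act (alpha H (alpha H a1)) (mul C (alpha C c) (alpha C d)))))) ?f"
    by (subst lin_on_sweedler2[OF l])
      (intro datum_lin b c d sweedler_cong refl sweedler3_tens[OF V(1) VT f, symmetric]; assumption)+
  also have "\<dots> = SwA (ainv A b) (\<lambda>a1 a2. SwR a1 (\<lambda>x0 x1. SwR a2 (\<lambda>y0 y1.
      ?f x0 y0 (mul C (act x1 (alpha C c)) (act y1 (alpha C d))))))"
    unfolding monoidal_mul[OF m', unfolded alpha_pow_simps]
    by (subst lin_on_sweedler3[OF l])
      (intro datum_lin b c d sweedler_cong refl sweedler3_tens[OF V(1) VT f]; assumption)+
  also have "\<dots> = SuA b (\<lambda>a1 a2. SuR a1 (\<lambda>x0 x1. SuR a2 (\<lambda>y0 y1.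
      tens3 A A C x0 y0 (umul C (uact C act x1 c) (uact C act y1 d)))))"
    unfolding ucoact_def ucomul_def uact_def umul_def
  proof (rule cong_A, intro datum_lin b)
    fix a1 a2 assume m: "a1 \<in> carrier A" "a2 \<in> carrier A"
    let ?g = "\<lambda>x0 x1 y0 y1. tens3 A A C x0 y0 (ainv C (mul C (ainv C (act x1 c)) (ainv C (act y1 d))))"
    have "SwR (ainv A a1) (\<lambda>x0 x1. SwR (ainv A a2) (?g x0 x1)) =
      SwR a1 (\<lambda>x0 x1. SwR (ainv A a2) (?g (ainv A x0) (ainv H x1)))"
      using m c d by (intro sweedler_coact_ainv[OF VT] datum_lin)
    also have "\<dots> = SwR a1 (\<lambda>x0 x1. SwR a2 (\<lambda>y0 y1.
        ?g (ainv A x0) (ainv H x1) (ainv A y0) (ainv H y1)))"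
      using m c d by (intro cong_A sweedler_coact_ainv[OF VT] datum_lin)
    also have "\<dots> = SwR a1 (\<lambda>x0 x1. SwR a2 (\<lambda>y0 y1.
      ?f x0 y0 (mul C (act x1 (alpha C c)) (act y1 (alpha C d)))))"
      using m c d by (intro cong_A datum_lin) (simp_all add: ainv_act C.ainv_mul mem inv)
    finally show "SwR a1 (\<lambda>x0 x1. SwR a2 (\<lambda>y0 y1.
        ?f x0 y0 (mul C (act x1 (alpha C c)) (act y1 (alpha C d))))) =
      SwR (ainv A a1) (\<lambda>x0 x1. SwR (ainv A a2) (?g x0 x1))" ..
  qed
  finally show ?thesis .
qed

lemma monoidal_one_untwisted:
  assumes b: "b \<in> carrier A"
  shows "SuR b (\<lambda>a0 a1. smul C (counit A a0) (uact C act a1 (one C))) =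
    smul C (counit A b) (one C)"
proof -
  have "SuR b (\<lambda>a0 a1. smul C (counit A a0) (uact C act a1 (one C))) =
    SwR (ainv A b) (\<lambda>a0 a1. ainv C (smul C (counit A a0) (act a1 (one C))))"
    unfolding ucoact_def uact_def using b
    by (intro cong_A datum_lin) (simp_all add: lin_on_smul[OF C.ainv_linear] mem)
  also have "\<dots> = ainv C (SwR (ainv A b) (\<lambda>a0 a1. smul C (counit A a0) (act a1 (one C))))"
    using b by (intro lin_on_sweedler[OF C.ainv_linear, symmetric] datum_lin)
  also have "\<dots> = smul C (counit A b) (one C)"
    using b by (simp add: monoidal_one[symmetric] mem lin_on_smul[OF C.ainv_linear] A.counit_ainv C.ainv_one)
  finally show ?thesis .
qed

lemma ucoact_linear: "lin_on A (tensor A H) (ucoact A \<rho>)"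
  unfolding ucoact_def by (intro datum_lin)

lemma uact_bilinear: "bilin_on H C C (uact C act)"
  unfolding uact_def by (intro datum_lin)

lemma ucoact_counit: "a \<in> carrier A \<Longrightarrow> SuR a (\<lambda>a0 a1. smul A (counit H a1) a0) = a"
  by (simp add: ucoact_def coact_counit mem inv)

lemma ucoact_one: "ucoact A \<rho> (one A) = tens A H (one A) (one H)"
  by (simp add: ucoact_def A.ainv_one coact_one)

lemma uact_one: "c \<in> carrier C \<Longrightarrow> uact C act (one H) c = c"
  by (simp add: uact_def one_act inv)

lemma counit_uact: "h \<in> carrier H \<Longrightarrow> c \<in> carrier C \<Longrightarrow> counit C (uact C act h c) = counit H h * counit C c"
  by (simp add: uact_def C.counit_ainv mem counit_act)

lemma ucoact_alpha: "a \<in> carrier A \<Longrightarrow>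
    ucoact A \<rho> (alpha A a) = tensor_map A H A H (alpha A) (alpha H) (ucoact A \<rho> a)"
  by (simp add: ucoact_def coact_alpha mem inv)

lemma ainv_uact: "h \<in> carrier H \<Longrightarrow> c \<in> carrier C \<Longrightarrow> ainv C (uact C act (alpha H h) c) = uact C act h (ainv C c)"
  by (simp add: uact_def ainv_act mem inv)

lemma ordinary: "ordinary_datum A H C (umul A) (one A) (ucomul A) (counit A) (umul H) (one H) (ucomul H) (counit H)
    (umul C) (one C) (ucomul C) (counit C) (ucoact A \<rho>) (uact C act)"
  by (intro ordinary_datum.intro V A.umul_bilinear A.one_carrier umul_bilinear one_carrier
      C.umul_bilinear C.one_carrier A.ucomul_linear A.counit_linear ucomul_linear counit_linear
      C.ucomul_linear C.counit_linear ucoact_linear uact_bilinear A.umul_assoc A.umul_one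
      A.ucomul_coassoc A.ucomul_counit A.ucomul_one A.counit_one C.umul_assoc C.umul_one C.counit_umul
      C.counit_one A.ucomul_umul A.counit_umul C.ucomul_coassoc C.ucomul_counit C.ucomul_umul C.ucomul_one
      ucoact_coassoc ucoact_counit ucoact_umul ucoact_one uact_uact uact_one ucomul_uact counit_uact
      monoidal_untwisted monoidal_one_untwisted; assumption)

end

section \<open>The conditions on \<open>Q\<close> without structure maps\<close>

locale braided_hom_datum = monoidal_doi_hopf_datum H S A \<rho> C act
  for H :: "('k::field, 'h::ab_group_add) hom_bialg"
    and S :: "'h \<Rightarrow> 'h"
    and A :: "('k, 'a::ab_group_add) hom_bialg"
    and \<rho> :: "'a \<Rightarrow> ('a, 'h, 'k) tensor"
    and C :: "('k, 'c::ab_group_add) hom_bialg"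
    and act :: "'h \<Rightarrow> 'c \<Rightarrow> 'c" +
  fixes Q :: "('c, 'c, 'k) tensor \<Rightarrow> ('a, 'a, 'k) tensor"
  assumes Q_linear: "lin_on (tensor C C) (tensor A A) Q"
    and Q_alpha: "t \<in> carrier (tensor C C) \<Longrightarrow>
      Q (tensor_map C C C C (alpha C) (alpha C) t) = tensor_map A A A A (alpha A) (alpha A) (Q t)"
    and cond1: "\<lbrakk>a \<in> carrier A; c \<in> carrier C; d \<in> carrier C\<rbrakk> \<Longrightarrow>
          sweedler A A (comul A a) (\<lambda>a1 a2.
            sweedler A H (\<rho> a1) (\<lambda>a10 a11. sweedler A H (\<rho> a2) (\<lambda>a20 a21.
              mul (tensor_alg A A) (Q (tens C C (act a21 d) (act a11 c)))
                (tens A A (alpha A a20) (alpha A a10)))))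
          = mul (tensor_alg A A) (comul A (alpha_pow A 2 a)) (Q (tens C C (alpha C d) (alpha C c)))"
    and cond2: "\<lbrakk>c \<in> carrier C; d \<in> carrier C\<rbrakk> \<Longrightarrow>
          sweedler C C (comul C c) (\<lambda>c1 c2. sweedler C C (comul C d) (\<lambda>d1 d2.
            tens (tensor A A) C (Q (tens C C d1 c1)) (alpha_pow C (-3) (mul C c2 d2))))
          = sweedler C C (comul C c) (\<lambda>c1 c2. sweedler C C (comul C d) (\<lambda>d1 d2.
              sweedler (tensor A A) (tensor H H)
                (coact2 H A \<rho> (Q (tens C C (alpha_pow C (-1) d2) (alpha_pow C (-1) c2))))
                (\<lambda>q0 q1. tens (tensor A A) C q0
                  (alpha_pow C (-4) (mul_map C (act2 H C act q1 (tens C C d1 c1)))))))"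
    and cond3: "\<lbrakk>c \<in> carrier C; d \<in> carrier C; e \<in> carrier C\<rbrakk> \<Longrightarrow>
          sweedler A A
            (Q (tens C C (mul C (alpha_pow C (-2) d) (alpha_pow C (-1) e)) (alpha_pow C (-1) c)))
            (\<lambda>x y. sweedler A A (comul A x) (\<lambda>x1 x2. tens3 A A A x1 x2 (alpha A y)))
          = sweedler C C (comul C c) (\<lambda>c1 c2.
              sweedler A A (Q (tens C C (alpha_pow C (-2) d) (alpha_pow C (-3) c2))) (\<lambda>Q1 Q2.
                sweedler A H (\<rho> Q2) (\<lambda>Q20 Q21.
                  tens A (tensor A A) (alpha_pow A 2 Q1)
                    (mul (tensor_alg A A)
                      (Q (tens C C e (act (alpha_pow H (-1) Q21) (alpha_pow C (-3) c1))))
                      (tens A A (one A) Q20)))))"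
    and cond4: "\<lbrakk>c \<in> carrier C; d \<in> carrier C; e \<in> carrier C\<rbrakk> \<Longrightarrow>
          sweedler A A
            (Q (tens C C (alpha_pow C (-1) e) (mul C (alpha_pow C (-1) c) (alpha_pow C (-2) d))))
            (\<lambda>x y. tens A (tensor A A) (alpha A x) (comul A y))
          = sweedler C C (comul C e) (\<lambda>e1 e2.
              sweedler A A (Q (tens C C (alpha_pow C (-3) e2) (alpha_pow C (-2) d))) (\<lambda>Q1 Q2.
                sweedler A H (\<rho> Q1) (\<lambda>Q10 Q11.
                  sweedler A A
                    (mul (tensor_alg A A)
                      (Q (tens C C (act (alpha_pow H (-1) Q11) (alpha_pow C (-3) e1)) c))
                      (tens A A Q10 (one A)))
                    (\<lambda>x y. tens3 A A A x y (alpha_pow A 2 Q2)))))"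
begin

abbreviation SwQ where "SwQ c d f \<equiv> sweedler A A (Q (tens C C c d)) f"

lemmas Q_lin = datum_lin lin_on_comp[OF Q_linear] lin_on_mem[OF Q_linear]

lemma Q_ainv:
  assumes "c \<in> carrier C" "d \<in> carrier C"
  shows "Q (tens C C (ainv C c) (ainv C d)) = tensor_map A A A A (ainv A) (ainv A) (Q (tens C C c d))"
proof -
  note VT = vspace_tensor[of A A]
  let ?t = "tens C C (ainv C c) (ainv C d)"
  have t: "?t \<in> carrier (tensor C C)" using assms by (intro datum_lin)
  have "tensor_map C C C C (alpha C) (alpha C) ?t = tens C C c d"
    using assms by (simp add: tensor_map_tens[OF C.alpha_linear C.alpha_linear] mem inv)
  then have "Q (tens C C c d) = tensor_map A A A A (alpha A) (alpha A) (Q ?t)"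
    using Q_alpha[OF t] by simp
  then have "tensor_map A A A A (ainv A) (ainv A) (Q (tens C C c d)) =
    sweedler A A (Q ?t) (\<lambda>x y. tens A A (ainv A (alpha A x)) (ainv A (alpha A y)))"
    unfolding tensor_map_def[of A A A A "ainv A"] using assms
    by (simp only:) (intro sweedler_tensor_map[OF V(1) V(1) VT A.alpha_linear A.alpha_linear] Q_lin)
  also have "\<dots> = sweedler A A (Q ?t) (tens A A)"
    by (intro cong_A lin_on_mem[OF Q_linear] t) (simp add: inv)
  also have "\<dots> = Q ?t"
    by (intro sweedler_tens_self V lin_on_mem[OF Q_linear] t)
  finally show ?thesis ..
qed

lemma sweedler_Q_ainv:
  assumes "vspace U" "bilin_on A A U f" "c \<in> carrier C" "d \<in> carrier C"
  shows "SwQ (ainv C c) (ainv C d) f =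
    SwQ c d (\<lambda>x y. f (ainv A x) (ainv A y))"
  unfolding Q_ainv[OF assms(3,4)]
  by (intro sweedler_tensor_map[OF V(1) V(1) assms(1) A.ainv_linear A.ainv_linear] lin_on_mem[OF Q_linear]
      tens_in_tensor assms)

lemma mul_tensor_alg_A:
  "mul (tensor_alg A A) X Y = sweedler A A X (\<lambda>p q. sweedler A A Y (\<lambda>x y. tens A A (mul A p x) (mul A q y)))"
  by (simp add: tensor_alg_def)

lemma mul_tensor_alg_A_mem:
  "X \<in> carrier (tensor A A) \<Longrightarrow> Y \<in> carrier (tensor A A) \<Longrightarrow> mul (tensor_alg A A) X Y \<in> carrier (tensor A A)"
  unfolding mul_tensor_alg_A by (intro datum_lin)

lemma mul_tensor_alg_A_tens:
  assumes "X \<in> carrier (tensor A A)" "x \<in> carrier A" "y \<in> carrier A"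
  shows "mul (tensor_alg A A) X (tens A A x y) = sweedler A A X (\<lambda>p q. tens A A (mul A p x) (mul A q y))"
  unfolding mul_tensor_alg_A using assms
  by (intro cong_A sweedler_tens[OF vspace_tensor[of A A]] datum_lin)

text \<open>The first condition at \<open>\<alpha>\<^sup>-\<^sup>3(b)\<close>, \<open>\<alpha>\<inverse>(c)\<close>, \<open>\<alpha>\<inverse>(d)\<close>, with \<open>\<alpha>\<inverse> \<otimes> \<alpha>\<inverse>\<close> applied to both sides.  The arguments are
  chosen such that \<open>\<Delta>(\<alpha>\<^sup>2(a))\<close> becomes \<open>\<Delta>(\<alpha>\<inverse>(b))\<close>, the untwisted coproduct of \<open>b\<close>.\<close>

lemma Q_natural_A:
  assumes b: "b \<in> carrier A" and c: "c \<in> carrier C" and d: "d \<in> carrier C"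
  shows "SuA b (\<lambda>a1 a2. SuR a1 (\<lambda>x0 x1. SuR a2 (\<lambda>y0 y1.
        SwQ (uact C act y1 d) (uact C act x1 c) (\<lambda>p q.
          tens A A (umul A p y0) (umul A q x0))))) =
      SuA b (\<lambda>a1 a2. SwQ d c (\<lambda>p q.
        tens A A (umul A a1 p) (umul A a2 q)))"
proof -
  note VT = vspace_tensor[of A A]
  let ?L = "tensor_map A A A A (ainv A) (ainv A)"
  have L: "lin_on (tensor A A) (tensor A A) ?L" by (intro datum_lin A.ainv_linear)
  have L_tens: "?L (tens A A (mul A p x) (mul A q y)) = tens A A (umul A p x) (umul A q y)"
    if "p \<in> carrier A" "q \<in> carrier A" "x \<in> carrier A" "y \<in> carrier A" for p q x y
    using that by (simp add: tensor_map_tens A.ainv_linear mem umul_def)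
  let ?a = "ainv A (ainv A (ainv A b))"
  have a: "?a \<in> carrier A" using b by (simp add: mem)
  let ?q = "\<lambda>x0 x1 y0 y1. SwQ (act y1 (ainv C d)) (act x1 (ainv C c)) (\<lambda>p q.
      tens A A (umul A p (alpha A y0)) (umul A q (alpha A x0)))"
  let ?G = "\<lambda>a1 a2. SwR a1 (\<lambda>x0 x1. SwR a2 (?q x0 x1))"
  have um: "umul A x y \<in> carrier A" if "x \<in> carrier A" "y \<in> carrier A" for x y
    using that by (simp add: umul_def mem)
  note ul = bilin_on_lin1[OF A.umul_bilinear] bilin_on_lin2[OF A.umul_bilinear]
  have "SwA ?a ?G = ?L (SwA ?a (\<lambda>a1 a2.
      SwR a1 (\<lambda>a10 a11. SwR a2 (\<lambda>a20 a21.
        mul (tensor_alg A A) (Q (tens C C (act a21 (ainv C d)) (act a11 (ainv C c))))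
          (tens A A (alpha A a20) (alpha A a10))))))"
  proof (subst lin_on_sweedler3[OF L])
    have "?q x0 x1 y0 y1 = ?L (mul (tensor_alg A A) (Q (tens C C (act y1 (ainv C d)) (act x1 (ainv C c))))
          (tens A A (alpha A y0) (alpha A x0)))"
      if m: "x0 \<in> carrier A" "x1 \<in> carrier H" "y0 \<in> carrier A" "y1 \<in> carrier H" for x0 x1 y0 y1
    proof -
      have "?L (mul (tensor_alg A A) (Q (tens C C (act y1 (ainv C d)) (act x1 (ainv C c))))
          (tens A A (alpha A y0) (alpha A x0))) =
        ?L (SwQ (act y1 (ainv C d)) (act x1 (ainv C c)) (\<lambda>p q.
          tens A A (mul A p (alpha A y0)) (mul A q (alpha A x0))))"
        using m c d by (subst mul_tensor_alg_A_tens) (intro Q_lin refl; assumption)+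
      also have "\<dots> = SwQ (act y1 (ainv C d)) (act x1 (ainv C c)) (\<lambda>p q.
          ?L (tens A A (mul A p (alpha A y0)) (mul A q (alpha A x0))))"
        using m c d by (intro lin_on_sweedler[OF L] Q_lin)
      also have "\<dots> = ?q x0 x1 y0 y1"
        using m c d by (intro cong_A Q_lin L_tens)
      finally show ?thesis ..
    qed
    then show "SwA ?a ?G = SwA ?a (\<lambda>a1 a2.
      SwR a1 (\<lambda>a10 a11. SwR a2 (\<lambda>a20 a21.
        ?L (mul (tensor_alg A A) (Q (tens C C (act a21 (ainv C d)) (act a11 (ainv C c))))
          (tens A A (alpha A a20) (alpha A a10))))))"
      by (intro cong_A A.comul_mem a coact_mem)
  qed (intro mul_tensor_alg_A_mem Q_lin a b c d; assumption)+
  also have "\<dots> = ?L (mul (tensor_alg A A) (comul A (ainv A b)) (Q (tens C C d c)))"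
    using cond1[OF a C.ainv_mem[OF c] C.ainv_mem[OF d]] b c d by (simp add: alpha_pow_simps inv mem)
  also have "\<dots> = SuA b (\<lambda>a1 a2. SwQ d c (\<lambda>p q.
        tens A A (umul A a1 p) (umul A a2 q)))"
    unfolding mul_tensor_alg_A ucomul_def
    by (subst lin_on_sweedler2[OF L])
      (intro Q_lin b c d cong_A L_tens; assumption)+
  finally have 1: "SwA ?a ?G = \<dots>" .
  have "SwA ?a ?G =
    SwA (ainv A (ainv A b)) (\<lambda>a1 a2. ?G (ainv A a1) (ainv A a2))"
    using b c d by (intro A.sweedler_comul_ainv[OF VT] Q_lin um ul)
  also have "\<dots> = SwA (ainv A b) (\<lambda>a1 a2. ?G (ainv A (ainv A a1)) (ainv A (ainv A a2)))"
    using b c d by (intro A.sweedler_comul_ainv[OF VT] Q_lin um ul)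
  also have "\<dots> = SuA b (\<lambda>a1 a2. SuR a1 (\<lambda>x0 x1. SuR a2 (\<lambda>y0 y1.
        SwQ (uact C act y1 d) (uact C act x1 c) (\<lambda>p q.
          tens A A (umul A p y0) (umul A q x0)))))"
    unfolding ucoact_def ucomul_def
  proof (rule cong_A, intro datum_lin b)
    fix a1 a2 assume m: "a1 \<in> carrier A" "a2 \<in> carrier A"
    have "?G (ainv A (ainv A a1)) (ainv A (ainv A a2)) =
      SwR (ainv A a1) (\<lambda>x0 x1. SwR (ainv A (ainv A a2)) (?q (ainv A x0) (ainv H x1)))"
      using m c d by (intro sweedler_coact_ainv[OF VT] Q_lin um ul)
    also have "\<dots> = SwR (ainv A a1) (\<lambda>x0 x1. SwR (ainv A a2) (\<lambda>y0 y1.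
        ?q (ainv A x0) (ainv H x1) (ainv A y0) (ainv H y1)))"
      using m c d by (intro cong_A sweedler_coact_ainv[OF VT] Q_lin um ul)
    also have "\<dots> = SwR (ainv A a1) (\<lambda>x0 x1. SwR (ainv A a2) (\<lambda>y0 y1.
        SwQ (uact C act y1 d) (uact C act x1 c) (\<lambda>p q.
          tens A A (umul A p y0) (umul A q x0))))"
      using m c d by (intro cong_A datum_lin) (simp_all add: uact_def ainv_act inv)
    finally show "?G (ainv A (ainv A a1)) (ainv A (ainv A a2)) = \<dots>" .
  qed
  finally show ?thesis using 1 by simp
qed

text \<open>The second condition at \<open>\<alpha>\<inverse>(c)\<close>, \<open>\<alpha>\<inverse>(d)\<close>, with \<open>id \<otimes> \<alpha>\<^sup>2\<close> applied to both sides: \<open>\<alpha>\<^sup>-\<^sup>3(cd)\<close> becomes the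
  untwisted product \<open>\<alpha>\<inverse>(cd)\<close>.\<close>

lemma Q_natural_C:
  assumes c: "c \<in> carrier C" and d: "d \<in> carrier C"
  shows "SuC c (\<lambda>c1 c2. SuC d (\<lambda>d1 d2.
        tens (tensor A A) C (Q (tens C C d1 c1)) (umul C c2 d2))) =
      SuC c (\<lambda>c1 c2. SuC d (\<lambda>d1 d2.
        SwQ d2 c2 (\<lambda>p q. SuR p (\<lambda>p0 p1. SuR q (\<lambda>q0 q1.
          tens (tensor A A) C (tens A A p0 q0) (umul C (uact C act p1 d1) (uact C act q1 c1)))))))"
proof -
  note VA = vspace_tensor[of A A] and VH = vspace_tensor[of H H] and VC = vspace_tensor[of C C]
    and VT = vspace_tensor[of "tensor A A" C] and VAH = vspace_tensor[of "tensor A A" "tensor H H"]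
  let ?L = "tensor_map (tensor A A) C (tensor A A) C (\<lambda>x. x) (\<lambda>x. alpha C (alpha C x))"
  have aa: "lin_on C C (\<lambda>x. alpha C (alpha C x))" by (intro datum_lin)
  have L: "lin_on (tensor (tensor A A) C) (tensor (tensor A A) C) ?L" by (intro datum_lin)
  have L_tens: "?L (tens (tensor A A) C T x) = tens (tensor A A) C T (alpha C (alpha C x))"
    if "T \<in> carrier (tensor A A)" "x \<in> carrier C" for T x
    by (intro tensor_map_tens lin_on_id aa that)
  let ?i4 = "\<lambda>x. ainv C (ainv C (ainv C (ainv C x)))"
  have mm: "mul_map C (act2 H C act (tens H H h g) (tens C C x y)) = mul C (act h x) (act g y)"
    if "h \<in> carrier H" "g \<in> carrier H" "x \<in> carrier C" "y \<in> carrier C" for h g x y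
  proof -
    have "act2 H C act (tens H H h g) (tens C C x y) =
      sweedler C C (tens C C x y) (\<lambda>c c'. tens C C (act h c) (act g c'))"
      unfolding act2_def using that by (intro sweedler_tens[OF VC] datum_lin)
    also have "\<dots> = tens C C (act h x) (act g y)"
      using that by (intro sweedler_tens[OF VC] datum_lin)
    finally show ?thesis
      unfolding mul_map_def using that
      by (simp add: sweedler_tens[OF V(3) C.mul_bilinear] mem)
  qed
  have i: "ainv C c \<in> carrier C" "ainv C d \<in> carrier C" using c d by (simp_all add: mem)
  have "SuC c (\<lambda>c1 c2. SuC d (\<lambda>d1 d2.
        tens (tensor A A) C (Q (tens C C d1 c1)) (umul C c2 d2))) =
    ?L (SwC (ainv C c) (\<lambda>c1 c2. SwC (ainv C d) (\<lambda>d1 d2.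
            tens (tensor A A) C (Q (tens C C d1 c1)) (alpha_pow C (-3) (mul C c2 d2)))))"
    unfolding ucomul_def alpha_pow_simps
  proof (subst lin_on_sweedler2[OF L])
    show "SwC (ainv C c) (\<lambda>c1 c2. SwC (ainv C d) (\<lambda>d1 d2.
        tens (tensor A A) C (Q (tens C C d1 c1)) (umul C c2 d2))) =
      SwC (ainv C c) (\<lambda>c1 c2. SwC (ainv C d) (\<lambda>d1 d2.
        ?L (tens (tensor A A) C (Q (tens C C d1 c1)) (ainv C (ainv C (ainv C (mul C c2 d2)))))))"
      by (intro cong_C C.comul_mem i)
        (simp add: L_tens mem inv umul_def lin_on_mem[OF Q_linear] tens_in_tensor)
  qed (intro Q_lin c d; assumption)+
  also have "\<dots> = ?L (SwC (ainv C c) (\<lambda>c1 c2. SwC (ainv C d) (\<lambda>d1 d2.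
      sweedler (tensor A A) (tensor H H) (coact2 H A \<rho> (Q (tens C C (ainv C d2) (ainv C c2))))
        (\<lambda>q0 q1. tens (tensor A A) C q0 (?i4 (mul_map C (act2 H C act q1 (tens C C d1 c1))))))))"
    by (simp only: cond2[OF i, unfolded alpha_pow_simps] alpha_pow_simps)
  also have "\<dots> = SwC (ainv C c) (\<lambda>c1 c2. SwC (ainv C d) (\<lambda>d1 d2.
      ?L (SwQ (ainv C d2) (ainv C c2) (\<lambda>p q. SwR p (\<lambda>p0 p1.
        SwR q (\<lambda>q0 q1. tens (tensor A A) C (tens A A p0 q0)
          (?i4 (mul C (act p1 d1) (act q1 c1)))))))))"
  proof -
    have *: "sweedler (tensor A A) (tensor H H) (coact2 H A \<rho> T)
        (\<lambda>q0 q1. tens (tensor A A) C q0 (?i4 (mul_map C (act2 H C act q1 (tens C C x y))))) =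
      sweedler A A T (\<lambda>p q. SwR p (\<lambda>p0 p1. SwR q (\<lambda>q0 q1.
        tens (tensor A A) C (tens A A p0 q0) (?i4 (mul C (act p1 x) (act q1 y))))))"
      (is "_ = ?r")
      if T: "T \<in> carrier (tensor A A)" and x: "x \<in> carrier C" and y: "y \<in> carrier C" for T x y
    proof -
      let ?f = "\<lambda>q0 q1. tens (tensor A A) C q0 (?i4 (mul_map C (act2 H C act q1 (tens C C x y))))"
      have act2_lin: "lin_on X C (\<lambda>z. mul_map C (act2 H C act (g z) (tens C C x y)))"
        if "lin_on X (tensor H H) g" for X :: "('k, 'e::ab_group_add, 'f) vspace_scheme" and g
        unfolding mul_map_def act2_def using that x y by (intro datum_lin)
      have act2_mem: "mul_map C (act2 H C act q (tens C C x y)) \<in> carrier C"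
        if "q \<in> carrier (tensor H H)" for q
        unfolding mul_map_def act2_def using that x y by (intro datum_lin)
      have f: "bilin_on (tensor A A) (tensor H H) (tensor (tensor A A) C) ?f"
        by (intro datum_lin act2_lin act2_mem)
      have "sweedler (tensor A A) (tensor H H) (coact2 H A \<rho> T) ?f =
        sweedler A A T (\<lambda>p q. SwR p (\<lambda>p0 p1. SwR q (\<lambda>q0 q1.
        sweedler (tensor A A) (tensor H H) (tens (tensor A A) (tensor H H) (tens A A p0 q0) (tens H H p1 q1)) ?f)))"
        unfolding coact2_def
        by (rule lin_on_sweedler3[OF sweedler_lin_on[OF VA VT f]]) (intro datum_lin T; assumption)+
      also have "\<dots> = sweedler A A T (\<lambda>p q. SwR p (\<lambda>p0 p1. SwR q (\<lambda>q0 q1.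
          ?f (tens A A p0 q0) (tens H H p1 q1))))"
        by (intro cong_A T coact_mem sweedler_tens[OF VT f] tens_in_tensor)
      also have "\<dots> = ?r"
        by (intro cong_A T coact_mem) (simp_all add: mm x y)
      finally show ?thesis .
    qed
    have m4: "?i4 (mul C (act p1 x) (act q1 y)) \<in> carrier C"
      if "p1 \<in> carrier H" "q1 \<in> carrier H" "x \<in> carrier C" "y \<in> carrier C" for p1 q1 x y
      using that by (simp add: mem)
    have "SwC (ainv C c) (\<lambda>c1 c2. SwC (ainv C d) (\<lambda>d1 d2.
      sweedler (tensor A A) (tensor H H) (coact2 H A \<rho> (Q (tens C C (ainv C d2) (ainv C c2))))
        (\<lambda>q0 q1. tens (tensor A A) C q0 (?i4 (mul_map C (act2 H C act q1 (tens C C d1 c1))))))) =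
      SwC (ainv C c) (\<lambda>c1 c2. SwC (ainv C d) (\<lambda>d1 d2.
        SwQ (ainv C d2) (ainv C c2) (\<lambda>p q. SwR p (\<lambda>p0 p1.
        SwR q (\<lambda>q0 q1. tens (tensor A A) C (tens A A p0 q0)
          (?i4 (mul C (act p1 d1) (act q1 c1))))))))"
      by (intro cong_C * Q_lin c d)
    then show ?thesis
      by (simp only:) (rule lin_on_sweedler2[OF L]; intro Q_lin c d; assumption)
  qed
  also have "\<dots> = SuC c (\<lambda>c1 c2. SuC d (\<lambda>d1 d2.
        SwQ d2 c2 (\<lambda>p q. SuR p (\<lambda>p0 p1. SuR q (\<lambda>q0 q1.
          tens (tensor A A) C (tens A A p0 q0) (umul C (uact C act p1 d1) (uact C act q1 c1)))))))"
    unfolding ucomul_def ucoact_def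
  proof (rule cong_C, intro datum_lin c,
      rule cong_C, intro datum_lin d)
    fix c1 c2 d1 d2
    assume m: "c1 \<in> carrier C" "c2 \<in> carrier C" "d1 \<in> carrier C" "d2 \<in> carrier C"
    have "?L (SwQ (ainv C d2) (ainv C c2) (\<lambda>p q. SwR p (\<lambda>p0 p1.
        SwR q (\<lambda>q0 q1. tens (tensor A A) C (tens A A p0 q0)
          (?i4 (mul C (act p1 d1) (act q1 c1))))))) =
      SwQ (ainv C d2) (ainv C c2) (\<lambda>p q. SwR p (\<lambda>p0 p1.
        SwR q (\<lambda>q0 q1. ?L (tens (tensor A A) C (tens A A p0 q0)
          (?i4 (mul C (act p1 d1) (act q1 c1)))))))"
      using m by (intro lin_on_sweedler3[OF L] Q_lin)
    also have "\<dots> = SwQ (ainv C d2) (ainv C c2) (\<lambda>p q. SwR p (\<lambda>p0 p1.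
        SwR q (\<lambda>q0 q1. tens (tensor A A) C (tens A A p0 q0)
          (umul C (uact C act p1 d1) (uact C act q1 c1)))))"
      using m by (intro cong_A Q_lin)
        (simp_all add: L_tens mem inv umul_def uact_def tens_in_tensor C.ainv_mul C.alpha_mul)
    also have "\<dots> = SwQ d2 c2 (\<lambda>p q. SwR (ainv A p) (\<lambda>p0 p1.
        SwR (ainv A q) (\<lambda>q0 q1. tens (tensor A A) C (tens A A p0 q0)
          (umul C (uact C act p1 d1) (uact C act q1 c1)))))"
      unfolding umul_def uact_def using m by (intro sweedler_Q_ainv[OF VT] Q_lin)
    finally show "?L (SwQ (ainv C d2) (ainv C c2) (\<lambda>p q. SwR p (\<lambda>p0 p1.
        SwR q (\<lambda>q0 q1. tens (tensor A A) C (tens A A p0 q0)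
          (?i4 (mul C (act p1 d1) (act q1 c1))))))) = \<dots>" .
  qed
  finally show ?thesis .
qed

text \<open>The third condition at \<open>\<alpha>(c)\<close>, \<open>\<alpha>(d)\<close>, \<open>e\<close>, with \<open>\<alpha>\<inverse>\<close> applied to all three tensor factors.  The coproduct of
  \<open>\<alpha>(c)\<close> is then pulled back in two steps to that of \<open>\<alpha>\<inverse>(c)\<close>, the untwisted coproduct of \<open>c\<close>.\<close>

lemma Q_hexagon1:
  assumes c: "c \<in> carrier C" and d: "d \<in> carrier C" and e: "e \<in> carrier C"
  shows "SwQ (umul C d e) c (\<lambda>x y. SuA x (\<lambda>x1 x2. tens3 A A A x1 x2 y)) =
      SuC c (\<lambda>c1 c2. SwQ d c2 (\<lambda>p q. SuR q (\<lambda>q0 q1.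
        SwQ e (uact C act q1 c1) (\<lambda>x y. tens3 A A A p x (umul A y q0)))))"
proof -
  note VT = vspace_tensor[of A "tensor A A"]
  note ul = bilin_on_lin1[OF A.umul_bilinear] bilin_on_lin2[OF A.umul_bilinear] bilin_on_mem[OF A.umul_bilinear]
  let ?f = "\<lambda>x y z. tens3 A A A (ainv A x) (ainv A y) (ainv A z)"
  have f: "trilin_on A A A (tensor A (tensor A A)) ?f" by (intro datum_lin)
  note l = sweedler3_lin[OF V(1,1) VT f]
  let ?M = "\<lambda>t. sweedler3 A A A t ?f"
  have ac: "alpha C c \<in> carrier C" "alpha C d \<in> carrier C" using c d by (simp_all add: mem)
  have de: "mul C (ainv C d) (ainv C e) = umul C d e"
    using d e by (simp add: umul_def C.ainv_mul)
  have ude: "umul C d e \<in> carrier C" using d e by (simp add: umul_def mem)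
  have "SwQ (umul C d e) c (\<lambda>x y. SuA x (\<lambda>x1 x2. tens3 A A A x1 x2 y)) =
    SwQ (umul C d e) c (\<lambda>x y. SwA x (\<lambda>x1 x2. ?f x1 x2 (alpha A y)))"
    unfolding ucomul_def
  proof (rule cong_A, intro Q_lin c ude)
    fix x y assume m: "x \<in> carrier A" "y \<in> carrier A"
    show "SwA (ainv A x) (\<lambda>x1 x2. tens3 A A A x1 x2 y) =
      SwA x (\<lambda>x1 x2. ?f x1 x2 (alpha A y))"
      using m by (simp only: inv) (intro A.sweedler_comul_ainv[OF VT] datum_lin)
  qed
  also have "\<dots> = ?M (SwQ (umul C d e) c (\<lambda>x y. SwA x (\<lambda>x1 x2.
      tens3 A A A x1 x2 (alpha A y))))"
    by (subst lin_on_sweedler2[OF l])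
      (intro Q_lin c ude cong_A sweedler3_tens[OF V(1) VT f, symmetric]; assumption)+
  also have "\<dots> = ?M (SwC (alpha C c) (\<lambda>c1 c2.
      SwQ (ainv C d) (ainv C (ainv C (ainv C c2))) (\<lambda>Q1 Q2. SwR Q2 (\<lambda>Q20 Q21.
        tens A (tensor A A) (alpha A (alpha A Q1)) (mul (tensor_alg A A)
          (Q (tens C C e (act (ainv H Q21) (ainv C (ainv C (ainv C c1)))))) (tens A A (one A) Q20))))))"
    using cond3[OF ac(1,2) e] c d by (simp add: alpha_pow_simps inv mem de)
  also have "\<dots> = SwC (alpha C c) (\<lambda>c1 c2.
      SwQ (ainv C d) (ainv C (ainv C (ainv C c2))) (\<lambda>Q1 Q2. SwR Q2 (\<lambda>Q20 Q21.
        ?M (tens A (tensor A A) (alpha A (alpha A Q1)) (mul (tensor_alg A A)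
          (Q (tens C C e (act (ainv H Q21) (ainv C (ainv C (ainv C c1)))))) (tens A A (one A) Q20))))))"
    by (rule lin_on_sweedler3[OF l]) (intro mul_tensor_alg_A_mem Q_lin c d e; assumption)+
  also have "\<dots> = SwC (alpha C c) (\<lambda>c1 c2.
      SwQ (ainv C d) (ainv C (ainv C (ainv C c2))) (\<lambda>Q1 Q2. SwR Q2 (\<lambda>Q20 Q21.
        SwQ e (act (ainv H Q21) (ainv C (ainv C (ainv C c1)))) (\<lambda>x y.
          tens3 A A A (alpha A Q1) x (umul A y Q20)))))"
  proof (intro cong_C cong_A Q_lin c d)
    fix c1 c2 Q1 Q2 Q20 Q21
    assume m: "c1 \<in> carrier C" "c2 \<in> carrier C" "Q1 \<in> carrier A" "Q2 \<in> carrier A" "Q20 \<in> carrier A"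
      "Q21 \<in> carrier H"
    let ?q = "Q (tens C C e (act (ainv H Q21) (ainv C (ainv C (ainv C c1)))))"
    have q: "?q \<in> carrier (tensor A A)" using m e by (intro Q_lin)
    have g: "lin_on (tensor A A) (tensor A (tensor A A)) (\<lambda>T. ?M (tens A (tensor A A) (alpha A (alpha A Q1)) T))"
      using m by (intro lin_on_comp[OF l] datum_lin)
    have "?M (tens A (tensor A A) (alpha A (alpha A Q1)) (mul (tensor_alg A A) ?q (tens A A (one A) Q20))) =
      ?M (tens A (tensor A A) (alpha A (alpha A Q1)) (sweedler A A ?q (\<lambda>x y. tens A A (mul A x (one A)) (mul A y Q20))))"
      using m by (simp only: mul_tensor_alg_A_tens[OF q A.one_carrier m(5)])
    also have "\<dots> = sweedler A A ?q (\<lambda>x y. ?M (tens A (tensor A A) (alpha A (alpha A Q1)) (tens A A (mul A x (one A)) (mul A y Q20))))"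
      using m by (intro lin_on_sweedler[OF g] q Q_lin)
    also have "\<dots> = sweedler A A ?q (\<lambda>x y. tens3 A A A (alpha A Q1) x (umul A y Q20))"
    proof (intro cong_A q)
      fix x y assume xy: "x \<in> carrier A" "y \<in> carrier A"
      show "?M (tens A (tensor A A) (alpha A (alpha A Q1)) (tens A A (mul A x (one A)) (mul A y Q20))) =
        tens3 A A A (alpha A Q1) x (umul A y Q20)"
        using sweedler3_tens[OF V(1) VT f, of "alpha A (alpha A Q1)" "mul A x (one A)" "mul A y Q20"] m xy
        by (simp add: tens3_def[symmetric] mem inv A.mul_one umul_def)
    qed
    finally show "?M (tens A (tensor A A) (alpha A (alpha A Q1)) (mul (tensor_alg A A) ?q (tens A A (one A) Q20))) = \<dots>" .
  qed
  also have "\<dots> = SwC c (\<lambda>c1 c2.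
      SwQ (ainv C d) (ainv C (ainv C c2)) (\<lambda>Q1 Q2. SwR Q2 (\<lambda>Q20 Q21.
        SwQ e (act (ainv H Q21) (ainv C (ainv C c1))) (\<lambda>x y.
          tens3 A A A (alpha A Q1) x (umul A y Q20)))))" (is "sweedler C C _ ?K = sweedler C C _ ?K'")
  proof -
    have "SwC (alpha C c) ?K = SwC c (\<lambda>c1 c2. ?K (alpha C c1) (alpha C c2))"
      by (intro C.sweedler_comul_alpha[OF VT] Q_lin ul c d e)
    also have "\<dots> = SwC c ?K'"
      by (intro cong_C Q_lin c) (simp add: inv mem)
    finally show ?thesis .
  qed
  also have "\<dots> = SwC (ainv C c) (\<lambda>c1 c2. ?K' (alpha C c1) (alpha C c2))"
  proof -
    have "SwC (alpha C (ainv C c)) ?K' =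
      SwC (ainv C c) (\<lambda>c1 c2. ?K' (alpha C c1) (alpha C c2))"
      by (intro C.sweedler_comul_alpha[OF VT] Q_lin ul c d e)
    then show ?thesis using c by (simp only: inv)
  qed
  also have "\<dots> = SuC c (\<lambda>c1 c2. SwQ d c2 (\<lambda>p q. SuR q (\<lambda>q0 q1.
        SwQ e (uact C act q1 c1) (\<lambda>x y. tens3 A A A p x (umul A y q0)))))"
    unfolding ucomul_def ucoact_def
  proof (rule cong_C, intro datum_lin c)
    fix c1 c2 assume m: "c1 \<in> carrier C" "c2 \<in> carrier C"
    let ?k = "\<lambda>p q. SwR q (\<lambda>q0 q1. SwQ e (act (ainv H q1) (ainv C c1)) (\<lambda>x y.
          tens3 A A A (alpha A p) x (umul A y q0)))"
    have "?K' (alpha C c1) (alpha C c2) = SwQ (ainv C d) (ainv C c2) ?k"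
      using m by (simp add: inv mem)
    also have "\<dots> = SwQ d c2 (\<lambda>p q. ?k (ainv A p) (ainv A q))"
      using m by (intro sweedler_Q_ainv[OF VT] Q_lin ul d e)
    also have "\<dots> = SwQ d c2 (\<lambda>p q. SwR (ainv A q) (\<lambda>q0 q1.
        SwQ e (uact C act q1 c1) (\<lambda>x y. tens3 A A A p x (umul A y q0))))"
      using m by (intro cong_A Q_lin d e) (simp_all add: inv uact_def ainv_act Q_lin e)
    finally show "?K' (alpha C c1) (alpha C c2) = \<dots>" .
  qed
  finally show ?thesis .
qed

text \<open>The fourth condition at \<open>c\<close>, \<open>\<alpha>(d)\<close>, \<open>\<alpha>(e)\<close>, with \<open>\<alpha>\<inverse>\<close> applied to all three tensor factors.\<close>

lemma Q_hexagon2: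
  assumes c: "c \<in> carrier C" and d: "d \<in> carrier C" and e: "e \<in> carrier C"
  shows "SwQ e (umul C c d) (\<lambda>x y. tens A (tensor A A) x (ucomul A y)) =
      SuC e (\<lambda>e1 e2. SwQ e2 d (\<lambda>p q. SuR p (\<lambda>p0 p1.
        SwQ (uact C act p1 e1) c (\<lambda>x y. tens3 A A A (umul A x p0) y q))))"
proof -
  note VT = vspace_tensor[of A "tensor A A"]
  note ul = bilin_on_lin1[OF A.umul_bilinear] bilin_on_lin2[OF A.umul_bilinear] bilin_on_mem[OF A.umul_bilinear]
  let ?f = "\<lambda>x y z. tens3 A A A (ainv A x) (ainv A y) (ainv A z)"
  have f: "trilin_on A A A (tensor A (tensor A A)) ?f" by (intro datum_lin)
  note l = sweedler3_lin[OF V(1,1) VT f]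
  let ?M = "\<lambda>t. sweedler3 A A A t ?f"
  have ac: "alpha C d \<in> carrier C" "alpha C e \<in> carrier C" using e d by (simp_all add: mem)
  have cd: "mul C (ainv C c) (ainv C d) = umul C c d"
    using d c by (simp add: umul_def C.ainv_mul)
  have ucd: "umul C c d \<in> carrier C" using d c by (simp add: umul_def mem)
  have "SwQ e (umul C c d) (\<lambda>x y. tens A (tensor A A) x (ucomul A y)) =
    SwQ e (umul C c d) (\<lambda>x y. ?M (tens A (tensor A A) (alpha A x) (comul A y)))"
    unfolding ucomul_def
  proof (rule cong_A, intro Q_lin e ucd)
    fix x y assume m: "x \<in> carrier A" "y \<in> carrier A"
    have t: "lin_on (tensor A A) (tensor A (tensor A A)) (tens A (tensor A A) x)"
      using m by (intro datum_lin)
    have "?M (tens A (tensor A A) (alpha A x) (comul A y)) = SwA y (?f (alpha A x))"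
      using m by (intro sweedler3_tens2[OF V(1) VT f] datum_lin)
    also have "\<dots> = SwA y (\<lambda>u v. tens A (tensor A A) x (tens A A (ainv A u) (ainv A v)))"
      using m by (simp add: inv tens3_def)
    also have "\<dots> = tens A (tensor A A) x (comul A (ainv A y))"
      unfolding A.tensor_map_ainv_comul[OF m(2)] tensor_map_def
      using m by (intro lin_on_sweedler[OF t, symmetric] datum_lin)
    finally show "tens A (tensor A A) x (comul A (ainv A y)) = ?M (tens A (tensor A A) (alpha A x) (comul A y))" ..
  qed
  also have "\<dots> = ?M (SwQ e (umul C c d) (\<lambda>x y. tens A (tensor A A) (alpha A x) (comul A y)))"
    by (intro lin_on_sweedler[OF l, symmetric] Q_lin e ucd)
  also have "\<dots> = ?M (SwC (alpha C e) (\<lambda>e1 e2.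
      SwQ (ainv C (ainv C (ainv C e2))) (ainv C d) (\<lambda>Q1 Q2. SwR Q1 (\<lambda>Q10 Q11.
        sweedler A A (mul (tensor_alg A A) (Q (tens C C (act (ainv H Q11) (ainv C (ainv C (ainv C e1)))) c))
          (tens A A Q10 (one A))) (\<lambda>x y. tens3 A A A x y (alpha A (alpha A Q2)))))))"
    using cond4[OF c ac] e d by (simp add: alpha_pow_simps inv mem cd)
  also have "\<dots> = SwC (alpha C e) (\<lambda>e1 e2.
      SwQ (ainv C (ainv C (ainv C e2))) (ainv C d) (\<lambda>Q1 Q2. SwR Q1 (\<lambda>Q10 Q11.
        ?M (sweedler A A (mul (tensor_alg A A) (Q (tens C C (act (ainv H Q11) (ainv C (ainv C (ainv C e1)))) c))
          (tens A A Q10 (one A))) (\<lambda>x y. tens3 A A A x y (alpha A (alpha A Q2)))))))"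
    by (rule lin_on_sweedler3[OF l]) (intro mul_tensor_alg_A_mem Q_lin c d e; assumption)+
  also have "\<dots> = SwC (alpha C e) (\<lambda>e1 e2.
      SwQ (ainv C (ainv C (ainv C e2))) (ainv C d) (\<lambda>Q1 Q2. SwR Q1 (\<lambda>Q10 Q11.
        SwQ (act (ainv H Q11) (ainv C (ainv C (ainv C e1)))) c (\<lambda>x y.
          tens3 A A A (umul A x Q10) y (alpha A Q2)))))"
  proof (intro cong_C cong_A Q_lin e d)
    fix e1 e2 Q1 Q2 Q10 Q11
    assume m: "e1 \<in> carrier C" "e2 \<in> carrier C" "Q1 \<in> carrier A" "Q2 \<in> carrier A" "Q10 \<in> carrier A"
      "Q11 \<in> carrier H"
    let ?q = "Q (tens C C (act (ainv H Q11) (ainv C (ainv C (ainv C e1)))) c)"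
    have q: "?q \<in> carrier (tensor A A)" using m c by (intro Q_lin)
    have g: "bilin_on A A (tensor A (tensor A A)) (\<lambda>x y. tens3 A A A x y (alpha A (alpha A Q2)))"
      using m by (intro datum_lin)
    note g' = lin_on_comp[OF l sweedler_lin_on[OF V(1) VT g]]
    have "?M (sweedler A A (mul (tensor_alg A A) ?q (tens A A Q10 (one A))) (\<lambda>x y. tens3 A A A x y (alpha A (alpha A Q2)))) =
      ?M (sweedler A A (sweedler A A ?q (\<lambda>x y. tens A A (mul A x Q10) (mul A y (one A)))) (\<lambda>x y. tens3 A A A x y (alpha A (alpha A Q2))))"
      using m by (simp only: mul_tensor_alg_A_tens[OF q m(5) A.one_carrier])
    also have "\<dots> = sweedler A A ?q (\<lambda>x y. ?M (sweedler A A (tens A A (mul A x Q10) (mul A y (one A)))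
        (\<lambda>x y. tens3 A A A x y (alpha A (alpha A Q2)))))"
      using m by (intro lin_on_sweedler[OF g'] q Q_lin)
    also have "\<dots> = sweedler A A ?q (\<lambda>x y. tens3 A A A (umul A x Q10) y (alpha A Q2))"
    proof (intro cong_A q)
      fix x y assume xy: "x \<in> carrier A" "y \<in> carrier A"
      show "?M (sweedler A A (tens A A (mul A x Q10) (mul A y (one A))) (\<lambda>x y. tens3 A A A x y (alpha A (alpha A Q2)))) =
        tens3 A A A (umul A x Q10) y (alpha A Q2)"
        using sweedler3_tens[OF V(1) VT f, of "mul A x Q10" "mul A y (one A)" "alpha A (alpha A Q2)"] m xy
        by (simp add: sweedler_tens[OF VT g] mem inv A.mul_one umul_def)
    qed
    finally show "?M (sweedler A A (mul (tensor_alg A A) ?q (tens A A Q10 (one A))) (\<lambda>x y. tens3 A A A x y (alpha A (alpha A Q2)))) = \<dots>" .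
  qed
  also have "\<dots> = SwC e (\<lambda>e1 e2.
      SwQ (ainv C (ainv C e2)) (ainv C d) (\<lambda>Q1 Q2. SwR Q1 (\<lambda>Q10 Q11.
        SwQ (act (ainv H Q11) (ainv C (ainv C e1))) c (\<lambda>x y.
          tens3 A A A (umul A x Q10) y (alpha A Q2)))))" (is "sweedler C C _ ?K = sweedler C C _ ?K'")
  proof -
    have "SwC (alpha C e) ?K = SwC e (\<lambda>e1 e2. ?K (alpha C e1) (alpha C e2))"
      by (intro C.sweedler_comul_alpha[OF VT] Q_lin ul c d e)
    also have "\<dots> = SwC e ?K'"
      by (intro cong_C Q_lin e) (simp add: inv mem)
    finally show ?thesis .
  qed
  also have "\<dots> = SwC (ainv C e) (\<lambda>e1 e2. ?K' (alpha C e1) (alpha C e2))"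
  proof -
    have "SwC (alpha C (ainv C e)) ?K' =
      SwC (ainv C e) (\<lambda>e1 e2. ?K' (alpha C e1) (alpha C e2))"
      by (intro C.sweedler_comul_alpha[OF VT] Q_lin ul c d e)
    then show ?thesis using e by (simp only: inv)
  qed
  also have "\<dots> = SuC e (\<lambda>e1 e2. SwQ e2 d (\<lambda>p q. SuR p (\<lambda>p0 p1.
        SwQ (uact C act p1 e1) c (\<lambda>x y. tens3 A A A (umul A x p0) y q))))"
    unfolding ucomul_def ucoact_def
  proof (rule cong_C, intro datum_lin e)
    fix e1 e2 assume m: "e1 \<in> carrier C" "e2 \<in> carrier C"
    let ?k = "\<lambda>p q. SwR p (\<lambda>p0 p1. SwQ (act (ainv H p1) (ainv C e1)) c (\<lambda>x y.
          tens3 A A A (umul A x p0) y (alpha A q)))"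
    have "?K' (alpha C e1) (alpha C e2) = SwQ (ainv C e2) (ainv C d) ?k"
      using m by (simp add: inv mem)
    also have "\<dots> = SwQ e2 d (\<lambda>p q. ?k (ainv A p) (ainv A q))"
      using m by (intro sweedler_Q_ainv[OF VT] Q_lin ul d c)
    also have "\<dots> = SwQ e2 d (\<lambda>p q. SwR (ainv A p) (\<lambda>p0 p1.
        SwQ (uact C act p1 e1) c (\<lambda>x y. tens3 A A A (umul A x p0) y q)))"
      using m by (intro cong_A Q_lin d c) (simp_all add: inv uact_def ainv_act Q_lin c)
    finally show "?K' (alpha C e1) (alpha C e2) = \<dots>" .
  qed
  finally show ?thesis .
qed

lemma ordinary_braided: "ordinary_braided_datum A H C (umul A) (one A) (ucomul A) (counit A) (umul H) (one H) (ucomul H)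
    (counit H) (umul C) (one C) (ucomul C) (counit C) (ucoact A \<rho>) (uact C act) Q"
  by (intro ordinary_braided_datum.intro ordinary_braided_datum_axioms.intro ordinary Q_linear Q_natural_A
      Q_natural_C Q_hexagon1 Q_hexagon2; assumption)

end

section \<open>The dual of \<open>C\<close> and evaluation on the smash product\<close>

locale coordinatized_datum = monoidal_doi_hopf_datum H S A \<rho> C act
  for H :: "('k::field, 'h::ab_group_add) hom_bialg"
    and S :: "'h \<Rightarrow> 'h"
    and A :: "('k, 'a::ab_group_add) hom_bialg"
    and \<rho> :: "'a \<Rightarrow> ('a, 'h, 'k) tensor"
    and C :: "('k, 'c::ab_group_add) hom_bialg"
    and act :: "'h \<Rightarrow> 'c \<Rightarrow> 'c" +
  fixes I :: "'c set" and crd :: "'c \<Rightarrow> 'c \<Rightarrow> 'k"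
  assumes fin_I: "finite I" and I_mem: "i \<in> I \<Longrightarrow> i \<in> carrier C"
    and crd_lin: "i \<in> I \<Longrightarrow> lin_on C ground (crd i)"
    and crd_sum: "c \<in> carrier C \<Longrightarrow> (\<Sum>i\<in>I. smul C (crd i c) i) = c"
begin

abbreviation D where "D \<equiv> dual_bialg C"

lemma D_simps: "smul D = fun_smul"
  "alpha D f = on_carrier C (\<lambda>c. f (ainv C c))"
  "mul D f g = on_carrier C (\<lambda>c. SwC c (\<lambda>c1 c2. f (ainv C (ainv C c1)) * g (ainv C (ainv C c2))))"
  "one D = on_carrier C (counit C)"
  by (simp_all add: dual_bialg_def dual_space_def alpha_pow_simps)

lemma D_mem_iff: "f \<in> carrier D \<longleftrightarrow> lin_on C ground f \<and> (\<forall>c. c \<notin> carrier C \<longrightarrow> f c = 0)"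
  by (auto simp: dual_bialg_def dual_space_def on_carrier_def fun_eq_iff)

lemma on_carrier_eq: "c \<in> carrier C \<Longrightarrow> on_carrier C f c = f c"
  by (simp add: on_carrier_def)

lemma on_carrier_mem: "lin_on C ground f \<Longrightarrow> on_carrier C f \<in> carrier D"
  unfolding D_mem_iff using lin_on_cong[OF V(3) on_carrier_eq] by (simp add: on_carrier_def fun_eq_iff)

lemma D_lin: "f \<in> carrier D \<Longrightarrow> lin_on C ground f"
  by (simp add: D_mem_iff)

lemma D_eqI:
  assumes "f \<in> carrier D" "g \<in> carrier D" "\<And>c. c \<in> carrier C \<Longrightarrow> f c = g c"
  shows "f = g"
proof (rule ext)
  fix c show "f c = g c" using assms by (cases "c \<in> carrier C") (auto simp: D_mem_iff)
qed

lemma VD: "vspace D"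
proof -
  interpret F: vector_space "fun_smul :: 'k \<Rightarrow> ('c \<Rightarrow> 'k) \<Rightarrow> _" by (rule vspace_fun)
  have "F.subspace (carrier D)"
    unfolding F.subspace_def
    by (auto simp: D_mem_iff lin_on_def fun_smul_def fun_eq_iff algebra_simps)
  then show ?thesis
    unfolding vspace_def vspace_axioms_def D_simps by (simp add: F.vector_space_axioms)
qed

lemma eval_lin: "c \<in> carrier C \<Longrightarrow> lin_on D ground (\<lambda>f. f c)"
  by (rule lin_onI) (simp_all add: D_simps fun_smul_def)

lemma lin_on_DI:
  assumes "\<And>x. x \<in> carrier X \<Longrightarrow> lin_on C ground (F x)" and "vspace X"
    and "\<And>c. c \<in> carrier C \<Longrightarrow> lin_on X ground (\<lambda>x. F x c)"
  shows "lin_on X D (\<lambda>x. on_carrier C (F x))"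
proof (rule lin_onI)
  fix x y r assume x: "x \<in> carrier X" and y: "y \<in> carrier X"
  show "on_carrier C (F x) \<in> carrier D" using assms(1) x by (intro on_carrier_mem)
  show "on_carrier C (F (x + y)) = on_carrier C (F x) + on_carrier C (F y)"
    using assms(3) x y by (auto simp: on_carrier_def fun_eq_iff lin_on_def)
  show "on_carrier C (F (smul X r x)) = smul D r (on_carrier C (F x))"
    using assms(3) x by (auto simp: on_carrier_def fun_eq_iff lin_on_def D_simps fun_smul_def)
qed

lemma hom_space_D: "hom_space D"
proof (intro hom_space.intro hom_space_axioms.intro VD)
  have l: "lin_on C ground (\<lambda>c. f (ainv C c))" "lin_on C ground (\<lambda>c. f (alpha C c))" if "f \<in> carrier D" for f
    using lin_on_comp[OF D_lin[OF that] C.ainv_linear] lin_on_comp[OF D_lin[OF that] C.alpha_linear] .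
  show lin: "lin_on D D (alpha D)"
    unfolding D_simps by (intro lin_on_DI l VD eval_lin C.ainv_mem)
  show "bij_betw (alpha D) (carrier D) (carrier D)"
  proof (intro bij_betw_imageI inj_onI equalityI subsetI)
    fix f g assume f: "f \<in> carrier D" and g: "g \<in> carrier D" and eq: "alpha D f = alpha D g"
    show "f = g"
    proof (rule D_eqI[OF f g])
      fix c assume c: "c \<in> carrier C"
      have "alpha D f (alpha C c) = alpha D g (alpha C c)" by (simp only: eq)
      then show "f c = g c" using c by (simp add: D_simps on_carrier_eq mem inv)
    qed
  next
    fix f assume "f \<in> alpha D ` carrier D"
    then show "f \<in> carrier D" using lin_on_mem[OF lin] by auto
  next
    fix f assume f: "f \<in> carrier D"
    have g: "on_carrier C (\<lambda>c. f (alpha C c)) \<in> carrier D" using l f by (intro on_carrier_mem)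
    have eq: "alpha D (on_carrier C (\<lambda>c. f (alpha C c))) = f"
      by (rule D_eqI[OF lin_on_mem[OF lin g] f]) (simp add: D_simps on_carrier_eq mem inv)
    from imageI[OF g, of "alpha D"] show "f \<in> alpha D ` carrier D" by (simp only: eq)
  qed
qed

sublocale D: hom_space "dual_bialg C" by (rule hom_space_D)

lemma ainv_D:
  assumes "f \<in> carrier D"
  shows "ainv D f = on_carrier C (\<lambda>c. f (alpha C c))"
proof (rule D.ainv_eqI)
  show g: "on_carrier C (\<lambda>c. f (alpha C c)) \<in> carrier D"
    using lin_on_comp[OF D_lin[OF assms] C.alpha_linear] by (rule on_carrier_mem)
  show "alpha D (on_carrier C (\<lambda>c. f (alpha C c))) = f"
    by (rule D_eqI[OF lin_on_mem[OF D.alpha_linear g] assms]) (simp add: D_simps on_carrier_eq mem inv)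
qed

lemma one_D_mem: "one D \<in> carrier D"
  unfolding D_simps by (intro on_carrier_mem C.counit_linear)

lemma mul_D_bilinear: "bilin_on D D D (mul D)"
proof -
  have l: "lin_on C ground (\<lambda>c. f (ainv C (ainv C c)))" if "f \<in> carrier D" for f
    by (intro lin_on_comp[OF D_lin[OF that]] datum_lin)
  have m: "lin_on C ground (\<lambda>c. SwC c (\<lambda>c1 c2. f (ainv C (ainv C c1)) * g (ainv C (ainv C c2))))"
    if "f \<in> carrier D" "g \<in> carrier D" for f g
    using l[OF that(1)] l[OF that(2)] by (intro datum_lin)
  have e1: "lin_on D ground (\<lambda>f. SwC c (\<lambda>c1 c2. f (ainv C (ainv C c1)) * g (ainv C (ainv C c2))))"
    if "c \<in> carrier C" for c g
    using that by (intro datum_lin eval_lin)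
  have e2: "lin_on D ground (\<lambda>f. SwC c (\<lambda>c1 c2. g (ainv C (ainv C c1)) * f (ainv C (ainv C c2))))"
    if "c \<in> carrier C" for c g
    using that by (intro datum_lin eval_lin)
  show ?thesis
    unfolding D_simps by (intro bilin_onI lin_on_DI m VD e1 e2)
qed

definition dual_basis :: "'c \<Rightarrow> 'c \<Rightarrow> 'k" where "dual_basis i = on_carrier C (crd i)"

lemma dual_basis_mem: "i \<in> I \<Longrightarrow> dual_basis i \<in> carrier D"
  unfolding dual_basis_def by (intro on_carrier_mem crd_lin)

lemma reconstruction_D: "reconstruction D ground I (\<lambda>i f. f i) (\<lambda>i r. smul D r (dual_basis i))"
  unfolding reconstruction_def
proof (intro conjI ballI fin_I eval_lin I_mem)
  fix i assume i: "i \<in> I"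
  show "lin_on ground D (\<lambda>r. smul D r (dual_basis i))"
    by (intro lin_on_rsmul[OF VD lin_on_id] dual_basis_mem i)
next
  fix f assume f: "f \<in> carrier D"
  show "(\<Sum>i\<in>I. smul D (f i) (dual_basis i)) = f"
  proof (rule D_eqI[OF _ f])
    show "(\<Sum>i\<in>I. smul D (f i) (dual_basis i)) \<in> carrier D"
      by (intro vspace_sum[OF VD] vspace_smul[OF VD] dual_basis_mem)
    fix c assume c: "c \<in> carrier C"
    have "(\<Sum>i\<in>I. smul D (f i) (dual_basis i)) c = (\<Sum>i\<in>I. smul D (f i) (dual_basis i) c)"
      by (intro lin_on_sum[OF VD vspace_ground eval_lin[OF c]] vspace_smul[OF VD] dual_basis_mem)
    also have "\<dots> = (\<Sum>i\<in>I. f (smul C (crd i c) i))"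
      using c by (intro sum.cong refl)
        (simp add: lin_on_smul[OF D_lin[OF f]] I_mem D_simps fun_smul_def dual_basis_def on_carrier_eq mult.commute)
    also have "\<dots> = f (\<Sum>i\<in>I. smul C (crd i c) i)"
      by (intro lin_on_sum[OF V(3) vspace_ground D_lin[OF f], symmetric] vspace_smul V I_mem)
    finally show "(\<Sum>i\<in>I. smul D (f i) (dual_basis i)) c = f c" by (simp add: crd_sum c)
  qed
qed

lemma pairing_lin:
  "c \<in> carrier C \<Longrightarrow> d \<in> carrier C \<Longrightarrow> lin_on (tensor D D) ground (\<lambda>t. sweedler D D t (\<lambda>f g. f c * g d))"
  by (intro lin VD eval_lin)

text \<open>The pairings with \<open>C \<times> C\<close> separate \<open>C\<^sup>* \<otimes> C\<^sup>*\<close>, which gives the uniqueness in the definition of the coproduct of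
  \<open>C\<^sup>*\<close>; existence comes from the dual basis.\<close>

lemma pairing_inj:
  assumes t: "t \<in> carrier (tensor D D)" and t': "t' \<in> carrier (tensor D D)"
    and eq: "\<And>c d. \<lbrakk>c \<in> carrier C; d \<in> carrier C\<rbrakk> \<Longrightarrow>
      sweedler D D t (\<lambda>f g. f c * g d) = sweedler D D t' (\<lambda>f g. f c * g d)"
  shows "t = t'"
proof (rule reconstruction_inj[OF reconstruction_tensor[OF VD VD vspace_ground vspace_ground
        reconstruction_D reconstruction_D] t t'])
  \<comment> \<open>Tensors of scalars are multiples of \<open>1 \<otimes> 1\<close>, so the pairing determines them.\<close>
  let ?G = "tensor ground ground :: ('k, ('k, 'k, 'k) tensor) vspace"
  have *: "tensor_map D D ground ground (\<lambda>f. f i) (\<lambda>f. f j) s =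
      smul ?G (sweedler D D s (\<lambda>f g. f i * g j)) (tens ground ground 1 1)"
    if s: "s \<in> carrier (tensor D D)" and i: "i \<in> I" and j: "j \<in> I" for s i j
  proof -
    have l: "lin_on ground ?G (\<lambda>r. smul ?G r (tens ground ground 1 1))"
      by (intro lin) simp_all
    have "smul ?G (sweedler D D s (\<lambda>f g. f i * g j)) (tens ground ground 1 1) =
      sweedler D D s (\<lambda>f g. smul ?G (f i * g j) (tens ground ground 1 1))"
      using s by (intro lin_on_sweedler[OF l] VD lin) simp_all
    also have "\<dots> = tensor_map D D ground ground (\<lambda>f. f i) (\<lambda>f. f j) s"
      unfolding tensor_map_def
    proof (intro sweedler_cong[OF VD refl] s)
      fix f g :: "'c \<Rightarrow> 'k"
      have 1: "tens ground ground (smul ground r x) y = smul ?G r (tens ground ground x y)" for r x y :: 'k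
        by (intro lin_on_smul[of ground ?G "\<lambda>x. tens ground ground x y"] tens_lin1 lin_on_id) simp_all
      have 2: "tens ground ground x (smul ground r y) = smul ?G r (tens ground ground x y)" for r x y :: 'k
        by (intro lin_on_smul[of ground ?G "tens ground ground x"] tens_lin2 lin_on_id) simp_all
      show "smul ?G (f i * g j) (tens ground ground 1 1) = tens ground ground (f i) (g j)"
        using 1[of "f i" 1 "g j"] 2[of 1 "g j" 1] by (simp add: vspace_smul_simps(6)[OF vspace_tensor])
    qed
    finally show ?thesis ..
  qed
  fix x assume "x \<in> I \<times> I"
  then show "(case x of (i, j) \<Rightarrow> tensor_map D D ground ground (\<lambda>f. f i) (\<lambda>f. f j)) t =
      (case x of (i, j) \<Rightarrow> tensor_map D D ground ground (\<lambda>f. f i) (\<lambda>f. f j)) t'"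
    by (auto simp: * t t' eq I_mem)
qed

lemma comul_D:
  assumes f: "f \<in> carrier D"
  shows "comul D f \<in> carrier (tensor D D)"
    "\<lbrakk>c \<in> carrier C; d \<in> carrier C\<rbrakk> \<Longrightarrow>
      sweedler D D (comul D f) (\<lambda>f1 f2. f1 c * f2 d) = f (ainv C (ainv C (mul C c d)))"
proof -
  have DD: "tensor (dual_space C) (dual_space C) = tensor D D"
    "sweedler (dual_space C) (dual_space C) = sweedler D D"
    by (rule vspace_cong; simp add: dual_bialg_def)+
  let ?P = "\<lambda>t. t \<in> carrier (tensor D D) \<and> (\<forall>c\<in>carrier C. \<forall>d\<in>carrier C.
      sweedler D D t (\<lambda>f1 f2. f1 c * f2 d) = f (ainv C (ainv C (mul C c d))))"
  let ?K = "\<lambda>c d. f (ainv C (ainv C (mul C c d)))"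
  have "comul D f = (THE t. t \<in> carrier (tensor (dual_space C) (dual_space C)) \<and> (\<forall>c\<in>carrier C. \<forall>d\<in>carrier C.
      sweedler (dual_space C) (dual_space C) t (\<lambda>f1 f2. f1 c * f2 d) = f (ainv C (ainv C (mul C c d)))))"
    by (simp add: dual_bialg_def alpha_pow_simps)
  then have def: "comul D f = (THE t. ?P t)"
    by (simp only: DD)
  have "\<exists>t. ?P t"
  proof (intro exI conjI ballI)
    \<comment> \<open>The multiplication table of \<open>C\<close>, written in the dual basis.\<close>
    let ?t = "\<Sum>i\<in>I. \<Sum>j\<in>I. smul (tensor D D) (?K i j) (tens D D (dual_basis i) (dual_basis j))"
    have m: "smul (tensor D D) (?K i j) (tens D D (dual_basis i) (dual_basis j)) \<in> carrier (tensor D D)"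
      if "i \<in> I" "j \<in> I" for i j
      by (intro lin dual_basis_mem that)
    show "?t \<in> carrier (tensor D D)"
      by (intro vspace_sum vspace_tensor m)
    fix c d assume c: "c \<in> carrier C" and d: "d \<in> carrier C"
    note l = pairing_lin[OF c d]
    have K1: "lin_on C ground (\<lambda>c. ?K c d)" if "d \<in> carrier C" for d
      by (intro lin_on_comp[OF D_lin[OF f]] datum_lin that)
    have K2: "lin_on C ground (?K c)" if "c \<in> carrier C" for c
      by (intro lin_on_comp[OF D_lin[OF f]] datum_lin that)
    have sm: "smul C r i \<in> carrier C" if "i \<in> I" for r i
      by (intro vspace_smul V I_mem that)
    have "sweedler D D ?t (\<lambda>f1 f2. f1 c * f2 d) = (\<Sum>i\<in>I. \<Sum>j\<in>I.
        sweedler D D (smul (tensor D D) (?K i j) (tens D D (dual_basis i) (dual_basis j))) (\<lambda>f1 f2. f1 c * f2 d))"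
      by (subst lin_on_sum[OF vspace_tensor vspace_ground l], intro vspace_sum vspace_tensor m, assumption+)
        (intro sum.cong refl lin_on_sum[OF vspace_tensor vspace_ground l] m)
    also have "\<dots> = (\<Sum>i\<in>I. \<Sum>j\<in>I. ?K (smul C (crd i c) i) (smul C (crd j d) j))"
    proof (intro sum.cong refl)
      fix i j assume i: "i \<in> I" and j: "j \<in> I"
      have "sweedler D D (tens D D (dual_basis i) (dual_basis j)) (\<lambda>f1 f2. f1 c * f2 d) = dual_basis i c * dual_basis j d"
        by (intro sweedler_tens[OF vspace_ground] lin VD eval_lin c d dual_basis_mem i j)
      then show "sweedler D D (smul (tensor D D) (?K i j) (tens D D (dual_basis i) (dual_basis j))) (\<lambda>f1 f2. f1 c * f2 d) =
          ?K (smul C (crd i c) i) (smul C (crd j d) j)"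
        using lin_on_smul[OF l tens_in_tensor[OF dual_basis_mem[OF i] dual_basis_mem[OF j]]]
        by (simp add: lin_on_smul[OF K1[OF sm[OF j]]] lin_on_smul[OF K2] I_mem i j dual_basis_def on_carrier_eq c d)
    qed
    also have "\<dots> = (\<Sum>i\<in>I. ?K (smul C (crd i c) i) (\<Sum>j\<in>I. smul C (crd j d) j))"
      by (intro sum.cong refl lin_on_sum[OF V(3) vspace_ground K2, symmetric] sm)
    also have "\<dots> = ?K (\<Sum>i\<in>I. smul C (crd i c) i) (\<Sum>j\<in>I. smul C (crd j d) j)"
      by (intro lin_on_sum[OF V(3) vspace_ground K1, symmetric] sm vspace_sum V)
    also have "\<dots> = ?K c d" by (simp only: crd_sum c d)
    finally show "sweedler D D ?t (\<lambda>f1 f2. f1 c * f2 d) = ?K c d" .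
  qed
  then obtain t where t: "?P t" ..
  have "\<exists>!t. ?P t"
  proof (rule ex1I[where P = ?P and a = t])
    show "?P t" by (rule t)
    fix t' assume t': "?P t'"
    show "t' = t" by (rule pairing_inj) (use t t' in auto)
  qed
  from theI'[OF this, folded def]
  show "comul D f \<in> carrier (tensor D D)"
    "\<lbrakk>c \<in> carrier C; d \<in> carrier C\<rbrakk> \<Longrightarrow>
      sweedler D D (comul D f) (\<lambda>f1 f2. f1 c * f2 d) = f (ainv C (ainv C (mul C c d)))" by auto
qed

lemma comul_D_lin: "lin_on D (tensor D D) (comul D)"
proof (rule lin_onI)
  fix f g r assume f: "f \<in> carrier D" and g: "g \<in> carrier D"
  show "comul D f \<in> carrier (tensor D D)" using comul_D(1)[OF f] .
  show "comul D (f + g) = comul D f + comul D g"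
    by (rule pairing_inj)
      (simp_all del: plus_fun_apply add: comul_D vspace_add[OF VD] vspace_add[OF vspace_tensor] f g
        lin_on_add[OF pairing_lin], simp)
  show "comul D (smul D r f) = smul (tensor D D) r (comul D f)"
    by (rule pairing_inj)
      (simp_all add: comul_D vspace_smul[OF VD] vspace_smul[OF vspace_tensor] f
        lin_on_smul[OF pairing_lin], simp add: D_simps fun_smul_def)
qed

subsection \<open>Evaluation\<close>

abbreviation B0 where "B0 \<equiv> tensor A D"
abbreviation B where "B \<equiv> smash H A \<rho> C act"

lemma V0: "vspace B0"
  by (rule vspace_tensor)

lemma B_simps:
  "carrier B = carrier B0" "smul B = smul B0"
  "alpha B = tensor_map A D A D (alpha A) (alpha D)"
  "one B = tens A D (one A) (one D)"
  "counit B t = sweedler A D t (\<lambda>a f. counit A a * f (one C))"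
  "comul B t = sweedler A D t (\<lambda>a f. SwA a (\<lambda>a1 a2. sweedler D D (comul D f) (\<lambda>f1 f2.
     tens B0 B0 (tens A D a1 f1) (tens A D a2 f2))))"
  "mul B s t = sweedler A D s (\<lambda>a f. sweedler A D t (\<lambda>a' f'. SwR a' (\<lambda>x0 x1.
     tens A D (mul A a (ainv A x0)) (mul D (dual_act C act (ainv D f) (ainv H (ainv H x1))) f'))))"
  by (simp_all add: smash_def Let_def alpha_pow_simps)

lemma vspace_B:
  "tens B B = tens B0 B0" "tensor B B = tensor B0 B0" "sweedler B B = sweedler B0 B0"
  by (rule vspace_cong; simp add: B_simps)+

text \<open>Evaluation is shifted by \<open>\<alpha>\<close>.  In the smash product \<open>h\<close> acts on \<open>C\<close> as the untwisted action of \<open>\<alpha>(h)\<close>;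
  the shift conjugates this into the untwisted action of \<open>h\<close> itself, which is the one in the conditions
  on \<open>Q\<close>.\<close>

definition ev :: "'c \<Rightarrow> ('a, 'c \<Rightarrow> 'k, 'k) tensor \<Rightarrow> 'a" where
  "ev c b = sweedler A D b (\<lambda>a f. smul A (f (alpha C c)) a)"

lemma D_comp: "f \<in> carrier D \<Longrightarrow> lin_on X C g \<Longrightarrow> lin_on X ground (\<lambda>x. f (g x))"
  using lin_on_comp[OF D_lin] .

lemma ev_bilin: "c \<in> carrier C \<Longrightarrow> bilin_on A D A (\<lambda>a f. smul A (f (alpha C c)) a)"
  by (intro datum_lin VD eval_lin)

lemma ev_tens: "\<lbrakk>c \<in> carrier C; a \<in> carrier A; f \<in> carrier D\<rbrakk> \<Longrightarrow>
    ev c (tens A D a f) = smul A (f (alpha C c)) a"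
  unfolding ev_def by (rule sweedler_tens[OF V(1) ev_bilin])

lemma ev_lin_B: "c \<in> carrier C \<Longrightarrow> lin_on B0 A (ev c)"
  unfolding ev_def by (intro sweedler_lin_on V ev_bilin)

lemma ev_lin_C: "b \<in> carrier B0 \<Longrightarrow> lin_on C A (\<lambda>c. ev c b)"
  unfolding ev_def
  by (rule lin_on_sweedler_fun[OF V(1) V(1)], assumption)
    (intro lin_on_rsmul[OF V(1)] D_comp C.alpha_linear)

lemma ev_lin1: "b \<in> carrier B0 \<Longrightarrow> lin_on X C g \<Longrightarrow> lin_on X A (\<lambda>x. ev (g x) b)"
  using lin_on_comp[OF ev_lin_C] .

lemma ev_lin2: "c \<in> carrier C \<Longrightarrow> lin_on X B0 g \<Longrightarrow> lin_on X A (\<lambda>x. ev c (g x))"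
  using lin_on_comp[OF ev_lin_B] .

lemma ev_mem: "c \<in> carrier C \<Longrightarrow> b \<in> carrier B0 \<Longrightarrow> ev c b \<in> carrier A"
  using lin_on_mem[OF ev_lin_B] .

text \<open>The action of \<open>H\<close> on functionals in the product of the smash product, \<open>\<alpha>\<inverse>(f) \<leftharpoonup> \<alpha>\<^sup>-\<^sup>2(h)\<close>, with the
  powers of \<open>\<alpha>\<close> collected.\<close>

definition dact :: "('c \<Rightarrow> 'k) \<Rightarrow> 'h \<Rightarrow> 'c \<Rightarrow> 'k" where
  "dact f h = on_carrier C (\<lambda>c. f (act (ainv H h) (ainv C c)))"

lemma dual_act_eq:
  assumes f: "f \<in> carrier D" and h: "h \<in> carrier H"
  shows "dual_act C act (ainv D f) (ainv H (ainv H h)) = dact f h"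
proof -
  have "ainv D f (act (ainv H (ainv H h)) (ainv C (ainv C c))) = f (act (ainv H h) (ainv C c))"
    if "c \<in> carrier C" for c
    using h that by (simp add: ainv_D[OF f] on_carrier_eq mem alpha_act inv)
  then show ?thesis
    unfolding dual_act_def dact_def by (auto simp: on_carrier_def alpha_pow_simps)
qed

lemma dact_bilinear: "bilin_on D H D dact"
proof -
  have l: "lin_on C ground (\<lambda>c. f (act (ainv H h) (ainv C c)))" if "f \<in> carrier D" "h \<in> carrier H" for f h
    using that by (intro D_comp datum_lin)
  have l': "lin_on H ground (\<lambda>h. f (act (ainv H h) (ainv C c)))" if "f \<in> carrier D" "c \<in> carrier C" for f c
    using that by (intro D_comp datum_lin)
  show ?thesis
    unfolding dact_def by (intro bilin_onI lin_on_DI l l' VD V eval_lin act_mem ainv_mem C.ainv_mem)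
qed

lemmas smash_lin = datum_lin VD one_D_mem D.alpha_mem bilin_on_lin1[OF mul_D_bilinear] bilin_on_lin2[OF mul_D_bilinear]
  bilin_on_mem[OF mul_D_bilinear] bilin_on_lin1[OF dact_bilinear] bilin_on_lin2[OF dact_bilinear]
  bilin_on_mem[OF dact_bilinear] lin_on_comp[OF comul_D_lin] comul_D(1) ev_lin1 ev_lin2 ev_mem eval_lin

lemma mul_B:
  assumes "s \<in> carrier B0" "t \<in> carrier B0"
  shows "mul B s t = sweedler A D s (\<lambda>a f. sweedler A D t (\<lambda>a' f'. SwR a' (\<lambda>x0 x1.
     tens A D (mul A a (ainv A x0)) (mul D (dact f x1) f'))))"
  unfolding B_simps using assms
  by (intro cong_A coact_mem) (simp_all add: dual_act_eq)

lemma mul_B_bilinear: "bilin_on B0 B0 B0 (mul B)"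
proof -
  have "bilin_on B0 B0 B0 (\<lambda>s t. sweedler A D s (\<lambda>a f. sweedler A D t (\<lambda>a' f'. SwR a' (\<lambda>x0 x1.
     tens A D (mul A a (ainv A x0)) (mul D (dact f x1) f')))))"
    by (intro smash_lin)
  then show ?thesis
    unfolding bilin_on_def using lin_on_cong[OF V0] mul_B by (simp add: lin_on_def vspace_add[OF V0] vspace_smul[OF V0])
qed

lemma comul_B_lin: "lin_on B0 (tensor B0 B0) (comul B)"
  unfolding B_simps by (intro smash_lin)

text \<open>Both sides are bilinear, and on pure tensors both are
  \<open>f(\<alpha>\<inverse>(a'\<^sub>1) \<cdot> \<alpha>\<inverse>(c\<^sub>1)) f'(c\<^sub>2) (a \<alpha>\<inverse>(a'\<^sub>0))\<close> with \<open>c\<^sub>1 \<otimes> c\<^sub>2 = \<Delta>(\<alpha>\<inverse>(c))\<close>.\<close>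

lemma ev_mul:
  assumes c: "c \<in> carrier C" and s: "s \<in> carrier B0" and t: "t \<in> carrier B0"
  shows "ev c (mul B s t) = alpha A (SuC (ainv C c) (\<lambda>c1 c2.
    SuR (ev c2 t) (\<lambda>x0 x1. umul A (ev (uact C act x1 c1) s) x0)))" (is "_ = ?r s t")
proof -
  note ul = bilin_on_lin1[OF A.umul_bilinear] bilin_on_lin2[OF A.umul_bilinear] bilin_on_mem[OF A.umul_bilinear]
    bilin_on_lin1[OF uact_bilinear] bilin_on_lin2[OF uact_bilinear] bilin_on_mem[OF uact_bilinear]
    lin_on_comp[OF C.ucomul_linear] lin_on_mem[OF C.ucomul_linear] lin_on_comp[OF ucoact_linear] lin_on_mem[OF ucoact_linear]
  have l1: "lin_on B0 A (\<lambda>s. ?r s t)" if "t \<in> carrier B0" for t using that c by (intro smash_lin ul)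
  have l2: "lin_on B0 A (?r s)" if "s \<in> carrier B0" for s using that c by (intro smash_lin ul)
  have m1: "lin_on B0 A (\<lambda>s. ev c (mul B s t))" if "t \<in> carrier B0" for t
    using that by (intro lin_on_comp[OF ev_lin_B[OF c]] bilin_on_lin1[OF mul_B_bilinear] lin)
  have m2: "lin_on B0 A (\<lambda>t. ev c (mul B s t))" if "s \<in> carrier B0" for s
    using that by (intro lin_on_comp[OF ev_lin_B[OF c]] bilin_on_lin2[OF mul_B_bilinear] lin)
  have pure: "ev c (mul B (tens A D a f) (tens A D a' f')) = ?r (tens A D a f) (tens A D a' f')"
    if m: "a \<in> carrier A" "f \<in> carrier D" "a' \<in> carrier A" "f' \<in> carrier D" for a f a' f'
  proof -
    let ?k = "\<lambda>c1 c2 x0 x1. smul A (f (act (ainv H x1) (ainv C c1)) * f' c2) (mul A a (ainv A x0))"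
    have "mul B (tens A D a f) (tens A D a' f') =
      sweedler A D (tens A D a' f') (\<lambda>a' f'. SwR a' (\<lambda>x0 x1.
        tens A D (mul A a (ainv A x0)) (mul D (dact f x1) f')))"
      using m by (subst mul_B) (intro smash_lin sweedler_tens[OF vspace_tensor[of A D]]; assumption)+
    also have "\<dots> = SwR a' (\<lambda>x0 x1. tens A D (mul A a (ainv A x0)) (mul D (dact f x1) f'))"
      using m by (intro sweedler_tens[OF vspace_tensor[of A D]] smash_lin)
    finally have "ev c (mul B (tens A D a f) (tens A D a' f')) =
      ev c (SwR a' (\<lambda>x0 x1. tens A D (mul A a (ainv A x0)) (mul D (dact f x1) f')))"
      by (rule arg_cong)
    also have "\<dots> = SwR a' (\<lambda>x0 x1. ev c (tens A D (mul A a (ainv A x0)) (mul D (dact f x1) f')))"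
      using m by (intro lin_on_sweedler[OF ev_lin_B[OF c]] smash_lin)
    also have "\<dots> = SwR a' (\<lambda>x0 x1. SwC (ainv C c) (\<lambda>c1 c2. ?k c1 c2 x0 x1))"
    proof (intro cong_A coact_mem m)
      fix x0 x1 assume x: "x0 \<in> carrier A" "x1 \<in> carrier H"
      have d: "dact f x1 \<in> carrier D" using m x by (intro smash_lin)
      have y: "mul A a (ainv A x0) \<in> carrier A" using m x by (simp add: mem)
      have "mul D (dact f x1) f' (alpha C c) =
        SwC (alpha C c) (\<lambda>c1 c2. dact f x1 (ainv C (ainv C c1)) * f' (ainv C (ainv C c2)))"
        unfolding D_simps using c by (simp add: on_carrier_eq mem)
      also have "\<dots> = SwC c (\<lambda>c1 c2.
          dact f x1 (ainv C (ainv C (alpha C c1))) * f' (ainv C (ainv C (alpha C c2))))"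
        using c d m by (intro C.sweedler_comul_alpha[OF vspace_ground] smash_lin D_comp[OF d] D_comp[OF m(4)])
      also have "\<dots> = SwC (alpha C (ainv C c)) (\<lambda>c1 c2. dact f x1 (ainv C c1) * f' (ainv C c2))"
        using c by (simp only: inv) (intro cong_C C.comul_mem; simp add: inv)
      also have "\<dots> = SwC (ainv C c) (\<lambda>c1 c2.
          dact f x1 (ainv C (alpha C c1)) * f' (ainv C (alpha C c2)))"
        using c d m by (intro C.sweedler_comul_alpha[OF vspace_ground] smash_lin D_comp[OF d] D_comp[OF m(4)])
      also have "\<dots> = SwC (ainv C c) (\<lambda>c1 c2. f (act (ainv H x1) (ainv C c1)) * f' c2)"
        using c by (intro cong_C C.comul_mem C.ainv_mem) (simp_all add: inv dact_def on_carrier_eq mem)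
      finally have "ev c (tens A D (mul A a (ainv A x0)) (mul D (dact f x1) f')) =
        smul A (SwC (ainv C c) (\<lambda>c1 c2. f (act (ainv H x1) (ainv C c1)) * f' c2)) (mul A a (ainv A x0))"
        using c m x d y by (simp add: ev_tens bilin_on_mem[OF mul_D_bilinear])
      also have "\<dots> = SwC (ainv C c) (\<lambda>c1 c2. ?k c1 c2 x0 x1)"
        using c y by (intro lin_on_sweedler[OF lin_on_rsmul[OF V(1) lin_on_id y]] smash_lin) simp_all
      finally show "ev c (tens A D (mul A a (ainv A x0)) (mul D (dact f x1) f')) = \<dots>" .
    qed
    also have "\<dots> = SwC (ainv C c) (\<lambda>c1 c2. SwR a' (?k c1 c2))"
      by (rule sweedler_swap)
    finally have left: "ev c (mul B (tens A D a f) (tens A D a' f')) = \<dots>" .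
    let ?F = "\<lambda>c1 c2. SwR (ainv A (ev c2 (tens A D a' f'))) (\<lambda>x0 x1.
        umul A (ev (uact C act x1 c1) (tens A D a f)) x0)"
    have "?r (tens A D a f) (tens A D a' f') = alpha A (SwC (ainv C (ainv C c)) ?F)"
      by (simp add: ucomul_def ucoact_def)
    also have "SwC (ainv C (ainv C c)) ?F =
      SwC (ainv C c) (\<lambda>c1 c2. ?F (ainv C c1) (ainv C c2))"
      using c m by (intro C.sweedler_comul_ainv[OF V(1)] smash_lin ul)
    also have "alpha A \<dots> = SwC (ainv C c) (\<lambda>c1 c2. alpha A (?F (ainv C c1) (ainv C c2)))"
      using c m by (intro lin_on_sweedler[OF A.alpha_linear] smash_lin ul)
    also have "\<dots> = SwC (ainv C c) (\<lambda>c1 c2. SwR a' (?k c1 c2))"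
    proof (intro cong_C C.comul_mem C.ainv_mem c)
      fix c1 c2 assume cc: "c1 \<in> carrier C" "c2 \<in> carrier C"
      let ?G = "\<lambda>x0 x1. umul A (ev (uact C act x1 (ainv C c1)) (tens A D a f)) x0"
      have G: "?G x0 x1 = smul A (f (act x1 (ainv C c1))) (umul A a x0)"
        if x: "x0 \<in> carrier A" "x1 \<in> carrier H" for x0 x1
      proof -
        have "lin_on A A (\<lambda>y. umul A y x0)" using x by (intro smash_lin ul)
        from lin_on_smul[OF this m(1)] show ?thesis
          using x cc m by (simp add: ev_tens uact_def mem inv)
      qed
      have l: "lin_on A A (\<lambda>y. alpha A (SwR (ainv A y) ?G))"
        using cc m by (intro smash_lin ul)
      have "alpha A (?F (ainv C c1) (ainv C c2)) = smul A (f' c2) (alpha A (SwR (ainv A a') ?G))"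
        using lin_on_smul[OF l m(3)] cc m by (simp add: ev_tens mem inv)
      also have "SwR (ainv A a') ?G = SwR a' (\<lambda>x0 x1. ?G (ainv A x0) (ainv H x1))"
        using cc m by (intro sweedler_coact_ainv[OF V(1)] smash_lin ul)
      also have "smul A (f' c2) (alpha A \<dots>) = SwR a' (\<lambda>x0 x1. smul A (f' c2) (alpha A (?G (ainv A x0) (ainv H x1))))"
        using cc m by (intro lin_on_sweedler[OF lin_on_lsmul[OF V(1) A.alpha_linear]] smash_lin ul)
      also have "\<dots> = SwR a' (?k c1 c2)"
        using m cc by (intro cong_A coact_mem)
          (simp_all add: G mem lin_on_smul[OF A.alpha_linear] bilin_on_mem[OF A.umul_bilinear] A.alpha_umul_eq_mul
            vspace_smul_simps(6)[OF V(1)] mult.commute)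
      finally show "alpha A (?F (ainv C c1) (ainv C c2)) = \<dots>" .
    qed
    finally show ?thesis using left by simp
  qed
  have half: "ev c (mul B (tens A D a f) t) = ?r (tens A D a f) t" if m: "a \<in> carrier A" "f \<in> carrier D" for a f
  proof (rule lin_on_tensor_eqI[OF V(1) V(1) m2 l2 pure t])
    show "tens A D a f \<in> carrier B0" "tens A D a f \<in> carrier B0" by (intro lin m)+
  qed (rule m | assumption)+
  show ?thesis
    by (rule lin_on_tensor_eqI[OF V(1) V(1) m1[OF t] l1[OF t] half s])
qed

lemma ev_comul:
  assumes c: "c \<in> carrier C" and d: "d \<in> carrier C" and b: "b \<in> carrier B0"
  shows "tensor_map B0 B0 A A (ev c) (ev d) (comul B b) = comul A (ev (ainv C (umul C c d)) b)"
proof -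
  note VT = vspace_tensor[of A A]
  have z: "ainv C (umul C c d) \<in> carrier C" using c d by (simp add: umul_def mem)
  have T: "lin_on (tensor B0 B0) (tensor A A) (tensor_map B0 B0 A A (ev c) (ev d))"
    using c d by (intro lin ev_lin_B)
  show ?thesis
  proof (rule lin_on_tensor_eqI[OF V(1) VT _ _ _ b])
    show "lin_on B0 (tensor A A) (\<lambda>b. tensor_map B0 B0 A A (ev c) (ev d) (comul B b))"
      by (rule lin_on_comp[OF T comul_B_lin])
    show "lin_on B0 (tensor A A) (\<lambda>b. comul A (ev (ainv C (umul C c d)) b))"
      by (rule lin_on_comp[OF A.comul_linear ev_lin_B[OF z]])
    fix a f assume a: "a \<in> carrier A" and f: "f \<in> carrier D"
    let ?r = "f (ainv C (ainv C (mul C (alpha C c) (alpha C d))))"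
    have "comul B (tens A D a f) = SwA a (\<lambda>a1 a2. sweedler D D (comul D f) (\<lambda>f1 f2.
        tens B0 B0 (tens A D a1 f1) (tens A D a2 f2)))"
      unfolding B_simps using a f by (intro sweedler_tens[OF vspace_tensor[of B0 B0]] smash_lin)
    then have "tensor_map B0 B0 A A (ev c) (ev d) (comul B (tens A D a f)) =
        tensor_map B0 B0 A A (ev c) (ev d) (SwA a (\<lambda>a1 a2. sweedler D D (comul D f) (\<lambda>f1 f2.
        tens B0 B0 (tens A D a1 f1) (tens A D a2 f2))))"
      by (rule arg_cong)
    also have "\<dots> = SwA a (\<lambda>a1 a2. sweedler D D (comul D f) (\<lambda>f1 f2.
        tensor_map B0 B0 A A (ev c) (ev d) (tens B0 B0 (tens A D a1 f1) (tens A D a2 f2))))"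
      using a f by (intro lin_on_sweedler2[OF T] smash_lin)
    also have "\<dots> = SwA a (\<lambda>a1 a2. smul (tensor A A) ?r (tens A A a1 a2))"
    proof (intro cong_A A.comul_mem a)
      fix a1 a2 assume m: "a1 \<in> carrier A" "a2 \<in> carrier A"
      have t1: "tens A A (smul A r x) y = smul (tensor A A) r (tens A A x y)"
        if "x \<in> carrier A" "y \<in> carrier A" for r x y
        using lin_on_smul[of A "tensor A A" "\<lambda>a. tens A A a y"] that by (simp add: tens_lin1 lin_on_id)
      have t2: "tens A A x (smul A r y) = smul (tensor A A) r (tens A A x y)"
        if "x \<in> carrier A" "y \<in> carrier A" for r x y
        using lin_on_smul[of A "tensor A A" "tens A A x"] that by (simp add: tens_lin2 lin_on_id)
      have "sweedler D D (comul D f) (\<lambda>f1 f2.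
          tensor_map B0 B0 A A (ev c) (ev d) (tens B0 B0 (tens A D a1 f1) (tens A D a2 f2))) =
        sweedler D D (comul D f) (\<lambda>f1 f2. smul (tensor A A) (f1 (alpha C c) * f2 (alpha C d)) (tens A A a1 a2))"
        using m c d f by (intro sweedler_cong[OF VD refl] comul_D)
          (simp_all add: tensor_map_tens[OF ev_lin_B ev_lin_B] tens_in_tensor ev_tens t1 t2 vspace_smul[OF V(1)]
            vspace_smul_simps(6)[OF VT] mult.commute)
      also have "\<dots> = smul (tensor A A) (sweedler D D (comul D f) (\<lambda>f1 f2. f1 (alpha C c) * f2 (alpha C d))) (tens A A a1 a2)"
        using m f by (intro lin_on_sweedler[OF lin_on_rsmul[OF VT lin_on_id], symmetric] smash_lin) simp_all
      also have "\<dots> = smul (tensor A A) ?r (tens A A a1 a2)"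
        using c d f by (simp add: comul_D mem)
      finally show "sweedler D D (comul D f) (\<lambda>f1 f2.
          tensor_map B0 B0 A A (ev c) (ev d) (tens B0 B0 (tens A D a1 f1) (tens A D a2 f2))) = \<dots>" .
    qed
    also have "\<dots> = smul (tensor A A) ?r (SwA a (tens A A))"
      using a by (intro lin_on_sweedler[OF lin_on_lsmul[OF VT lin_on_id], symmetric] smash_lin)
    also have "\<dots> = comul A (ev (ainv C (umul C c d)) (tens A D a f))"
    proof -
      have "ainv C (ainv C (mul C (alpha C c) (alpha C d))) = umul C c d"
        using c d by (simp add: umul_def C.ainv_mul mem inv)
      then show ?thesis
        using a f z c d
        by (simp add: ev_tens sweedler_tens_self[OF V(1) A.comul_mem] lin_on_smul[OF A.comul_linear] inv umul_def mem)
    qed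
    finally show "tensor_map B0 B0 A A (ev c) (ev d) (comul B (tens A D a f)) =
      comul A (ev (ainv C (umul C c d)) (tens A D a f))" .
  qed
qed

lemma lin_on_B: "lin_on B W = lin_on B0 W" "lin_on W' B = lin_on W' B0"
  by (simp_all add: fun_eq_iff lin_on_def B_simps(1,2))

lemma ev_alpha:
  assumes c: "c \<in> carrier C" and b: "b \<in> carrier B0"
  shows "ev c (alpha B b) = alpha A (ev (ainv C c) b)"
proof -
  have "ev c (alpha B b) = sweedler A D b (\<lambda>a f. smul A (alpha D f (alpha C c)) (alpha A a))"
    unfolding ev_def B_simps using b c
    by (intro sweedler_tensor_map[OF V(1) V(1) V(1) A.alpha_linear D.alpha_linear] ev_bilin)
  also have "\<dots> = sweedler A D b (\<lambda>a f. alpha A (smul A (f (alpha C (ainv C c))) a))"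
    using c by (intro sweedler_cong[OF V(1) refl b])
      (simp add: lin_on_smul[OF A.alpha_linear] D_simps on_carrier_eq mem inv)
  also have "\<dots> = alpha A (ev (ainv C c) b)"
    unfolding ev_def by (intro lin_on_sweedler[OF A.alpha_linear, symmetric] V b vspace_smul)
  finally show ?thesis .
qed

lemma counit_ev:
  assumes b: "b \<in> carrier B0"
  shows "counit B b = counit A (ev (one C) b)"
proof -
  have "counit A (ev (one C) b) = sweedler A D b (\<lambda>a f. counit A (smul A (f (alpha C (one C))) a))"
    unfolding ev_def by (intro lin_on_sweedler[OF A.counit_linear] V b vspace_smul vspace_ground)
  also have "\<dots> = counit B b"
    unfolding B_simps by (intro sweedler_cong[OF V(1) refl b])
      (simp add: lin_on_smul[OF A.counit_linear] C.alpha_one mult.commute)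
  finally show ?thesis ..
qed

text \<open>The functionals of the dual basis are moved by \<open>\<alpha>\<close> to compensate the shift in evaluation.\<close>

definition lft :: "'c \<Rightarrow> 'a \<Rightarrow> ('a, 'c \<Rightarrow> 'k, 'k) tensor" where
  "lft i a = tens A D a (alpha D (dual_basis i))"

lemma lft_lin: "i \<in> I \<Longrightarrow> lin_on A B0 (lft i)"
  unfolding lft_def by (intro lin D.alpha_mem dual_basis_mem)

lemma lft_ev:
  assumes b: "b \<in> carrier B0"
  shows "(\<Sum>i\<in>I. lft i (ev i b)) = b"
proof (rule lin_on_tensor_eqI[OF V(1) V0 _ lin_on_id _ b])
  show "lin_on B0 B0 (\<lambda>b. \<Sum>i\<in>I. lft i (ev i b))"
    by (intro lin_on_sumI V0 lin_on_comp[OF lft_lin ev_lin_B] I_mem)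
  fix a f assume a: "a \<in> carrier A" and f: "f \<in> carrier D"
  let ?g = "ainv D f"
  have g: "?g \<in> carrier D" by (intro D.ainv_mem f)
  have l: "lin_on D B0 (tens A D a)" by (intro lin a)
  have t: "tens A D (smul A r a) x = smul B0 r (tens A D a x)" "tens A D a (smul D r x) = smul B0 r (tens A D a x)"
    if "x \<in> carrier D" for r x
    using lin_on_smul[of A B0 "\<lambda>a. tens A D a x"] lin_on_smul[OF l] a that by (simp_all add: tens_lin1 lin_on_id)
  have "(\<Sum>i\<in>I. lft i (ev i (tens A D a f))) = (\<Sum>i\<in>I. tens A D a (alpha D (smul D (?g i) (dual_basis i))))"
    by (intro sum.cong refl)
      (simp add: lft_def ev_tens a f I_mem t dual_basis_mem D.alpha_mem ainv_D on_carrier_eq lin_on_smul[OF D.alpha_linear])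
  also have "\<dots> = tens A D a (alpha D (\<Sum>i\<in>I. smul D (?g i) (dual_basis i)))"
    by (intro lin_on_sum[OF VD V0 lin_on_comp[OF l D.alpha_linear], symmetric] vspace_smul[OF VD] dual_basis_mem)
  also have "(\<Sum>i\<in>I. smul D (?g i) (dual_basis i)) = ?g"
    using reconstruction_D g by (simp add: reconstruction_def)
  finally show "(\<Sum>i\<in>I. lft i (ev i (tens A D a f))) = tens A D a f"
    by (simp add: D.alpha_ainv f)
qed

lemma smash_evaluation: "smash_evaluation A H C (umul A) (one A) (ucomul A) (counit A) (umul H) (one H) (ucomul H)
    (counit H) (umul C) (one C) (ucomul C) (counit C) (ucoact A \<rho>) (uact C act)
    (alpha A) (ainv A) (alpha H) (alpha C) (ainv C) B ev I (\<lambda>i. i) crd lft"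
proof (intro smash_evaluation.intro smash_evaluation_axioms.intro ordinary)
  show "vspace B"
    using V0 by (simp add: vspace_def vspace_axioms_def B_simps(1,2))
  show "lin_on B B (alpha B)"
    unfolding lin_on_B B_simps by (intro lin V A.alpha_linear D.alpha_linear)
  show "bilin_on B B B (mul B)"
    using mul_B_bilinear by (simp add: bilin_on_def lin_on_B B_simps(1))
  show "one B \<in> carrier B"
    unfolding B_simps by (intro lin A.one_carrier one_D_mem)
  show "lin_on B (tensor B B) (comul B)"
    unfolding lin_on_B vspace_B by (rule comul_B_lin)
  show "lin_on C A (\<lambda>c. ev c b)" if "b \<in> carrier B" for b
    using that by (simp add: B_simps(1) ev_lin_C)
  show "lin_on B A (ev c)" if "c \<in> carrier C" for c
    using that by (simp add: lin_on_B ev_lin_B)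
  show "ev c (alpha B b) = alpha A (ev (ainv C c) b)" if "c \<in> carrier C" "b \<in> carrier B" for b c
    using that by (simp only: B_simps(1) ev_alpha)
  show "ev c (mul B b b') = alpha A (ordinary_datum.conv A H C (umul A) (ucomul C) (ucoact A \<rho>) (uact C act)
      (\<lambda>x. ev x b) (\<lambda>x. ev x b') (ainv C c))"
    if "c \<in> carrier C" "b \<in> carrier B" "b' \<in> carrier B" for b b' c
    using that by (simp only: B_simps(1) ev_mul ordinary_datum.conv_def[OF ordinary])
  show "ev c (one B) = smul A (counit C c) (one A)" if "c \<in> carrier C" for c
    using that by (simp add: B_simps(4) ev_tens A.one_carrier one_D_mem)
      (simp add: D_simps on_carrier_eq mem C.counit_alpha)
  show "tensor_map B B A A (ev c) (ev d) (comul B b) = ucomul A (alpha A (ev (ainv C (umul C c d)) b))"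
    if "c \<in> carrier C" "d \<in> carrier C" "b \<in> carrier B" for b c d
  proof -
    have "tensor_map B B A A (ev c) (ev d) (comul B b) = tensor_map B0 B0 A A (ev c) (ev d) (comul B b)"
      by (simp only: tensor_map_def vspace_B)
    then show ?thesis
      using that by (simp add: ev_comul B_simps(1) ucomul_def inv ev_mem umul_def mem)
  qed
  show "counit B b = counit A (ev (one C) b)" if "b \<in> carrier B" for b
    using that by (simp only: B_simps(1) counit_ev)
  show "lin_on A B (lft i)" if "i \<in> I" for i
    using that by (simp add: lin_on_B lft_lin)
  show "ev c (lft i a) = smul A (crd i c) a" if "i \<in> I" "c \<in> carrier C" "a \<in> carrier A" for i c a
    using that by (simp add: lft_def ev_tens D.alpha_mem dual_basis_mem)
      (simp add: D_simps on_carrier_eq dual_basis_def mem inv)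
  show "(\<Sum>i\<in>I. lft i (ev i b)) = b" if "b \<in> carrier B" for b
    using that by (simp only: B_simps(1) lft_ev)
qed (use fin_I I_mem crd_sum in \<open>simp_all add: A.alpha_linear A.ainv_linear alpha_linear C.alpha_linear C.ainv_linear
    inv A.alpha_umul A.alpha_one A.ucomul_alpha A.counit_alpha ucoact_alpha C.ainv_umul C.ainv_one C.ucomul_ainv
    C.counit_ainv ainv_uact\<close>)

end

lemma finite_coordinates:
  fixes C :: "('k::field, 'c::ab_group_add, 'z) vspace_scheme"
  assumes "vspace C" "finite_dimensional C"
  obtains I crd where "finite I" "I \<subseteq> carrier C" "\<And>i. lin_on C ground (crd i)"
    "\<And>c. c \<in> carrier C \<Longrightarrow> (\<Sum>i\<in>I. smul C (crd i c) i) = c"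
proof -
  interpret C: vspace C by fact
  obtain X where X: "finite X" "carrier C = C.span X"
    using assms(2) by (auto simp: finite_dimensional_def)
  obtain I where I: "I \<subseteq> X" "C.independent I" "X \<subseteq> C.span I"
    by (rule C.maximal_independent_subset)
  have fin: "finite I" using X(1) I(1) by (rule rev_finite_subset)
  have span: "carrier C = C.span I"
    using X(2) I C.span_mono[OF I(1)] C.span_minimal[OF I(3) C.subspace_span] by blast
  show thesis
  proof (rule that[of I "\<lambda>i c. C.representation I c i"])
    show "I \<subseteq> carrier C" unfolding span by (rule C.span_superset)
    show "lin_on C ground (\<lambda>c. C.representation I c i)" for i
      by (rule lin_onI) (simp_all add: span C.representation_add C.representation_scale I(2))
    show "(\<Sum>i\<in>I. smul C (C.representation I c i) i) = c" if "c \<in> carrier C" for c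
      using that unfolding span by (intro C.sum_representation_eq I(2) fin order_refl)
  qed (rule fin)
qed

theorem mainTheorem10:
  fixes H :: "('k::field, 'h::ab_group_add) hom_bialg"
    and S :: "'h \<Rightarrow> 'h"
    and A :: "('k, 'a::ab_group_add) hom_bialg"
    and \<rho> :: "'a \<Rightarrow> ('a, 'h, 'k) tensor"
    and C :: "('k, 'c::ab_group_add) hom_bialg"
    and act :: "'h \<Rightarrow> 'c \<Rightarrow> 'c"
    and Q :: "('c, 'c, 'k) tensor \<Rightarrow> ('a, 'a, 'k) tensor"
  assumes datum: "monoidal_doi_hopf_datum H S A \<rho> C act"
    and fin_dim: "finite_dimensional C"
    and Q_linear: "lin_on (tensor C C) (tensor A A) Q"
    and Q_alpha: "\<forall>t\<in>carrier (tensor C C).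
          Q (tensor_map C C C C (alpha C) (alpha C) t)
            = tensor_map A A A A (alpha A) (alpha A) (Q t)"
    and Q_invertible: "twisted_convolution_invertible A C Q"
    and cond1: "\<forall>a\<in>carrier A. \<forall>c\<in>carrier C. \<forall>d\<in>carrier C.
          sweedler A A (comul A a) (\<lambda>a1 a2.
            sweedler A H (\<rho> a1) (\<lambda>a10 a11. sweedler A H (\<rho> a2) (\<lambda>a20 a21.
              mul (tensor_alg A A) (Q (tens C C (act a21 d) (act a11 c)))
                (tens A A (alpha A a20) (alpha A a10)))))
          = mul (tensor_alg A A) (comul A (alpha_pow A 2 a)) (Q (tens C C (alpha C d) (alpha C c)))"
    and cond2: "\<forall>c\<in>carrier C. \<forall>d\<in>carrier C.
          sweedler C C (comul C c) (\<lambda>c1 c2. sweedler C C (comul C d) (\<lambda>d1 d2.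
            tens (tensor A A) C (Q (tens C C d1 c1)) (alpha_pow C (-3) (mul C c2 d2))))
          = sweedler C C (comul C c) (\<lambda>c1 c2. sweedler C C (comul C d) (\<lambda>d1 d2.
              sweedler (tensor A A) (tensor H H)
                (coact2 H A \<rho> (Q (tens C C (alpha_pow C (-1) d2) (alpha_pow C (-1) c2))))
                (\<lambda>q0 q1. tens (tensor A A) C q0
                  (alpha_pow C (-4) (mul_map C (act2 H C act q1 (tens C C d1 c1)))))))"
    and cond3: "\<forall>c\<in>carrier C. \<forall>d\<in>carrier C. \<forall>e\<in>carrier C.
          sweedler A A
            (Q (tens C C (mul C (alpha_pow C (-2) d) (alpha_pow C (-1) e)) (alpha_pow C (-1) c)))
            (\<lambda>x y. sweedler A A (comul A x) (\<lambda>x1 x2. tens3 A A A x1 x2 (alpha A y)))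
          = sweedler C C (comul C c) (\<lambda>c1 c2.
              sweedler A A (Q (tens C C (alpha_pow C (-2) d) (alpha_pow C (-3) c2))) (\<lambda>Q1 Q2.
                sweedler A H (\<rho> Q2) (\<lambda>Q20 Q21.
                  tens A (tensor A A) (alpha_pow A 2 Q1)
                    (mul (tensor_alg A A)
                      (Q (tens C C e (act (alpha_pow H (-1) Q21) (alpha_pow C (-3) c1))))
                      (tens A A (one A) Q20)))))"
    and cond4: "\<forall>c\<in>carrier C. \<forall>d\<in>carrier C. \<forall>e\<in>carrier C.
          sweedler A A
            (Q (tens C C (alpha_pow C (-1) e) (mul C (alpha_pow C (-1) c) (alpha_pow C (-2) d))))
            (\<lambda>x y. tens A (tensor A A) (alpha A x) (comul A y))
          = sweedler C C (comul C e) (\<lambda>e1 e2.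
              sweedler A A (Q (tens C C (alpha_pow C (-3) e2) (alpha_pow C (-2) d))) (\<lambda>Q1 Q2.
                sweedler A H (\<rho> Q1) (\<lambda>Q10 Q11.
                  sweedler A A
                    (mul (tensor_alg A A)
                      (Q (tens C C (act (alpha_pow H (-1) Q11) (alpha_pow C (-3) e1)) c))
                      (tens A A Q10 (one A)))
                    (\<lambda>x y. tens3 A A A x y (alpha_pow A 2 Q2)))))"
  shows "quasitriangular_hom_bialgebra (smash H A \<rho> C act)"
proof -
  interpret datum: monoidal_doi_hopf_datum H S A \<rho> C act by (rule datum)
  interpret Q: braided_hom_datum H S A \<rho> C act Q
    by unfold_locales (use Q_linear Q_alpha cond1 cond2 cond3 cond4 in blast)+
  obtain I crd where I: "finite I" "I \<subseteq> carrier C" "\<And>i. lin_on C ground (crd i)"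
    "\<And>c. c \<in> carrier C \<Longrightarrow> (\<Sum>i\<in>I. smul C (crd i c) i) = c"
    using finite_coordinates[OF datum.V(3) fin_dim] by blast
  interpret X: coordinatized_datum H S A \<rho> C act I crd
    by unfold_locales (use I in auto)
  show ?thesis
    by (rule braided_smash_evaluation.quasitriangular_B[OF braided_smash_evaluation.intro,
          OF X.smash_evaluation Q.ordinary_braided])
qed

end
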